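(* Let $W$ be a Weyl group, $\mathbb{S}_\omega$ a right $\mathbb{Z}[W]$-lattice such that $V_\omega=\mathbb{S}_\omega\otimes\mathbb{Q}$ is an irreducible representation of $W$, $\lambda\in V_\omega$ a weight of $\mathbb{S}_\omega$, and $\pi:Z\to X$ a Galois covering of smooth projective curves with group $W$. Let $H=\mathrm{Stab}(\lambda)$, $Y=Z/H$ and $d=[W:H]$. Then the Kanev correspondence $\overline{K}_\lambda$ on $Y$ satisfies the cubic equation $$(\overline{K}_\lambda-\overline{\Delta})(\overline{K}_\lambda+(q_\lambda-1)\overline{\Delta})(\overline{K}_\lambda-\deg\overline{K}_\lambda\,\overline{\Delta})=0,\qquad q_\lambda=-\frac{d\cdot(\lambda,\lambda)}{\dim V_\omega}\in\mathbb{N},$$ where $\overline{\Delta}$ is the diagonal of $Y\times Y$.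
   Context: Curves are smooth and projective over $\mathbb{C}$. $W$ acts from the right on $Z$ ($z\mapsto z^g$, $z^{gh}=(z^g)^h$). A lattice is a free abelian group of finite rank. A weight of $\mathbb{S}_\omega$ is a vector $\lambda\in V_\omega$ with $\lambda g-\lambda\in\mathbb{S}_\omega$ for all $g\in W$; $\mathrm{Stab}(\lambda)=\{g\in W:\lambda g=\lambda\}$. $(\ ,\ )$ is the unique negative definite $W$-invariant symmetric form on $V_\omega$ such that (1) $(\lambda,\mu)\in\mathbb{Z}$ for all $\mu\in\mathbb{S}_\omega$, and (2) every $W$-invariant form satisfying (1) is an integer multiple of $(\ ,\ )$. Let $\varphi:Z\to Y$ be the quotient map, $\psi:Y\to X$ the induced map, and $g_1=1,\dots,g_d$ representatives of the right cosets: $W=\bigcup_iHg_i$. Kanev correspondence: let $U\subset X$ be the complement of the branch locus of $\pi$. For $\xi\in U$ choose $z_\xi\in\pi^{-1}(\xi)$; this gives a bijection $\mu:\psi^{-1}(\xi)\to\{\lambda g_1,\dots,\lambda g_d\}$, $\varphi(z_\xi^{g^{-1}})\mapsto\lambda g$ (other choices of $z_\xi$ change $\mu$ by right multiplication by an element of $W$). $\overline{K}_\lambda$ is the closure in $Y\times Y$ of the divisor which, as a map $y\mapsto\overline{K}_\lambda(y)\in\mathrm{Div}(Y)$ on $\psi^{-1}(U)$, is $\overline{K}_\lambda(y)=\sum_{j=1}^d[(\lambda g_j,\mu(y))-(\lambda,\lambda)-1]\mu^{-1}(\lambda g_j)+y$. It is an integral symmetric effective correspondence independent of choices. $\deg\overline{K}_\lambda$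 is the degree of the divisor $\overline{K}_\lambda(y)$. Products are compositions of correspondences, i.e. of the induced endomorphisms of $\mathrm{Div}_{\mathbb{Q}}(Y)$; $\overline{\Delta}$ is the identity.
   Formalization: That q_λ is a natural number is claimed only when λ lies in S_ω or W acts nontrivially on V_ω; otherwise it fails (S_ω = Z with trivial action, λ = 1/2 gives q_λ = 1/2). The cubic equation is claimed without this restriction. *)

theory Defs
  imports
    "HOL-Analysis.Analysis"
    "HOL-Algebra.Bij"
    "HOL-Algebra.Elementary_Groups"
    "HOL-Library.Poly_Mapping"
begin

section \<open>Complex projective space with its two topologies\<close>

text \<open>For an index type \<open>'n\<close> with \<open>N + 1\<close> elements, \<open>'n cproj\<close> is \<open>N\<close>-dimensional complex
  projective space: the set of lines in \<open>complex^'n\<close>.\<close>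

typedef 'n cproj = "{L :: (complex^'n::finite) set. \<exists>v. v \<noteq> 0 \<and> L = range (\<lambda>c. c *s v)}"
  morphisms line_of Abs_cproj
proof -
  have "(1 :: complex^'n) \<noteq> 0" by simp
  then show ?thesis by blast
qed

definition cproj_point :: "complex^'n::finite \<Rightarrow> 'n cproj" where
  "cproj_point v = Abs_cproj (range (\<lambda>c. c *s v))"

text \<open>The type class topology is the classical one (the quotient topology of \<open>complex^'n - {0}\<close>).
  In particular \<^const>\<open>closure\<close> on \<open>'n cproj \<times> 'n cproj\<close> is the classical closure; for
  constructible sets it agrees with the Zariski closure.\<close>

instantiation cproj :: (finite) topological_space
begin

definition open_cproj_def:
  "open (U :: 'a cproj set) \<longleftrightarrow> open {v. v \<noteq> 0 \<and> cproj_point v \<in> U}"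

instance
proof
  have "{v. v \<noteq> 0 \<and> cproj_point v \<in> (UNIV :: 'a cproj set)} = - {0}" by auto
  then show "open (UNIV :: 'a cproj set)"
    unfolding open_cproj_def by (simp add: open_Compl)
next
  fix S T :: "'a cproj set"
  assume "open S" "open T"
  moreover have "{v. v \<noteq> 0 \<and> cproj_point v \<in> S \<inter> T}
    = {v. v \<noteq> 0 \<and> cproj_point v \<in> S} \<inter> {v. v \<noteq> 0 \<and> cproj_point v \<in> T}" by auto
  ultimately show "open (S \<inter> T)"
    unfolding open_cproj_def by (simp add: open_Int)
next
  fix K :: "'a cproj set set"
  assume "\<forall>S\<in>K. open S"
  moreover have "{v. v \<noteq> 0 \<and> cproj_point v \<in> \<Union>K}
    = (\<Union>S\<in>K. {v. v \<noteq> 0 \<and> cproj_point v \<in> S})" by auto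
  ultimately show "open (\<Union>K)"
    unfolding open_cproj_def by auto
qed

end

definition homogeneous_poly :: "nat \<Rightarrow> (complex^'n::finite \<Rightarrow> complex) \<Rightarrow> bool" where
  "homogeneous_poly d f \<longleftrightarrow>
    (\<exists>(A :: ('n \<Rightarrow> nat) set) c. finite A \<and> (\<forall>a\<in>A. (\<Sum>i\<in>UNIV. a i) = d) \<and>
      f = (\<lambda>x. \<Sum>a\<in>A. c a * (\<Prod>i\<in>UNIV. (x $ i) ^ a i)))"

definition vanishes_at :: "(complex^'n::finite \<Rightarrow> complex) \<Rightarrow> 'n cproj \<Rightarrow> bool" where
  "vanishes_at f p \<longleftrightarrow> (\<forall>x\<in>line_of p. x \<noteq> 0 \<longrightarrow> f x = 0)"

definition zariski_closed :: "'n::finite cproj set \<Rightarrow> bool" where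
  "zariski_closed A \<longleftrightarrow>
    (\<exists>F. (\<forall>f\<in>F. \<exists>d. homogeneous_poly d f) \<and> A = {p. \<forall>f\<in>F. vanishes_at f p})"


section \<open>Smooth projective curves and regular maps\<close>

definition projective_variety :: "'n::finite cproj set \<Rightarrow> bool" where
  "projective_variety Z \<longleftrightarrow> zariski_closed Z \<and> Z \<noteq> {} \<and>
    (\<forall>A B. zariski_closed A \<and> zariski_closed B \<and> Z \<subseteq> A \<union> B \<longrightarrow> Z \<subseteq> A \<or> Z \<subseteq> B)"

text \<open>The second and third conjunct say that the Krull dimension of \<open>Z\<close>, i.e. the supremum of the
  lengths of chains of irreducible closed subsets, is 1.\<close>

definition projective_curve :: "'n::finite cproj set \<Rightarrow> bool" where
  "projective_curve Z \<longleftrightarrow> projective_variety Z \<and>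
    (\<exists>A. projective_variety A \<and> A \<subset> Z) \<and>
    \<not> (\<exists>A B. projective_variety A \<and> projective_variety B \<and> A \<subset> B \<and> B \<subset> Z)"

text \<open>The tangent space, at the nonzero points of the line \<open>p\<close>, of the affine cone over \<open>Z\<close>. Its
  dimension is one more than that of the Zariski tangent space of \<open>Z\<close> at \<open>p\<close>, so that the Jacobian
  criterion for a curve requires dimension 2.\<close>

definition cone_tangent_space :: "'n::finite cproj set \<Rightarrow> 'n cproj \<Rightarrow> (complex^'n) set" where
  "cone_tangent_space Z p =
    {v. \<forall>d f x. homogeneous_poly d f \<and> (\<forall>q\<in>Z. vanishes_at f q) \<and> x \<in> line_of p \<and> x \<noteq> 0
          \<longrightarrow> deriv (\<lambda>t. f (x + t *s v)) 0 = 0}"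

definition smooth_projective_curve :: "'n::finite cproj set \<Rightarrow> bool" where
  "smooth_projective_curve Z \<longleftrightarrow>
    projective_curve Z \<and> (\<forall>p\<in>Z. vec.dim (cone_tangent_space Z p) = 2)"

definition regular_map ::
  "'n::finite cproj set \<Rightarrow> 'm::finite cproj set \<Rightarrow> ('n cproj \<Rightarrow> 'm cproj) \<Rightarrow> bool" where
  "regular_map Z X f \<longleftrightarrow> f ` Z \<subseteq> X \<and>
    (\<forall>p\<in>Z. \<exists>C d F. zariski_closed C \<and> p \<notin> C \<and> (\<forall>i. homogeneous_poly d (\<lambda>x. F x $ i)) \<and>
      (\<forall>q\<in>Z - C. \<forall>x\<in>line_of q. x \<noteq> 0 \<longrightarrow> F x \<noteq> 0 \<and> f q = cproj_point (F x)))"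


section \<open>Group actions, quotients and Galois coverings\<close>

definition right_action :: "('g, 'b) monoid_scheme \<Rightarrow> 'a set \<Rightarrow> ('a \<Rightarrow> 'g \<Rightarrow> 'a) \<Rightarrow> bool" where
  "right_action W A act \<longleftrightarrow>
    (\<forall>a\<in>A. \<forall>g\<in>carrier W. act a g \<in> A) \<and>
    (\<forall>a\<in>A. act a \<one>\<^bsub>W\<^esub> = a) \<and>
    (\<forall>a\<in>A. \<forall>g\<in>carrier W. \<forall>h\<in>carrier W. act a (g \<otimes>\<^bsub>W\<^esub> h) = act (act a g) h)"

definition stabilizer_in :: "('g, 'b) monoid_scheme \<Rightarrow> ('a \<Rightarrow> 'g \<Rightarrow> 'a) \<Rightarrow> 'a \<Rightarrow> 'g set" where
  "stabilizer_in W act a = {g \<in> carrier W. act a g = a}"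

text \<open>\<open>Y\<close> together with \<open>\<phi>\<close> is the quotient of \<open>Z\<close> by \<open>H\<close>. As \<open>Y\<close> is smooth and the
  characteristic is 0, a surjective morphism whose fibres are the orbits determines \<open>Y\<close> up to
  isomorphism.\<close>

definition curve_quotient ::
  "('n::finite cproj \<Rightarrow> 'g \<Rightarrow> 'n cproj) \<Rightarrow> 'g set \<Rightarrow> 'n cproj set \<Rightarrow> 'm::finite cproj set
    \<Rightarrow> ('n cproj \<Rightarrow> 'm cproj) \<Rightarrow> bool" where
  "curve_quotient act H Z Y \<phi> \<longleftrightarrow>
    smooth_projective_curve Z \<and> smooth_projective_curve Y \<and> regular_map Z Y \<phi> \<and> \<phi> ` Z = Y \<and>
    (\<forall>z\<in>Z. \<forall>z'\<in>Z. \<phi> z = \<phi> z' \<longleftrightarrow> (\<exists>h\<in>H. z' = act z h))"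

definition galois_covering ::
  "('g, 'b) monoid_scheme \<Rightarrow> ('n::finite cproj \<Rightarrow> 'g \<Rightarrow> 'n cproj) \<Rightarrow> 'n cproj set
    \<Rightarrow> 'm::finite cproj set \<Rightarrow> ('n cproj \<Rightarrow> 'm cproj) \<Rightarrow> bool" where
  "galois_covering W act Z X \<pi> \<longleftrightarrow>
    right_action W Z act \<and>
    (\<forall>g\<in>carrier W. regular_map Z Z (\<lambda>z. act z g)) \<and>
    (\<forall>g\<in>carrier W. (\<forall>z\<in>Z. act z g = z) \<longrightarrow> g = \<one>\<^bsub>W\<^esub>) \<and>
    curve_quotient act (carrier W) Z X \<pi>"

text \<open>A non-constant morphism of smooth complex curves is unramified at \<open>z\<close> iff it is injective
  on a classical neighbourhood of \<open>z\<close>.\<close>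

definition branch_locus ::
  "'n::finite cproj set \<Rightarrow> ('n cproj \<Rightarrow> 'm::finite cproj) \<Rightarrow> 'm cproj set" where
  "branch_locus Z \<pi> = \<pi> ` {z \<in> Z. \<not> (\<exists>N. open N \<and> z \<in> N \<and> inj_on \<pi> (N \<inter> Z))}"


section \<open>Weyl groups\<close>

definition root_reflection :: "'e::euclidean_space \<Rightarrow> 'e \<Rightarrow> 'e" where
  "root_reflection a x = x - (2 * (x \<bullet> a) / (a \<bullet> a)) *\<^sub>R a"

text \<open>The roots are not required to span the ambient space; this does not affect which abstract
  groups arise.\<close>

definition root_system :: "'e::euclidean_space set \<Rightarrow> bool" where
  "root_system R \<longleftrightarrow> finite R \<and> 0 \<notin> R \<and>
    (\<forall>a\<in>R. root_reflection a ` R = R) \<and>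
    (\<forall>a\<in>R. \<forall>b\<in>R. 2 * (b \<bullet> a) / (a \<bullet> a) \<in> \<int>) \<and>
    (\<forall>a\<in>R. \<forall>c. c *\<^sub>R a \<in> R \<longrightarrow> c = 1 \<or> c = -1)"

definition weyl_group :: "'e::euclidean_space set \<Rightarrow> ('e \<Rightarrow> 'e) monoid" where
  "weyl_group R = subgroup_generated (BijGroup UNIV) (root_reflection ` R)"


section \<open>Lattices, weights and the invariant form\<close>

text \<open>A free abelian group \<open>S\<close> of rank \<open>CARD('r)\<close> inside \<open>S \<otimes> \<rat> = \<rat>\<^sup>r\<close>.\<close>

definition full_lattice :: "(rat^'r::finite) set \<Rightarrow> bool" where
  "full_lattice S \<longleftrightarrow> (\<exists>E. vec.independent E \<and> vec.span E = UNIV \<and>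
    S = range (\<lambda>c. \<Sum>e\<in>E. rat_of_int (c e) *s e))"

definition linear_right_action ::
  "('g, 'b) monoid_scheme \<Rightarrow> (rat^'r::finite \<Rightarrow> 'g \<Rightarrow> rat^'r) \<Rightarrow> bool" where
  "linear_right_action W act \<longleftrightarrow> right_action W UNIV act \<and>
    (\<forall>g\<in>carrier W. \<forall>c u v. act (c *s u + v) g = c *s act u g + act v g)"

definition lattice_with_action ::
  "('g, 'b) monoid_scheme \<Rightarrow> (rat^'r::finite \<Rightarrow> 'g \<Rightarrow> rat^'r) \<Rightarrow> (rat^'r) set \<Rightarrow> bool" where
  "lattice_with_action W act S \<longleftrightarrow> full_lattice S \<and> linear_right_action W act \<and>
    (\<forall>g\<in>carrier W. \<forall>v\<in>S. act v g \<in> S)"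

text \<open>\<open>\<rat>\<^sup>r\<close> is nonzero because index types are nonempty.\<close>

definition irreducible_action ::
  "('g, 'b) monoid_scheme \<Rightarrow> (rat^'r::finite \<Rightarrow> 'g \<Rightarrow> rat^'r) \<Rightarrow> bool" where
  "irreducible_action W act \<longleftrightarrow>
    (\<forall>T. vec.subspace T \<and> (\<forall>g\<in>carrier W. \<forall>v\<in>T. act v g \<in> T) \<longrightarrow> T = {0} \<or> T = UNIV)"

definition is_weight ::
  "('g, 'b) monoid_scheme \<Rightarrow> (rat^'r::finite \<Rightarrow> 'g \<Rightarrow> rat^'r) \<Rightarrow> (rat^'r) set \<Rightarrow> rat^'r \<Rightarrow> bool" where
  "is_weight W act S l \<longleftrightarrow> (\<forall>g\<in>carrier W. act l g - l \<in> S)"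

definition invariant_form ::
  "('g, 'b) monoid_scheme \<Rightarrow> (rat^'r::finite \<Rightarrow> 'g \<Rightarrow> rat^'r) \<Rightarrow> (rat^'r \<Rightarrow> rat^'r \<Rightarrow> rat) \<Rightarrow> bool" where
  "invariant_form W act B \<longleftrightarrow>
    (\<forall>u v. B u v = B v u) \<and>
    (\<forall>c u v w. B (c *s u + v) w = c * B u w + B v w) \<and>
    (\<forall>g\<in>carrier W. \<forall>u v. B (act u g) (act v g) = B u v)"

definition weight_form ::
  "('g, 'b) monoid_scheme \<Rightarrow> (rat^'r::finite \<Rightarrow> 'g \<Rightarrow> rat^'r) \<Rightarrow> (rat^'r) set \<Rightarrow> rat^'r
    \<Rightarrow> (rat^'r \<Rightarrow> rat^'r \<Rightarrow> rat) \<Rightarrow> bool" where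
  "weight_form W act S l B \<longleftrightarrow>
    invariant_form W act B \<and>
    (\<forall>v. v \<noteq> 0 \<longrightarrow> B v v < 0) \<and>
    (\<forall>m\<in>S. B l m \<in> \<int>) \<and>
    (\<forall>B'. invariant_form W act B' \<and> (\<forall>m\<in>S. B' l m \<in> \<int>)
       \<longrightarrow> (\<exists>k::int. B' = (\<lambda>u v. of_int k * B u v)))"


section \<open>Divisors and correspondences\<close>

definition div_Q :: "'a set \<Rightarrow> ('a \<Rightarrow>\<^sub>0 rat) set" where
  "div_Q Y = {D. Poly_Mapping.keys D \<subseteq> Y}"

definition div_scale :: "rat \<Rightarrow> ('a \<Rightarrow>\<^sub>0 rat) \<Rightarrow> ('a \<Rightarrow>\<^sub>0 rat)" where
  "div_scale c D = Poly_Mapping.map (\<lambda>x. c * x) D"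

definition div_degree :: "('a \<Rightarrow>\<^sub>0 rat) \<Rightarrow> rat" where
  "div_degree D = (\<Sum>y\<in>Poly_Mapping.keys D. Poly_Mapping.lookup D y)"

text \<open>A correspondence is given by its map \<open>y \<mapsto> T y\<close> from points to divisors.\<close>

definition corr_endo :: "('a \<Rightarrow> ('a \<Rightarrow>\<^sub>0 rat)) \<Rightarrow> ('a \<Rightarrow>\<^sub>0 rat) \<Rightarrow> ('a \<Rightarrow>\<^sub>0 rat)" where
  "corr_endo T D = (\<Sum>y\<in>Poly_Mapping.keys D. div_scale (Poly_Mapping.lookup D y) (T y))"

definition corr_degree :: "'a set \<Rightarrow> ('a \<Rightarrow> ('a \<Rightarrow>\<^sub>0 rat)) \<Rightarrow> rat" where
  "corr_degree Y T = (THE n. \<forall>y\<in>Y. div_degree (T y) = n)"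

text \<open>The intersection number of a closed (reduced) curve \<open>C \<subseteq> Y \<times> Y\<close> without fibral components
  with the fibre \<open>{y0} \<times> Y\<close> at the point \<open>(y0, y1)\<close>: the number of points of \<open>C\<close> near \<open>(y0, y1)\<close>
  lying on a neighbouring fibre \<open>{y} \<times> Y\<close>, \<open>y \<noteq> y0\<close>.\<close>

definition fibre_intersection ::
  "'a::topological_space set \<Rightarrow> ('a \<times> 'a) set \<Rightarrow> 'a \<Rightarrow> 'a \<Rightarrow> nat" where
  "fibre_intersection Y C y0 y1 =
    (THE m. \<exists>N0. open N0 \<and> y1 \<in> N0 \<and>
      (\<forall>N. open N \<and> y1 \<in> N \<and> N \<subseteq> N0 \<longrightarrow>
        (\<forall>\<^sub>F y in at y0 within Y. finite {y'\<in>N. (y, y') \<in> C} \<and> card {y'\<in>N. (y, y') \<in> C} = m)))"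

text \<open>Let \<open>k\<close> be the map \<open>y \<mapsto> k y\<close> of a divisor on \<open>V \<times> Y\<close>, for \<open>V\<close> open in \<open>Y\<close>, which is etale
  over \<open>V\<close>. The divisor is then the sum over \<open>c \<noteq> 0\<close> of \<open>c\<close> times the reduced curve
  \<open>divisor_part V k c\<close> (the union of its prime components of multiplicity \<open>c\<close>), and its closure is
  the corresponding combination of the closures of these curves. \<open>closure_corr\<close> is the map
  \<open>y \<mapsto> D \<sqdot> ({y} \<times> Y)\<close> of this closure \<open>D\<close>.\<close>

definition divisor_part :: "'a set \<Rightarrow> ('a \<Rightarrow> ('a \<Rightarrow>\<^sub>0 rat)) \<Rightarrow> rat \<Rightarrow> ('a \<times> 'a) set" where
  "divisor_part V k c = {(y, y'). y \<in> V \<and> Poly_Mapping.lookup (k y) y' = c}"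

definition closure_corr ::
  "'a::topological_space set \<Rightarrow> 'a set \<Rightarrow> ('a \<Rightarrow> ('a \<Rightarrow>\<^sub>0 rat)) \<Rightarrow> 'a \<Rightarrow> ('a \<Rightarrow>\<^sub>0 rat)" where
  "closure_corr Y V k y = Abs_poly_mapping (\<lambda>y'.
    \<Sum>c\<in>{c. c \<noteq> 0 \<and> divisor_part V k c \<noteq> {}}.
      c * of_nat (fibre_intersection Y (closure (divisor_part V k c)) y y'))"


section \<open>The Kanev correspondence\<close>

text \<open>The bijection \<open>\<mu>\<close> from the fibre of \<open>\<psi>\<close> to the orbit of \<open>l\<close> attached to the base point \<open>z\<close>.\<close>

definition kanev_mu ::
  "('g, 'b) monoid_scheme \<Rightarrow> ('z \<Rightarrow> 'g \<Rightarrow> 'z) \<Rightarrow> ('v \<Rightarrow> 'g \<Rightarrow> 'v) \<Rightarrow> 'v \<Rightarrow> ('z \<Rightarrow> 'y) \<Rightarrow> 'z \<Rightarrow> 'y \<Rightarrow> 'v" where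
  "kanev_mu W actZ actV l \<phi> z y =
    (THE v. \<exists>g\<in>carrier W. y = \<phi> (actZ z (inv\<^bsub>W\<^esub> g)) \<and> v = actV l g)"

text \<open>The divisor over \<open>\<psi> -` U\<close>. Here \<open>z \<xi>\<close> is the chosen point over \<open>\<xi>\<close> and \<open>g 1, \<dots>, g d\<close>
  are the coset representatives.\<close>

definition kanev_unramified ::
  "('g, 'b) monoid_scheme \<Rightarrow> ('z \<Rightarrow> 'g \<Rightarrow> 'z) \<Rightarrow> ('v \<Rightarrow> 'g \<Rightarrow> 'v) \<Rightarrow> ('v \<Rightarrow> 'v \<Rightarrow> rat) \<Rightarrow> 'v
    \<Rightarrow> 'y set \<Rightarrow> ('z \<Rightarrow> 'y) \<Rightarrow> ('y \<Rightarrow> 'x) \<Rightarrow> ('x \<Rightarrow> 'z) \<Rightarrow> nat \<Rightarrow> (nat \<Rightarrow> 'g) \<Rightarrow> 'y \<Rightarrow> ('y \<Rightarrow>\<^sub>0 rat)" where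
  "kanev_unramified W actZ actV B l Y \<phi> \<psi> z d g y =
    (let \<mu> = kanev_mu W actZ actV l \<phi> (z (\<psi> y));
         \<mu>inv = the_inv_into {y'\<in>Y. \<psi> y' = \<psi> y} \<mu>
     in (\<Sum>j=1..d. Poly_Mapping.single (\<mu>inv (actV l (g j)))
            (B (actV l (g j)) (\<mu> y) - B l l - 1))
        + Poly_Mapping.single y 1)"

definition kanev_correspondence ::
  "('g, 'b) monoid_scheme \<Rightarrow> ('z \<Rightarrow> 'g \<Rightarrow> 'z) \<Rightarrow> ('v \<Rightarrow> 'g \<Rightarrow> 'v) \<Rightarrow> ('v \<Rightarrow> 'v \<Rightarrow> rat) \<Rightarrow> 'v
    \<Rightarrow> 'y::topological_space set \<Rightarrow> 'x set \<Rightarrow> ('z \<Rightarrow> 'y) \<Rightarrow> ('y \<Rightarrow> 'x) \<Rightarrow> ('x \<Rightarrow> 'z) \<Rightarrow> nat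
    \<Rightarrow> (nat \<Rightarrow> 'g) \<Rightarrow> 'y \<Rightarrow> ('y \<Rightarrow>\<^sub>0 rat)" where
  "kanev_correspondence W actZ actV B l Y U \<phi> \<psi> z d g =
    closure_corr Y {y\<in>Y. \<psi> y \<in> U} (kanev_unramified W actZ actV B l Y \<phi> \<psi> z d g)"

end

theory Submission
  imports Defs "HOL-Complex_Analysis.Conformal_Mappings"
begin

text \<open>
  Index the orbit of the weight \<open>l\<close> by coset representatives \<open>g 1, \<dots>, g d\<close>, put
  \<open>x j = l g_j\<close>, and for \<open>p \<in> Z\<close> consider the points \<open>\<phi> (p g_j^{-1})\<close> of the fibre of
  \<open>\<psi>\<close> through \<open>\<phi> p\<close>. On divisors supported on these points the correspondence acts as the
  matrix \<open>1 + P - ((l, l) + 1) J\<close>, where \<open>P\<close> is the Gram matrix of the \<open>x j\<close> and all entries of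
  \<open>J\<close> are 1. The form \<open>(u, v) \<mapsto> \<Sum>j. (x j, u) (x j, v)\<close> is invariant, so the defining property
  of \<open>( , )\<close> makes it a rational multiple of \<open>( , )\<close>; comparing traces shows that the factor is \<open>-q\<close>.
  Evaluated at orbit vectors this says \<open>P\<^sup>2 = -q P\<close>. All column sums of the matrix equal the
  degree, so \<open>K - deg K\<close> maps into the vectors with sum 0. There \<open>J\<close> acts as 0, hence
  \<open>(K - 1) (K - 1 + q)\<close> acts as \<open>P\<^sup>2 + q P = 0\<close>. The number \<open>q\<close> is integral because the form above
  is integral on \<open>l\<close> and the lattice, so that the factor is an integer: modulo integers its value at
  \<open>(l, m)\<close> is \<open>(l, l)\<close> times the pairing of \<open>m\<close> with the sum of the orbit, an invariant vector
  and therefore 0 for a nontrivial irreducible action.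

  Geometrically one has to see that the matrix describes the correspondence over every point, also
  over branch points, where it is defined as a closure. The prime components of the correspondence
  are images of \<open>Z\<close> under \<open>p \<mapsto> (\<phi> p, \<phi> (p u^{-1}))\<close>. If all points of a punctured
  neighbourhood of \<open>p\<close> have trivial stabilizer, then over the points near \<open>\<phi> p\<close> the closure consists
  of distinct branches that move continuously, and counting those near a given point of the fibre
  gives the intersection number (lemmas \<open>closure_weighted_curve_fibre\<close>,
  \<open>fibre_intersection_weighted_curve\<close>, \<open>closure_corr_eq\<close>). Two facts about smooth projective
  curves in the classical topology are behind this: they have no isolated points
  (\<open>smooth_curve_islimpt\<close>), and proper Zariski closed subsets, in particular fixed point sets of
  nontrivial automorphisms, are discrete (\<open>proper_closed_subset_discrete\<close>).

  Both follow from a local parametrization by a holomorphic disc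
  (\<open>smooth_curve_parametrization\<close>). In an affine chart, smoothness at \<open>v\<close> provides equations of the
  curve whose common zero set near \<open>v\<close> is a disc \<open>\<gamma>\<close> with parameter a linear form \<open>t\<close>. It remains
  to show that every equation \<open>h\<close> of the curve vanishes on \<open>\<gamma>\<close>. Cramer's rule gives
  \<open>\<delta> (k - k v) = t k'\<close> on the zero set for every polynomial \<open>k\<close>, with a polynomial \<open>k'\<close> and
  \<open>\<delta> v = 1\<close>. Iterating from \<open>h\<close> one gets \<open>\<delta>^i h = t^i h_i\<close>; if some
  \<open>h_i v\<close> were nonzero, irreducibility of the curve would give \<open>t = 0\<close> on it, and then it would be a
  point. So \<open>h\<close> vanishes on \<open>\<gamma>\<close> to infinite order. Finally, a closed subset that accumulates at
  \<open>v\<close> contains the disc, whose Zariski closure is irreducible; as the curve has dimension 1, this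
  closure is the whole curve.
\<close>


section \<open>Polynomial functions\<close>

inductive cpoly :: "(complex^'n::finite \<Rightarrow> complex) \<Rightarrow> bool" where
  cpoly_const: "cpoly (\<lambda>x. c)"
| cpoly_coord: "cpoly (\<lambda>x. x $ i)"
| cpoly_add: "cpoly f \<Longrightarrow> cpoly g \<Longrightarrow> cpoly (\<lambda>x. f x + g x)"
| cpoly_mult: "cpoly f \<Longrightarrow> cpoly g \<Longrightarrow> cpoly (\<lambda>x. f x * g x)"

lemma cpoly_uminus: "cpoly f \<Longrightarrow> cpoly (\<lambda>x. - f x)"
  using cpoly_mult[OF cpoly_const[of "-1"]] by simp

lemma cpoly_diff: "cpoly f \<Longrightarrow> cpoly g \<Longrightarrow> cpoly (\<lambda>x. f x - g x)"
  using cpoly_add[of f "\<lambda>x. - g x"] cpoly_uminus[of g] by simp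

lemma cpoly_sum: "(\<And>i. i \<in> I \<Longrightarrow> cpoly (f i)) \<Longrightarrow> cpoly (\<lambda>x. \<Sum>i\<in>I. f i x)"
  by (induction I rule: infinite_finite_induct) (auto intro: cpoly.intros)

lemma cpoly_prod: "(\<And>i. i \<in> I \<Longrightarrow> cpoly (f i)) \<Longrightarrow> cpoly (\<lambda>x. \<Prod>i\<in>I. f i x)"
  by (induction I rule: infinite_finite_induct) (auto intro: cpoly.intros)

lemma cpoly_power: "cpoly f \<Longrightarrow> cpoly (\<lambda>x. f x ^ k)"
  by (induction k) (auto intro: cpoly.intros)

lemma cpoly_det: "(\<And>i j. cpoly (\<lambda>x. M x $ i $ j)) \<Longrightarrow> cpoly (\<lambda>x. det (M x :: complex^'m^'m::finite))"
  unfolding det_def by (intro cpoly_sum cpoly_prod cpoly_mult cpoly_const)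

lemma cpoly_continuous: "cpoly f \<Longrightarrow> continuous_on A f"
  by (induction rule: cpoly.induct) (auto intro!: continuous_intros)

lemma homogeneous_imp_cpoly: "homogeneous_poly d f \<Longrightarrow> cpoly f"
  unfolding homogeneous_poly_def
  by (elim exE conjE) (simp, intro cpoly_sum cpoly_prod cpoly_mult cpoly_const cpoly_power cpoly_coord)

text \<open>The coefficients \<open>q j x y\<close> serve two purposes: their joint continuity gives derivatives and
  injectivity, and for fixed \<open>y\<close> they are again polynomials, to which the argument can be repeated.\<close>

definition difference_quotient ::
  "(complex^'n::finite \<Rightarrow> complex) \<Rightarrow> ('n \<Rightarrow> complex^'n \<Rightarrow> complex^'n \<Rightarrow> complex) \<Rightarrow> bool" where
  "difference_quotient f q \<longleftrightarrow>
    (\<forall>j. continuous_on UNIV (\<lambda>z. q j (fst z) (snd z))) \<and> (\<forall>j y. cpoly (\<lambda>x. q j x y)) \<and>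
    (\<forall>x y. f x - f y = (\<Sum>j\<in>UNIV. q j x y * (x $ j - y $ j)))"

text \<open>A polynomial form of Hadamard's lemma; for products,
  \<open>f x g x - f y g y = f x (g x - g y) + g y (f x - f y)\<close>.\<close>

lemma cpoly_difference:
  assumes "cpoly f"
  shows "\<exists>q. difference_quotient f q"
  using assms
proof induction
  case (cpoly_const c)
  show ?case
    by (rule exI[of _ "\<lambda>j x y. 0"]) (auto simp: difference_quotient_def intro: cpoly.intros)
next
  case (cpoly_coord i)
  have "(\<Sum>j\<in>UNIV. (if j = i then 1 else 0) * (x $ j - y $ j)) = x $ i - y $ i" for x y :: "complex^'a"
  proof -
    have "(\<Sum>j\<in>UNIV. (if j = i then 1 else 0) * (x $ j - y $ j))
        = (\<Sum>j\<in>UNIV. if j = i then x $ j - y $ j else 0)"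
      by (rule sum.cong) auto
    then show ?thesis by simp
  qed
  then show ?case
    unfolding difference_quotient_def
    by (intro exI[of _ "\<lambda>j x y. if j = i then 1 else 0"] conjI allI cpoly_const continuous_on_const)
      simp
next
  case (cpoly_add f g)
  then obtain p q where p: "difference_quotient f p" and q: "difference_quotient g q" by blast
  have "difference_quotient (\<lambda>x. f x + g x) (\<lambda>j x y. p j x y + q j x y)"
    unfolding difference_quotient_def
  proof (intro conjI allI)
    show "f x + g x - (f y + g y) = (\<Sum>j\<in>UNIV. (p j x y + q j x y) * (x $ j - y $ j))" for x y
    proof -
      have "f x + g x - (f y + g y) = (f x - f y) + (g x - g y)" by simp
      then show ?thesis
        using p q unfolding difference_quotient_def by (simp add: distrib_right sum.distrib)
    qed
  qed (use p q in \<open>auto simp: difference_quotient_def intro: continuous_on_add cpoly.cpoly_add\<close>)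
  then show ?case by blast
next
  case (cpoly_mult f g)
  then obtain p q where p: "difference_quotient f p" and q: "difference_quotient g q" by blast
  have f: "continuous_on UNIV (\<lambda>z :: (complex^'a) \<times> (complex^'a). f (fst z))"
    by (rule continuous_on_compose2[OF cpoly_continuous[OF cpoly_mult.hyps(1), of UNIV]])
      (auto intro: continuous_intros)
  have g: "continuous_on UNIV (\<lambda>z :: (complex^'a) \<times> (complex^'a). g (snd z))"
    by (rule continuous_on_compose2[OF cpoly_continuous[OF cpoly_mult.hyps(2), of UNIV]])
      (auto intro: continuous_intros)
  have "difference_quotient (\<lambda>x. f x * g x) (\<lambda>j x y. f x * q j x y + g y * p j x y)"
    unfolding difference_quotient_def
  proof (intro conjI allI)
    show "f x * g x - f y * g y
        = (\<Sum>j\<in>UNIV. (f x * q j x y + g y * p j x y) * (x $ j - y $ j))" for x y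
    proof -
      have "f x * g x - f y * g y = f x * (g x - g y) + g y * (f x - f y)"
        by (simp add: algebra_simps)
      also have "\<dots> = (\<Sum>j\<in>UNIV. (f x * q j x y + g y * p j x y) * (x $ j - y $ j))"
        using p q unfolding difference_quotient_def
        by (simp add: sum_distrib_left sum.distrib distrib_right mult.assoc)
      finally show ?thesis .
    qed
    show "continuous_on UNIV (\<lambda>z. f (fst z) * q j (fst z) (snd z) + g (snd z) * p j (fst z) (snd z))" for j
      using p q unfolding difference_quotient_def
      by (intro continuous_on_add continuous_on_mult f g) auto
    show "cpoly (\<lambda>x. f x * q j x y + g y * p j x y)" for j y
      using p q cpoly_mult.hyps unfolding difference_quotient_def
      by (intro cpoly.cpoly_add cpoly.cpoly_mult cpoly_const) auto
  qed
  then show ?case by blast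
qed

lemma homogeneous_zero: "homogeneous_poly d (\<lambda>x. 0)"
  unfolding homogeneous_poly_def by (rule exI[of _ "{}"]) auto

lemma homogeneous_const: "homogeneous_poly 0 (\<lambda>x. c)"
  unfolding homogeneous_poly_def
  by (rule exI[of _ "{\<lambda>i. 0}"], rule exI[of _ "\<lambda>a. c"]) auto

lemma homogeneous_coord: "homogeneous_poly 1 (\<lambda>x. x $ i)"
proof -
  have "(\<Prod>j\<in>UNIV. (x $ j) ^ (if j = i then 1 else 0)) = x $ i" for x :: "complex^'a"
  proof -
    have "(\<Prod>j\<in>UNIV. (x $ j) ^ (if j = i then 1 else 0)) = (\<Prod>j\<in>UNIV. if j = i then x $ j else 1)"
      by (rule prod.cong) auto
    then show ?thesis by simp
  qed
  then show ?thesis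
    unfolding homogeneous_poly_def
    by (intro exI[of _ "{\<lambda>j. if j = i then 1 else 0}"] exI[of _ "\<lambda>a. 1"]) auto
qed

lemma homogeneous_add:
  assumes "homogeneous_poly d f" "homogeneous_poly d g"
  shows "homogeneous_poly d (\<lambda>x. f x + g x)"
proof -
  obtain A c where A: "finite A" "\<forall>a\<in>A. (\<Sum>i\<in>UNIV. a i) = d"
    "f = (\<lambda>x. \<Sum>a\<in>A. c a * (\<Prod>i\<in>UNIV. (x $ i) ^ a i))"
    using assms(1) unfolding homogeneous_poly_def by blast
  obtain B b where B: "finite B" "\<forall>a\<in>B. (\<Sum>i\<in>UNIV. a i) = d"
    "g = (\<lambda>x. \<Sum>a\<in>B. b a * (\<Prod>i\<in>UNIV. (x $ i) ^ a i))"
    using assms(2) unfolding homogeneous_poly_def by blast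
  define e where "e a = (if a \<in> A then c a else 0) + (if a \<in> B then b a else 0)" for a
  have "f x + g x = (\<Sum>a\<in>A \<union> B. e a * (\<Prod>i\<in>UNIV. (x $ i) ^ a i))" for x
  proof -
    have "f x = (\<Sum>a\<in>A \<union> B. (if a \<in> A then c a else 0) * (\<Prod>i\<in>UNIV. (x $ i) ^ a i))"
      unfolding A(3) by (rule sum.mono_neutral_cong_left) (use A(1) B(1) in auto)
    moreover have "g x = (\<Sum>a\<in>A \<union> B. (if a \<in> B then b a else 0) * (\<Prod>i\<in>UNIV. (x $ i) ^ a i))"
      unfolding B(3) by (rule sum.mono_neutral_cong_left) (use A(1) B(1) in auto)
    ultimately show ?thesis by (simp add: e_def distrib_right sum.distrib)
  qed
  then show ?thesis
    unfolding homogeneous_poly_def using A(1,2) B(1,2)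
    by (intro exI[of _ "A \<union> B"] exI[of _ e]) auto
qed

lemma homogeneous_sum:
  "(\<And>i. i \<in> I \<Longrightarrow> homogeneous_poly d (f i)) \<Longrightarrow> homogeneous_poly d (\<lambda>x. \<Sum>i\<in>I. f i x)"
  by (induction I rule: infinite_finite_induct) (auto intro: homogeneous_add homogeneous_zero)

lemma homogeneous_mult:
  assumes "homogeneous_poly d f" "homogeneous_poly e g"
  shows "homogeneous_poly (d + e) (\<lambda>x. f x * g x)"
proof -
  obtain A c where A: "finite A" "\<forall>a\<in>A. (\<Sum>i\<in>UNIV. a i) = d"
    "f = (\<lambda>x. \<Sum>a\<in>A. c a * (\<Prod>i\<in>UNIV. (x $ i) ^ a i))"
    using assms(1) unfolding homogeneous_poly_def by blast
  obtain B b where B: "finite B" "\<forall>a\<in>B. (\<Sum>i\<in>UNIV. a i) = e"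
    "g = (\<lambda>x. \<Sum>a\<in>B. b a * (\<Prod>i\<in>UNIV. (x $ i) ^ a i))"
    using assms(2) unfolding homogeneous_poly_def by blast
  have mono: "homogeneous_poly (d + e) (\<lambda>x. (c u * (\<Prod>i\<in>UNIV. (x $ i) ^ u i)) *
      (b v * (\<Prod>i\<in>UNIV. (x $ i) ^ v i)))" if "u \<in> A" "v \<in> B" for u v
    unfolding homogeneous_poly_def
    by (rule exI[of _ "{\<lambda>i. u i + v i}"], rule exI[of _ "\<lambda>a. c u * b v"])
      (use A(2) B(2) that in \<open>auto simp: sum.distrib prod.distrib power_add fun_eq_iff\<close>)
  show ?thesis
    unfolding A(3) B(3) sum_product by (intro homogeneous_sum mono)
qed

lemma homogeneous_scale: "homogeneous_poly d f \<Longrightarrow> homogeneous_poly d (\<lambda>x. c * f x)"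
  using homogeneous_mult[OF homogeneous_const[of c], of d f] by simp

lemma homogeneous_power: "homogeneous_poly d f \<Longrightarrow> homogeneous_poly (k * d) (\<lambda>x. f x ^ k)"
  by (induction k) (auto intro: homogeneous_const[of 1] homogeneous_mult)

lemma homogeneous_poly_smult:
  assumes "homogeneous_poly d f"
  shows "f (c *s x) = c ^ d * f x"
proof -
  obtain A b where A: "finite A" "\<forall>a\<in>A. (\<Sum>i\<in>UNIV. a i) = d"
    "f = (\<lambda>x. \<Sum>a\<in>A. b a * (\<Prod>i\<in>UNIV. (x $ i) ^ a i))"
    using assms unfolding homogeneous_poly_def by blast
  show ?thesis unfolding A(3) sum_distrib_left
    by (rule sum.cong) (use A(2) in \<open>auto simp: power_mult_distrib prod.distrib power_sum[symmetric]\<close>)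
qed

text \<open>The bilinear pairing of vectors, so that \<open>pairing a\<close> runs through all linear forms (the inner
  product of \<open>complex^'n\<close> is real-valued and not complex bilinear).\<close>

definition pairing :: "complex^'n \<Rightarrow> complex^'n \<Rightarrow> complex" where
  "pairing a x = (\<Sum>i\<in>UNIV. a $ i * x $ i)"

lemma pairing_linear:
  "pairing a (x + y) = pairing a x + pairing a y" "pairing a (x - y) = pairing a x - pairing a y"
  "pairing a (c *s x) = c * pairing a x" "pairing a 0 = 0"
  by (simp_all add: pairing_def algebra_simps sum.distrib sum_subtractf sum_distrib_left)

lemma homogeneous_pairing: "homogeneous_poly 1 (pairing a)"
  unfolding pairing_def by (intro homogeneous_sum homogeneous_scale homogeneous_coord)

text \<open>On the affine hyperplane where a linear form \<open>L\<close> equals 1, multiplying by powers of \<open>L\<close> changes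
  nothing, so summands can be brought to a common degree. This allows working with arbitrary
  polynomials in a chart.\<close>

lemma homogenization:
  assumes "cpoly f"
  obtains d F where "homogeneous_poly d F" "\<And>x. pairing L x = 1 \<Longrightarrow> F x = f x"
proof -
  have up: "\<exists>G. homogeneous_poly e G \<and> (\<forall>x. pairing L x = 1 \<longrightarrow> G x = F x)"
    if "homogeneous_poly d F" "d \<le> e" for d e F
    using homogeneous_mult[OF homogeneous_power[OF homogeneous_pairing[of L], of "e - d"] that(1)] that(2)
    by (intro exI[of _ "\<lambda>x. pairing L x ^ (e - d) * F x"]) auto
  have "\<exists>d F. homogeneous_poly d F \<and> (\<forall>x. pairing L x = 1 \<longrightarrow> F x = f x)"
    using assms
  proof induction
    case (cpoly_const c)
    show ?case using homogeneous_const by blast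
  next
    case (cpoly_coord i)
    show ?case using homogeneous_coord by blast
  next
    case (cpoly_add f g)
    then obtain d e F G where "homogeneous_poly d F" "\<forall>x. pairing L x = 1 \<longrightarrow> F x = f x"
      "homogeneous_poly e G" "\<forall>x. pairing L x = 1 \<longrightarrow> G x = g x" by blast
    moreover obtain F' where "homogeneous_poly (max d e) F'" "\<forall>x. pairing L x = 1 \<longrightarrow> F' x = F x"
      using up[of d F "max d e"] calculation by auto
    moreover obtain G' where "homogeneous_poly (max d e) G'" "\<forall>x. pairing L x = 1 \<longrightarrow> G' x = G x"
      using up[of e G "max d e"] calculation by auto
    ultimately show ?case using homogeneous_add[of "max d e" F' G'] by fastforce
  next
    case (cpoly_mult f g)
    then obtain d e F G where "homogeneous_poly d F" "\<forall>x. pairing L x = 1 \<longrightarrow> F x = f x"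
      "homogeneous_poly e G" "\<forall>x. pairing L x = 1 \<longrightarrow> G x = g x" by blast
    then show ?case using homogeneous_mult[of d F e G] by fastforce
  qed
  then show ?thesis using that by metis
qed


section \<open>Points of projective space\<close>

lemma line_of_cproj_point: "v \<noteq> 0 \<Longrightarrow> line_of (cproj_point v) = range (\<lambda>c. c *s v)"
  unfolding cproj_point_def by (rule Abs_cproj_inverse) auto

lemma cproj_point_cases:
  obtains v where "v \<noteq> 0" "p = cproj_point v"
proof -
  obtain v where "v \<noteq> 0" "line_of p = range (\<lambda>c. c *s v)" using line_of[of p] by auto
  then have "v \<noteq> 0" "p = cproj_point v"
    using line_of_inverse[of p] by (auto simp: cproj_point_def)
  then show ?thesis using that by blast
qed

lemma cproj_point_eq_iff:
  assumes "v \<noteq> 0" "w \<noteq> 0"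
  shows "cproj_point v = cproj_point w \<longleftrightarrow> (\<exists>c. w = c *s v)"
proof
  assume "cproj_point v = cproj_point w"
  then have "range (\<lambda>c. c *s v) = range (\<lambda>c. c *s w)"
    using line_of_cproj_point assms by metis
  moreover have "w \<in> range (\<lambda>c. c *s w)" by (metis rangeI vector_smult_lid)
  ultimately show "\<exists>c. w = c *s v" by auto
next
  assume "\<exists>c. w = c *s v"
  then obtain c where c: "w = c *s v" by blast
  with assms have "c \<noteq> 0" by auto
  have "range (\<lambda>a. a *s v) = range (\<lambda>a. a *s w)"
  proof (intro equalityI subsetI; clarify)
    fix a
    have "a *s v = (a / c) *s w" using c \<open>c \<noteq> 0\<close> by (simp add: vector_smult_assoc)
    then show "a *s v \<in> range (\<lambda>a. a *s w)" by blast
    show "a *s w \<in> range (\<lambda>a. a *s v)" using c by (auto simp: vector_smult_assoc)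
  qed
  then show "cproj_point v = cproj_point w" by (simp add: cproj_point_def)
qed

lemma cproj_point_smult: "v \<noteq> 0 \<Longrightarrow> c \<noteq> 0 \<Longrightarrow> cproj_point (c *s v) = cproj_point v"
  by (subst eq_commute, subst cproj_point_eq_iff) (auto simp: vector_mul_eq_0)

lemma nonzero_in_line_iff:
  "v \<noteq> 0 \<Longrightarrow> x \<in> line_of (cproj_point v) \<and> x \<noteq> 0 \<longleftrightarrow> (\<exists>c. c \<noteq> 0 \<and> x = c *s v)"
  by (auto simp: line_of_cproj_point vector_mul_eq_0)

lemma mem_line_cproj_point: "v \<noteq> 0 \<Longrightarrow> v \<in> line_of (cproj_point v)"
  using nonzero_in_line_iff[of v v] by (metis one_neq_zero vector_smult_lid)

lemma vanishes_at_cproj_point: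
  assumes "homogeneous_poly d f" "v \<noteq> 0"
  shows "vanishes_at f (cproj_point v) \<longleftrightarrow> f v = 0"
proof
  assume "vanishes_at f (cproj_point v)"
  then show "f v = 0" using mem_line_cproj_point assms(2) by (auto simp: vanishes_at_def)
next
  assume "f v = 0"
  then have "f (c *s v) = 0" for c using homogeneous_poly_smult[OF assms(1)] by simp
  then show "vanishes_at f (cproj_point v)"
    using assms(2) by (auto simp: vanishes_at_def line_of_cproj_point)
qed

lemma vanishes_at_mult: 
  assumes "homogeneous_poly d f" "homogeneous_poly e g"
  shows "vanishes_at (\<lambda>x. f x * g x) p \<longleftrightarrow> vanishes_at f p \<or> vanishes_at g p"
proof -
  obtain v where v: "v \<noteq> 0" "p = cproj_point v" by (rule cproj_point_cases)
  then show ?thesis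
    using vanishes_at_cproj_point[OF homogeneous_mult[OF assms]] vanishes_at_cproj_point[OF assms(1)]
      vanishes_at_cproj_point[OF assms(2)] by auto
qed


section \<open>The classical topology of projective space\<close>

text \<open>The saturation of an open set under the scalars is a union of its images under homotheties.\<close>

lemma open_cproj_point_image:
  assumes "open O'" "0 \<notin> O'"
  shows "open (cproj_point ` O')"
proof -
  have "{v. v \<noteq> 0 \<and> cproj_point v \<in> cproj_point ` O'} = (\<Union>c\<in>-{0}. (\<lambda>v. c *s v) -` O')"
  proof (intro equalityI subsetI; clarify)
    fix v w assume "v \<noteq> 0" "w \<in> O'" "cproj_point v = cproj_point w"
    moreover from this have "w \<noteq> 0" using assms(2) by auto
    ultimately obtain c where "w = c *s v" using cproj_point_eq_iff by blast
    moreover from this have "c \<noteq> 0" using \<open>w \<noteq> 0\<close> by auto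
    ultimately show "v \<in> (\<Union>c\<in>-{0}. (\<lambda>v. c *s v) -` O')" using \<open>w \<in> O'\<close> by auto
  next
    fix v c assume "c \<noteq> 0" "c *s v \<in> O'"
    moreover from this have "v \<noteq> 0" using assms(2) by auto
    ultimately show "v \<noteq> 0 \<and> cproj_point v \<in> cproj_point ` O'"
      using cproj_point_smult by (metis imageI)
  qed
  moreover have "continuous_on UNIV (\<lambda>v. c *s v)" for c :: complex and v :: "complex^'a"
    unfolding vector_scalar_mult_def by (intro continuous_intros)
  then have "open ((\<lambda>v. c *s v) -` O')" for c
    by (rule open_vimage[OF assms(1)])
  ultimately show ?thesis unfolding open_cproj_def by auto
qed

lemma continuous_on_cproj_point: "continuous_on (-{0}) cproj_point"
  unfolding continuous_on_open_vimage[OF open_Compl[OF closed_singleton]]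
proof (intro allI impI)
  fix U :: "'a cproj set" assume "open U"
  moreover have "cproj_point -` U \<inter> -{0} = {v. v \<noteq> 0 \<and> cproj_point v \<in> U}" by auto
  ultimately show "open (cproj_point -` U \<inter> -{0})" by (simp add: open_cproj_def)
qed

lemma range_sphere_cproj: "cproj_point ` sphere 0 1 = (UNIV :: 'n::finite cproj set)"
proof (intro equalityI subsetI)
  fix p :: "'n cproj"
  obtain v where v: "v \<noteq> 0" "p = cproj_point v" by (rule cproj_point_cases)
  have "inverse (norm v) *\<^sub>R v = (complex_of_real (inverse (norm v))) *s v"
    unfolding vec_eq_iff vector_scaleR_component vector_smult_component
    by (simp add: scaleR_conv_of_real)
  then have "cproj_point (inverse (norm v) *\<^sub>R v) = p"
    using v by (simp add: cproj_point_smult)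
  moreover have "inverse (norm v) *\<^sub>R v \<in> sphere 0 1" using v by simp
  ultimately show "p \<in> cproj_point ` sphere 0 1" by blast
qed auto

lemma compact_UNIV_cproj: "compact (UNIV :: 'n::finite cproj set)"
proof -
  have "compact (cproj_point ` sphere (0 :: complex^'n) 1)"
    by (rule compact_continuous_image)
      (auto intro: continuous_on_subset[OF continuous_on_cproj_point])
  then show ?thesis by (simp add: range_sphere_cproj)
qed

lemma zariski_closed_imp_closed:
  assumes "zariski_closed A"
  shows "closed A"
proof -
  obtain F where F: "\<forall>f\<in>F. \<exists>d. homogeneous_poly d f" "A = {p. \<forall>f\<in>F. vanishes_at f p}"
    using assms unfolding zariski_closed_def by blast
  have "{v. v \<noteq> 0 \<and> cproj_point v \<in> - A} = (\<Union>f\<in>F. -{0} \<inter> f -` (-{0}))"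
    using F vanishes_at_cproj_point by (auto; blast)
  moreover have "open (f -` (-{0}))" if "f \<in> F" for f
    using F(1) that cpoly_continuous[OF homogeneous_imp_cpoly] by (intro open_vimage) auto
  ultimately have "open (- A)" unfolding open_cproj_def
    by (auto intro!: open_UN open_Int)
  then show ?thesis by (simp add: closed_def)
qed

lemma minors_vanish_iff:
  assumes "v \<noteq> (0 :: complex^'n)"
  shows "(\<forall>i j. v $ i * w $ j = v $ j * w $ i) \<longleftrightarrow> (\<exists>c. w = c *s v)"
proof
  assume *: "\<forall>i j. v $ i * w $ j = v $ j * w $ i"
  obtain i where i: "v $ i \<noteq> 0" using assms by (auto simp: vec_eq_iff)
  define c where "c = w $ i / v $ i"
  have "w $ j = c * v $ j" for j
    using *[rule_format, of i j] i by (simp add: c_def field_simps)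
  then have "w = c *s v" by (simp add: vec_eq_iff)
  then show "\<exists>c. w = c *s v" by blast
qed auto

lemma zariski_closed_point: "zariski_closed {p}"
proof -
  obtain v where v: "v \<noteq> 0" "p = cproj_point v" by (rule cproj_point_cases)
  define F where "F = {\<lambda>x. v $ i * x $ j - v $ j * x $ i | i j. True}"
  have hom: "homogeneous_poly 1 (\<lambda>x. v $ i * x $ j - v $ j * x $ i)" for i j
    using homogeneous_add[OF homogeneous_scale[OF homogeneous_coord, of "v $ i" j]
        homogeneous_scale[OF homogeneous_coord, of "- v $ j" i]] by simp
  have "q = p \<longleftrightarrow> (\<forall>f\<in>F. vanishes_at f q)" for q
  proof -
    obtain w where w: "w \<noteq> 0" "q = cproj_point w" by (rule cproj_point_cases)
    have "(\<forall>f\<in>F. vanishes_at f q) \<longleftrightarrow> (\<forall>i j. v $ i * w $ j = v $ j * w $ i)"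
      unfolding F_def w(2) using vanishes_at_cproj_point[OF hom w(1)] by (force simp: setcompr_eq_image)
    also have "\<dots> \<longleftrightarrow> (\<exists>c. w = c *s v)" by (rule minors_vanish_iff[OF v(1)])
    finally have "(\<forall>f\<in>F. vanishes_at f q) \<longleftrightarrow> p = q"
      unfolding v(2) w(2) cproj_point_eq_iff[OF v(1) w(1)] .
    then show ?thesis by blast
  qed
  then have "{p} = {q. \<forall>f\<in>F. vanishes_at f q}" by blast
  moreover have "\<forall>f\<in>F. \<exists>d. homogeneous_poly d f" unfolding F_def using hom by blast
  ultimately show ?thesis unfolding zariski_closed_def by blast
qed

text \<open>The sum of the squared minors of a vector against \<open>v\<close>, relative to its squared norm, is a
  continuous function on projective space that vanishes only at the point of \<open>v\<close>; a threshold for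
  it separates two points.\<close>

instance cproj :: (finite) t2_space
proof
  fix p q :: "'a cproj" assume "p \<noteq> q"
  obtain v where v: "v \<noteq> 0" "p = cproj_point v" by (rule cproj_point_cases)
  define m where "m w = (\<Sum>i\<in>UNIV. \<Sum>j\<in>UNIV. (cmod (v $ i * w $ j - v $ j * w $ i))\<^sup>2)" for w
  obtain w where w: "w \<noteq> 0" "q = cproj_point w" by (rule cproj_point_cases)
  have m0: "m w = 0 \<longleftrightarrow> (\<forall>i j. v $ i * w $ j = v $ j * w $ i)" for w
    unfolding m_def by (simp add: sum_nonneg_eq_0_iff sum_nonneg)
  have "m w \<noteq> 0"
    using \<open>p \<noteq> q\<close> cproj_point_eq_iff v w minors_vanish_iff[OF v(1)] m0 by blast
  moreover have "m w \<ge> 0" unfolding m_def by (intro sum_nonneg) auto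
  ultimately have pos: "m w > 0" by simp
  define e where "e = m w / (2 * (norm w)\<^sup>2)"
  have e: "e > 0" "m w > e * (norm w)\<^sup>2" using pos w(1) by (auto simp: e_def)
  have scale: "m (c *s u) = (cmod c)\<^sup>2 * m u" for c u
    unfolding m_def sum_distrib_left
    by (intro sum.cong refl) (simp add: power_mult_distrib[symmetric] norm_mult[symmetric] algebra_simps)
  have nscale: "(norm (c *s u))\<^sup>2 = (cmod c)\<^sup>2 * (norm u)\<^sup>2" for c and u :: "complex^'a"
    unfolding norm_vec_def L2_set_def
    by (simp add: sum_nonneg sum_distrib_left norm_mult power_mult_distrib)
  have cont: "continuous_on UNIV (\<lambda>u. m u - e * (norm u)\<^sup>2)"
    unfolding m_def by (intro continuous_intros)
  define U1 where "U1 = -{0} \<inter> {u. m u - e * (norm u)\<^sup>2 < 0}"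
  define U2 where "U2 = -{0} \<inter> {u. m u - e * (norm u)\<^sup>2 > 0}"
  have "open U1" "open U2" unfolding U1_def U2_def
    using open_Collect_less[OF cont continuous_on_const[of _ 0]]
      open_Collect_less[OF continuous_on_const[of _ 0] cont]
    by (intro open_Int; simp add: open_Compl)+
  then have "open (cproj_point ` U1)" "open (cproj_point ` U2)"
    by (auto intro!: open_cproj_point_image simp: U1_def U2_def)
  moreover have "p \<in> cproj_point ` U1"
    using v e(1) m0[of v] by (auto simp: U1_def)
  moreover have "q \<in> cproj_point ` U2"
    using w e by (auto simp: U2_def)
  moreover have "cproj_point ` U1 \<inter> cproj_point ` U2 = {}"
  proof (rule ccontr)
    assume "cproj_point ` U1 \<inter> cproj_point ` U2 \<noteq> {}"
    then obtain a b where ab: "a \<in> U1" "b \<in> U2" "cproj_point a = cproj_point b" by auto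
    then obtain c where c: "b = c *s a"
      using cproj_point_eq_iff unfolding U1_def U2_def by blast
    have "m b - e * (norm b)\<^sup>2 = (cmod c)\<^sup>2 * (m a - e * (norm a)\<^sup>2)"
      unfolding c scale nscale by (simp add: algebra_simps)
    also have "\<dots> \<le> 0" using ab(1) by (intro mult_nonneg_nonpos) (auto simp: U1_def)
    finally show False using ab(2) by (auto simp: U2_def)
  qed
  ultimately show "\<exists>U V. open U \<and> open V \<and> p \<in> U \<and> q \<in> V \<and> U \<inter> V = {}" by blast
qed

lemma regular_map_continuous_on:
  assumes "regular_map Z X f"
  shows "continuous_on Z f"
  unfolding continuous_on_topological
proof (intro ballI allI impI)
  fix p V assume p: "p \<in> Z" and V: "open V" "f p \<in> V"
  obtain C d F where C: "zariski_closed C" "p \<notin> C" and F: "\<forall>i. homogeneous_poly d (\<lambda>x. F x $ i)"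
    and eq: "\<forall>q\<in>Z - C. \<forall>x\<in>line_of q. x \<noteq> 0 \<longrightarrow> F x \<noteq> 0 \<and> f q = cproj_point (F x)"
    using assms p unfolding regular_map_def by blast
  have contF: "continuous_on UNIV F"
    using continuous_on_vec_lambda[of UNIV "\<lambda>i x. F x $ i"] cpoly_continuous[OF homogeneous_imp_cpoly[OF F[rule_format]]]
    by simp
  define O' where "O' = {v. v \<noteq> 0 \<and> cproj_point v \<in> - C} \<inter> F -` {w. w \<noteq> 0 \<and> cproj_point w \<in> V}"
  have "open (- C)" using zariski_closed_imp_closed[OF C(1)] by (simp add: open_Compl)
  then have "open O'" unfolding O'_def
    using V(1) contF unfolding open_cproj_def by (intro open_Int open_vimage)
  then have "open (cproj_point ` O')" by (rule open_cproj_point_image) (auto simp: O'_def)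
  moreover obtain v where v: "v \<noteq> 0" "p = cproj_point v" by (rule cproj_point_cases)
  have "v \<in> O'" using eq[rule_format, of p v] v p C(2) V(2) mem_line_cproj_point[of v] by (auto simp: O'_def)
  then have "p \<in> cproj_point ` O'" using v by blast
  moreover have "f q \<in> V" if q: "q \<in> Z" "q \<in> cproj_point ` O'" for q
  proof -
    obtain u where u: "u \<in> O'" "q = cproj_point u" using q(2) by blast
    then have "q \<in> Z - C" "u \<in> line_of q" "u \<noteq> 0"
      using q mem_line_cproj_point by (auto simp: O'_def)
    then have "f q = cproj_point (F u)" using eq by blast
    then show ?thesis using u by (auto simp: O'_def)
  qed
  ultimately show "\<exists>A. open A \<and> p \<in> A \<and> (\<forall>y\<in>Z. y \<in> A \<longrightarrow> f y \<in> V)" by blast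
qed


section \<open>The Zariski topology\<close>

lemma zariski_closed_Un:
  assumes "zariski_closed A" "zariski_closed B"
  shows "zariski_closed (A \<union> B)"
proof -
  obtain F where F: "\<forall>f\<in>F. \<exists>d. homogeneous_poly d f" "A = {p. \<forall>f\<in>F. vanishes_at f p}"
    using assms unfolding zariski_closed_def by blast
  obtain G where G: "\<forall>f\<in>G. \<exists>d. homogeneous_poly d f" "B = {p. \<forall>f\<in>G. vanishes_at f p}"
    using assms unfolding zariski_closed_def by blast
  define P where "P = (\<lambda>(f, g) x. f x * g x) ` (F \<times> G)"
  have "\<forall>f\<in>P. \<exists>d. homogeneous_poly d f"
    unfolding P_def using F(1) G(1) homogeneous_mult by clarsimp blast
  moreover have "A \<union> B = {p. \<forall>f\<in>P. vanishes_at f p}"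
  proof -
    have "vanishes_at (\<lambda>x. f x * g x) p \<longleftrightarrow> vanishes_at f p \<or> vanishes_at g p"
      if "f \<in> F" "g \<in> G" for f g p
      using F(1) G(1) that vanishes_at_mult by blast
    then show ?thesis unfolding F(2) G(2) P_def by auto
  qed
  ultimately show ?thesis unfolding zariski_closed_def by blast
qed

text \<open>The intersection is cut out by all forms that vanish on some member.\<close>

lemma zariski_closed_Inter:
  assumes "\<And>A. A \<in> \<A> \<Longrightarrow> zariski_closed A"
  shows "zariski_closed (\<Inter>\<A>)"
proof -
  define F where "F = {f. (\<exists>d. homogeneous_poly d f) \<and> (\<exists>A\<in>\<A>. \<forall>p\<in>A. vanishes_at f p)}"
  have "p \<in> A" if p: "\<forall>f\<in>F. vanishes_at f p" and "A \<in> \<A>" for p A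
  proof -
    obtain G where G: "\<forall>f\<in>G. \<exists>d. homogeneous_poly d f" "A = {p. \<forall>f\<in>G. vanishes_at f p}"
      using assms[OF \<open>A \<in> \<A>\<close>] unfolding zariski_closed_def by blast
    have "f \<in> F" if "f \<in> G" for f
    proof -
      have "\<forall>q\<in>A. vanishes_at f q" unfolding G(2) using that by simp
      then show ?thesis using \<open>A \<in> \<A>\<close> G(1) that unfolding F_def by auto
    qed
    then show ?thesis unfolding G(2) using p by simp
  qed
  moreover have "vanishes_at f p" if "p \<in> \<Inter>\<A>" "f \<in> F" for p f
    using that by (auto simp: F_def)
  ultimately have "\<Inter>\<A> = {p. \<forall>f\<in>F. vanishes_at f p}" by blast
  moreover have "\<forall>f\<in>F. \<exists>d. homogeneous_poly d f" by (simp add: F_def)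
  ultimately show ?thesis unfolding zariski_closed_def by blast
qed

lemma zariski_closed_vanishing: "homogeneous_poly d f \<Longrightarrow> zariski_closed {p. vanishes_at f p}"
  unfolding zariski_closed_def by (rule exI[of _ "{f}"]) auto


section \<open>Linear forms and gradients\<close>

text \<open>Double duality for annihilators: a functional that kills \<open>S\<close> but not \<open>a\<close> exists by extending a
  basis, and its values on the unit vectors form the vector.\<close>

lemma subspace_separating_vector:
  fixes S :: "(complex^'n::finite) set"
  assumes "vec.subspace S" "a \<notin> S"
  obtains v where "\<forall>s\<in>S. pairing s v = 0" "pairing a v = 1"
proof -
  obtain B where B: "B \<subseteq> S" "vec.independent B" "S \<subseteq> vec.span B"
    using vec.basis_exists[of S] by metis
  have "vec.span B = S" using B assms(1) by (simp add: vec.span_subspace)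
  then have ind: "vec.independent (insert a B)" and aB: "a \<notin> B"
    using B assms(2) by (auto simp: vec.independent_insert)
  fix i :: 'n
  obtain g where g: "Vector_Spaces.linear (*s) (*s) g"
    "\<forall>x\<in>insert a B. g x = (if x = a then axis i 1 else 0)"
    using vec.linear_independent_extend[OF ind, of "\<lambda>x. if x = a then axis i 1 else 0"] by blast
  define v where "v = (\<chi> j. g (axis j 1) $ i)"
  have gv: "g x $ i = pairing x v" for x
  proof -
    have "g x = g (\<Sum>j\<in>UNIV. x $ j *s axis j 1)" by (simp add: basis_expansion)
    also have "\<dots> = (\<Sum>j\<in>UNIV. x $ j *s g (axis j 1))"
      using g(1) by (simp add: vec.linear_sum vec.linear_scale)
    finally show ?thesis by (simp add: pairing_def v_def)
  qed
  have "g s = 0" if "s \<in> S" for s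
  proof -
    have "s \<in> vec.span B" using that B by blast
    then show ?thesis
      by (rule vec.linear_eq_0_on_span[OF g(1), rotated]) (use g(2) aB in auto)
  qed
  then have "\<forall>s\<in>S. pairing s v = 0" using gv by (metis zero_index)
  moreover have "pairing a v = 1" using gv[of a] g(2) by simp
  ultimately show ?thesis using that by blast
qed

lemma cramer_scaled:
  fixes A :: "'a::field^'n^'n"
  assumes "A *v x = c *s b"
  shows "x $ k * det A = c * det (\<chi> i j. if j = k then b $ i else A $ i $ j)"
proof -
  have "x $ k * det A = det (\<chi> i j. if j = k then c * b $ i else A $ i $ j)"
    using cramer_lemma[of k A x] unfolding assms vector_smult_component by (rule sym)
  also have "\<dots> = det (\<chi> j. if j = k then c *s b else row j (transpose A))"
    by (subst det_transpose[symmetric], rule arg_cong[of _ _ det])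
      (simp add: transpose_def row_def vec_eq_iff)
  also have "\<dots> = c * det (\<chi> j. if j = k then b else row j (transpose A))"
    by (rule det_row_mul)
  also have "det (\<chi> j. if j = k then b else row j (transpose A))
      = det (\<chi> i j. if j = k then b $ i else A $ i $ j)"
    by (subst det_transpose[symmetric], rule arg_cong[of _ _ det])
      (auto simp: transpose_def row_def vec_eq_iff)
  finally show ?thesis .
qed

definition gradient :: "(complex^'n::finite \<Rightarrow> complex) \<Rightarrow> complex^'n \<Rightarrow> complex^'n" where
  "gradient f x = (\<chi> j. deriv (\<lambda>t. f (x + t *s axis j 1)) 0)"

lemma difference_quotient_derivative:
  assumes "difference_quotient f q"
  shows "((\<lambda>t. f (x + t *s v)) has_field_derivative (\<Sum>j\<in>UNIV. q j x x * v $ j)) (at 0)"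
proof -
  have "isCont (\<lambda>t. q j (x + t *s v) x) 0" for j
  proof -
    have "continuous_on UNIV (\<lambda>t. (x + t *s v, x))"
      unfolding vector_scalar_mult_def by (intro continuous_intros)
    then have "continuous_on UNIV (\<lambda>t. q j (fst (x + t *s v, x)) (snd (x + t *s v, x)))"
      using assms unfolding difference_quotient_def
      by (intro continuous_on_compose2[of UNIV "\<lambda>z. q j (fst z) (snd z)" UNIV "\<lambda>t. (x + t *s v, x)"]) auto
    then show ?thesis by (simp add: continuous_on_eq_continuous_at)
  qed
  then have "((\<lambda>t. \<Sum>j\<in>UNIV. q j (x + t *s v) x * v $ j) \<longlongrightarrow> (\<Sum>j\<in>UNIV. q j (x + 0 *s v) x * v $ j)) (at 0)"
    by (intro tendsto_sum tendsto_mult tendsto_const) (simp add: isCont_def)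
  moreover have "(f (x + t *s v) - f (x + 0 *s v)) / (t - 0) = (\<Sum>j\<in>UNIV. q j (x + t *s v) x * v $ j)"
    if "t \<noteq> 0" for t
  proof -
    have "f (x + t *s v) - f x = (\<Sum>j\<in>UNIV. q j (x + t *s v) x * ((x + t *s v) $ j - x $ j))"
      using assms unfolding difference_quotient_def by blast
    then show ?thesis using that by (simp add: sum_divide_distrib)
  qed
  then have "\<forall>\<^sub>F t in at 0. (\<Sum>j\<in>UNIV. q j (x + t *s v) x * v $ j)
      = (f (x + t *s v) - f (x + 0 *s v)) / (t - 0)"
    by (auto simp: eventually_at_filter)
  ultimately show ?thesis
    unfolding has_field_derivative_iff using tendsto_cong by fastforce
qed

lemma gradient_difference_quotient:
  assumes "difference_quotient f q"
  shows "gradient f x $ j = q j x x"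
proof -
  have "(\<Sum>i\<in>UNIV. q i x x * axis j 1 $ i) = (\<Sum>i\<in>UNIV. if i = j then q i x x else 0)"
    by (rule sum.cong) (auto simp: axis_def)
  then show ?thesis
    using DERIV_imp_deriv[OF difference_quotient_derivative[OF assms, of x "axis j 1"]]
    by (simp add: gradient_def)
qed

lemma cpoly_directional_derivative:
  assumes "cpoly f"
  shows "((\<lambda>t. f (x + t *s v)) has_field_derivative pairing (gradient f x) v) (at 0)"
proof -
  obtain q where q: "difference_quotient f q" using cpoly_difference[OF assms] by blast
  show ?thesis using difference_quotient_derivative[OF q, of x v]
    by (simp add: pairing_def gradient_difference_quotient[OF q])
qed

lemma gradient_const: "gradient (\<lambda>x. c) x = 0"
  by (simp add: gradient_def vec_eq_iff)

lemma gradient_unique: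
  assumes "cpoly f" "\<And>v. ((\<lambda>t. f (x + t *s v)) has_field_derivative pairing a v) (at 0)"
  shows "gradient f x = a"
proof -
  have "pairing a (axis j 1) = a $ j" for j
  proof -
    have "pairing a (axis j 1) = (\<Sum>i\<in>UNIV. if i = j then a $ i else 0)"
      unfolding pairing_def by (rule sum.cong) (auto simp: axis_def)
    then show ?thesis by simp
  qed
  then show ?thesis
    using DERIV_imp_deriv[OF assms(2)] by (simp add: gradient_def vec_eq_iff)
qed

lemma pairing_left_linear:
  "pairing (a + b) x = pairing a x + pairing b x" "pairing (c *s a) x = c * pairing a x"
  "pairing 0 x = 0"
  by (simp_all add: pairing_def algebra_simps sum.distrib sum_distrib_left)

lemma gradient_linear:
  assumes "cpoly f" "cpoly g"
  shows "gradient (\<lambda>x. c * f x + g x) x = c *s gradient f x + gradient g x"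
  by (rule gradient_unique)
    (auto simp: pairing_left_linear intro!: cpoly_add cpoly_mult cpoly_const assms DERIV_add DERIV_cmult
      cpoly_directional_derivative)

lemma cpoly_pairing: "cpoly (pairing a)"
  using homogeneous_imp_cpoly[OF homogeneous_pairing] .


section \<open>Affine charts and tangent spaces\<close>

text \<open>The part of \<open>Z\<close> off the hyperplane \<open>L = 0\<close>, represented by the vectors with \<open>L = 1\<close>.\<close>

definition chart :: "complex^'n::finite \<Rightarrow> 'n cproj set \<Rightarrow> (complex^'n) set" where
  "chart L Z = {x. pairing L x = 1 \<and> cproj_point x \<in> Z}"

lemma pairing_one_nonzero: "pairing L x = 1 \<Longrightarrow> x \<noteq> 0"
  by (auto simp: pairing_linear)

lemma chart_representative:
  assumes "q \<in> Z" "\<not> vanishes_at (pairing L) q"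
  obtains x where "x \<in> chart L Z" "q = cproj_point x"
proof -
  obtain v where v: "v \<noteq> 0" "q = cproj_point v" by (rule cproj_point_cases)
  then have L: "pairing L v \<noteq> 0"
    using assms(2) vanishes_at_cproj_point[OF homogeneous_pairing] by blast
  define x where "x = (1 / pairing L v) *s v"
  have q: "q = cproj_point x"
    unfolding x_def v(2) using v(1) L by (simp add: cproj_point_smult)
  moreover have "pairing L x = 1" using L by (simp add: x_def pairing_linear)
  ultimately show ?thesis
    using that assms(1) by (simp add: chart_def)
qed

lemma chart_subset_vanishing:
  assumes "homogeneous_poly d F" "x \<in> chart L {p. vanishes_at F p}"
  shows "F x = 0"
  using assms vanishes_at_cproj_point[OF assms(1) pairing_one_nonzero[of L x]]
  by (simp add: chart_def)

text \<open>Irreducibility in a chart: homogenize both factors and add the hyperplane \<open>L = 0\<close> to one of the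
  two closed sets.\<close>

lemma chart_prime:
  assumes Z: "projective_variety Z" and f: "cpoly f" and g: "cpoly g"
    and fg: "\<forall>x\<in>chart L Z. f x * g x = 0"
  shows "(\<forall>x\<in>chart L Z. f x = 0) \<or> (\<forall>x\<in>chart L Z. g x = 0)"
proof -
  obtain d F where F: "homogeneous_poly d F" "\<And>x. pairing L x = 1 \<Longrightarrow> F x = f x"
    using homogenization[OF f] by metis
  obtain e G where G: "homogeneous_poly e G" "\<And>x. pairing L x = 1 \<Longrightarrow> G x = g x"
    using homogenization[OF g] by metis
  note FL = homogeneous_mult[OF F(1) homogeneous_pairing[of L]]
  define A where "A = {p. vanishes_at (\<lambda>x. F x * pairing L x) p}"
  define B where "B = {p. vanishes_at G p}"
  have "Z \<subseteq> A \<union> B"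
  proof
    fix q assume q: "q \<in> Z"
    show "q \<in> A \<union> B"
    proof (cases "vanishes_at (pairing L) q")
      case True
      then show ?thesis
        using vanishes_at_mult[OF F(1) homogeneous_pairing[of L], of q] unfolding A_def by blast
    next
      case False
      then obtain x where x: "x \<in> chart L Z" "q = cproj_point x"
        using chart_representative q by blast
      then have x1: "pairing L x = 1" by (simp add: chart_def)
      note x0 = pairing_one_nonzero[OF x1]
      have "F x * pairing L x = 0 \<or> G x = 0" using fg x F(2)[OF x1] G(2)[OF x1] by auto
      then show ?thesis unfolding A_def B_def x(2)
        using vanishes_at_cproj_point[OF FL x0] vanishes_at_cproj_point[OF G(1) x0] by auto
    qed
  qed
  moreover have "zariski_closed A" "zariski_closed B"
    unfolding A_def B_def using zariski_closed_vanishing FL G(1) by blast+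
  ultimately have "Z \<subseteq> A \<or> Z \<subseteq> B" using Z unfolding projective_variety_def by blast
  then show ?thesis
  proof
    assume "Z \<subseteq> A"
    have "f x = 0" if "x \<in> chart L Z" for x
    proof -
      have x1: "pairing L x = 1" and "x \<in> chart L A"
        using that \<open>Z \<subseteq> A\<close> by (auto simp: chart_def)
      then have "F x * pairing L x = 0" unfolding A_def by (intro chart_subset_vanishing[OF FL])
      then show ?thesis using x1 F(2)[OF x1] by simp
    qed
    then show ?thesis by blast
  next
    assume "Z \<subseteq> B"
    have "g x = 0" if "x \<in> chart L Z" for x
    proof -
      have x1: "pairing L x = 1" and "x \<in> chart L B"
        using that \<open>Z \<subseteq> B\<close> by (auto simp: chart_def)
      then have "G x = 0" unfolding B_def by (intro chart_subset_vanishing[OF G(1)])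
      then show ?thesis using G(2)[OF x1] by simp
    qed
    then show ?thesis by blast
  qed
qed

lemma chart_singleton:
  assumes Z: "projective_variety Z" and "chart L Z = {v}"
  shows "Z = {cproj_point v}"
proof -
  have v: "pairing L v = 1" "cproj_point v \<in> Z" using assms(2) by (auto simp: chart_def)
  have "q = cproj_point v \<or> vanishes_at (pairing L) q" if "q \<in> Z" for q
    using chart_representative[OF that, of L] assms(2) by blast
  then have "Z \<subseteq> {cproj_point v} \<union> {p. vanishes_at (pairing L) p}" by blast
  moreover have "\<not> Z \<subseteq> {p. vanishes_at (pairing L) p}"
    using v vanishes_at_cproj_point[OF homogeneous_pairing pairing_one_nonzero[OF v(1)], of L] by auto
  moreover have "zariski_closed {p. vanishes_at (pairing L) p}" 
    using zariski_closed_vanishing[OF homogeneous_pairing] .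
  ultimately have "Z \<subseteq> {cproj_point v}"
    using Z zariski_closed_point unfolding projective_variety_def by blast
  then show ?thesis using v by blast
qed

lemma vanishes_on_chart:
  assumes "homogeneous_poly d F" "\<forall>q\<in>Z. vanishes_at F q"
  shows "\<forall>x\<in>chart L Z. F x = 0"
proof
  fix x assume "x \<in> chart L Z"
  then have "x \<in> chart L {p. vanishes_at F p}" using assms(2) by (simp add: chart_def)
  then show "F x = 0" by (rule chart_subset_vanishing[OF assms(1)])
qed

text \<open>A Zariski closed set is recovered from the equations of its chart.\<close>

lemma zariski_closed_member:
  assumes "zariski_closed Z" "pairing L x = 1"
    and "\<And>f. cpoly f \<Longrightarrow> (\<forall>y\<in>chart L Z. f y = 0) \<Longrightarrow> f x = 0"
  shows "cproj_point x \<in> Z"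
proof -
  obtain F where F: "\<forall>f\<in>F. \<exists>d. homogeneous_poly d f" "Z = {p. \<forall>f\<in>F. vanishes_at f p}"
    using assms(1) unfolding zariski_closed_def by (elim exE conjE)
  have "vanishes_at f (cproj_point x)" if "f \<in> F" for f
  proof -
    from F(1) that have "\<exists>d. homogeneous_poly d f" by (rule bspec)
    then obtain d where d: "homogeneous_poly d f" by (elim exE)
    have "\<forall>q\<in>Z. vanishes_at f q"
    proof
      fix q assume "q \<in> Z"
      then have "\<forall>f\<in>F. vanishes_at f q" unfolding F(2) by (rule CollectD)
      then show "vanishes_at f q" using that by (rule bspec)
    qed
    then have "\<forall>y\<in>chart L Z. f y = 0" by (rule vanishes_on_chart[OF d])
    then have "f x = 0" by (rule assms(3)[OF homogeneous_imp_cpoly[OF d]])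
    then show ?thesis using vanishes_at_cproj_point[OF d pairing_one_nonzero[OF assms(2)]] by blast
  qed
  then show ?thesis unfolding F(2) by simp
qed

text \<open>Euler's relation: along the line through \<open>v\<close> a form that vanishes at \<open>v\<close> vanishes identically.\<close>

lemma tangent_space_euler:
  assumes "cproj_point v \<in> Z" "v \<noteq> 0"
  shows "v \<in> cone_tangent_space Z (cproj_point v)"
proof -
  have "deriv (\<lambda>t. f (x + t *s v)) 0 = 0"
    if f: "homogeneous_poly d f" and van: "\<forall>q\<in>Z. vanishes_at f q"
      and x: "x \<in> line_of (cproj_point v)" "x \<noteq> 0" for d f x
  proof -
    obtain c where c: "x = c *s v" using nonzero_in_line_iff[OF assms(2)] x by blast
    have "f v = 0" using van assms vanishes_at_cproj_point[OF f assms(2)] by blast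
    then have "f (x + t *s v) = 0" for t
      using homogeneous_poly_smult[OF f, of "c + t" v] unfolding c vector_sadd_rdistrib[symmetric] by simp
    then show ?thesis by simp
  qed
  then show ?thesis unfolding cone_tangent_space_def by blast
qed

text \<open>By homogeneity one representative \<open>v\<close> of the point suffices.\<close>

lemma tangent_space_iff:
  assumes "v \<noteq> 0"
  shows "u \<in> cone_tangent_space Z (cproj_point v) \<longleftrightarrow>
    (\<forall>f d. homogeneous_poly d f \<and> (\<forall>q\<in>Z. vanishes_at f q) \<longrightarrow> pairing (gradient f v) u = 0)"
proof -
  have deriv: "deriv (\<lambda>t. f (x + t *s u)) 0 = pairing (gradient f x) u"
    if "homogeneous_poly d f" for d f x
    using DERIV_imp_deriv[OF cpoly_directional_derivative[OF homogeneous_imp_cpoly[OF that]]] .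
  have "pairing (gradient f (c *s v)) u = 0"
    if f: "homogeneous_poly d f" and "c \<noteq> 0" "pairing (gradient f v) u = 0" for f d c
  proof -
    have "((\<lambda>t. f (v + t *s u)) has_field_derivative pairing (gradient f v) u) (at (0 / c))"
      using cpoly_directional_derivative[OF homogeneous_imp_cpoly[OF f]] by simp
    then have "((\<lambda>t. f (v + (t / c) *s u)) has_field_derivative pairing (gradient f v) u * (1 / c)) (at 0)"
      by (rule DERIV_chain2) (use \<open>c \<noteq> 0\<close> in \<open>auto intro!: derivative_eq_intros\<close>)
    then have "((\<lambda>t. c ^ d * f (v + (t / c) *s u)) has_field_derivative c ^ d * (pairing (gradient f v) u * (1 / c))) (at 0)"
      by (rule DERIV_cmult)
    moreover have "c ^ d * f (v + (t / c) *s u) = f (c *s v + t *s u)" for t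
      using homogeneous_poly_smult[OF f, of c "v + (t / c) *s u"] \<open>c \<noteq> 0\<close>
      by (simp add: vector_add_ldistrib vector_smult_assoc)
    ultimately have "((\<lambda>t. f (c *s v + t *s u)) has_field_derivative 0) (at 0)"
      using that(3) by simp
    then show ?thesis
      using cpoly_directional_derivative[OF homogeneous_imp_cpoly[OF f], of "c *s v" u] DERIV_unique by blast
  qed
  moreover have "x \<in> line_of (cproj_point v) \<and> x \<noteq> 0 \<longleftrightarrow> (\<exists>c. c \<noteq> 0 \<and> x = c *s v)" for x
    using nonzero_in_line_iff[OF assms] by blast
  moreover have "v \<in> line_of (cproj_point v)" by (rule mem_line_cproj_point[OF assms])
  ultimately show ?thesis
    unfolding cone_tangent_space_def mem_Collect_eq using deriv assms by metis
qed

text \<open>The tangent space of the cone is a plane containing \<open>v\<close>; the vector \<open>u\<close> spans the tangent line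
  of the curve inside the chart.\<close>

lemma tangent_direction:
  assumes "vec.dim (cone_tangent_space Z (cproj_point v)) = 2" "cproj_point v \<in> Z" "pairing L v = 1"
  obtains u where "u \<noteq> 0" "pairing L u = 0" "cone_tangent_space Z (cproj_point v) \<subseteq> vec.span {v, u}"
proof -
  let ?T = "cone_tangent_space Z (cproj_point v)"
  have v0: "v \<noteq> 0" by (rule pairing_one_nonzero[OF assms(3)])
  have vT: "v \<in> ?T" by (rule tangent_space_euler[OF assms(2) v0])
  have sub: "vec.subspace ?T"
    unfolding vec.subspace_def by (simp add: tangent_space_iff[OF v0] pairing_linear)
  obtain w where w: "w \<in> ?T" "w \<notin> vec.span {v}"
  proof (rule ccontr)
    assume "\<not> thesis"
    then have "?T \<subseteq> vec.span {v}" using that by blast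
    then have "vec.dim ?T \<le> card {v}" by (intro vec.dim_le_card) auto
    then show False using assms(1) by simp
  qed
  define u where "u = w - pairing L w *s v"
  have u: "u \<noteq> 0" "pairing L u = 0" "u \<in> ?T" "u \<notin> vec.span {v}"
  proof -
    have "w = u + pairing L w *s v" by (simp add: u_def)
    then show "u \<notin> vec.span {v}"
      using w(2) by (metis insertI1 vec.span_add vec.span_base vec.span_scale)
    then show "u \<noteq> 0" using vec.span_zero by blast
    show "pairing L u = 0" using assms(3) by (simp add: u_def pairing_linear)
    show "u \<in> ?T" unfolding u_def using sub vT w(1) by (intro vec.subspace_diff vec.subspace_scale)
  qed
  have "vec.independent {u, v}"
    using u(4) v0 by (subst vec.independent_insert) (auto simp: vec.dependent_single)
  moreover have "u \<noteq> v" using u(2) assms(3) by auto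
  ultimately have "?T \<subseteq> vec.span {u, v}"
    using vec.card_ge_dim_independent[of "{u, v}" ?T] u(3) vT assms(1) by simp
  then show ?thesis using that u(1,2) by (simp add: insert_commute)
qed

text \<open>Smoothness, dually: every linear form that kills the tangent directions is the
  gradient of an equation of the curve, because the gradients form a subspace.\<close>

lemma gradient_of_equation:
  assumes "v \<noteq> 0" "\<forall>u\<in>cone_tangent_space Z (cproj_point v). pairing a u = 0"
  obtains f where "cpoly f" "\<forall>x\<in>chart L Z. f x = 0" "gradient f v = a"
proof -
  define S where "S = {gradient f v | f. cpoly f \<and> (\<forall>x\<in>chart L Z. f x = 0)}"
  have "vec.subspace S"
  proof (rule vec.subspaceI)
    show "0 \<in> S" unfolding S_def
      by (intro CollectI exI[of _ "\<lambda>x. 0"]) (simp add: gradient_const cpoly_const)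
  next
    fix a b assume "a \<in> S" "b \<in> S"
    then obtain f g where "a = gradient f v" "cpoly f" "\<forall>x\<in>chart L Z. f x = 0"
      "b = gradient g v" "cpoly g" "\<forall>x\<in>chart L Z. g x = 0" unfolding S_def by blast
    then show "a + b \<in> S" unfolding S_def using gradient_linear[of f g 1 v]
      by (intro CollectI exI[of _ "\<lambda>x. f x + g x"]) (simp add: cpoly_add)
  next
    fix c a assume "a \<in> S"
    then obtain f where "a = gradient f v" "cpoly f" "\<forall>x\<in>chart L Z. f x = 0" unfolding S_def by blast
    then show "c *s a \<in> S" unfolding S_def using gradient_linear[of f "\<lambda>x. 0" c v]
      by (intro CollectI exI[of _ "\<lambda>x. c * f x"]) (simp add: cpoly_mult cpoly_const gradient_const)
  qed
  have "a \<in> S"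
  proof (rule ccontr)
    assume "a \<notin> S"
    then obtain u where u: "\<forall>s\<in>S. pairing s u = 0" "pairing a u = 1"
      using subspace_separating_vector[OF \<open>vec.subspace S\<close>] by blast
    have "pairing (gradient f v) u = 0"
      if f: "homogeneous_poly d f" "\<forall>q\<in>Z. vanishes_at f q" for f d
    proof -
      have "\<forall>x\<in>chart L Z. f x = 0" by (rule vanishes_on_chart[OF f])
      then have "gradient f v \<in> S" unfolding S_def using homogeneous_imp_cpoly[OF f(1)] by blast
      then show ?thesis using u(1) by blast
    qed
    then have "u \<in> cone_tangent_space Z (cproj_point v)" using tangent_space_iff[OF assms(1)] by blast
    then show False using u(2) assms(2) by simp
  qed
  then show ?thesis using that unfolding S_def by blast
qed


section \<open>Local parametrization of a smooth curve\<close>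

text \<open>The vector-valued map \<open>f\<close> collects equations of the curve near \<open>v\<close>. Its values lie in the common
  kernel of \<open>L\<close> and \<open>b\<close>, and its derivative at \<open>v\<close> is the projection to that kernel along \<open>v\<close>
  and the tangent direction \<open>u\<close>. Thus \<open>f\<close> is transversal to the two remaining coordinates \<open>L\<close> and
  \<open>b\<close>, the second of which restricts to a parameter on the curve.\<close>

definition local_equations ::
  "complex^'n::finite \<Rightarrow> complex^'n \<Rightarrow> complex^'n \<Rightarrow> complex^'n \<Rightarrow> 'n cproj set
    \<Rightarrow> (complex^'n \<Rightarrow> complex^'n) \<Rightarrow> bool" where
  "local_equations L b v u Z f \<longleftrightarrow>
    pairing L v = 1 \<and> pairing L u = 0 \<and> pairing b v = 0 \<and> pairing b u = 1 \<and>
    (\<forall>k. cpoly (\<lambda>x. f x $ k)) \<and> (\<forall>x\<in>chart L Z. f x = 0) \<and>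
    (\<forall>x. pairing L (f x) = 0 \<and> pairing b (f x) = 0) \<and>
    (\<forall>k w. pairing (gradient (\<lambda>x. f x $ k) v) w = w $ k - pairing L w * v $ k - pairing b w * u $ k)"

lemma pairing_commute: "pairing a b = pairing b a"
  by (simp add: pairing_def mult.commute)

lemma exists_local_equations:
  assumes Z: "smooth_projective_curve Z" and p: "cproj_point v \<in> Z" and L: "pairing L v = 1"
  obtains b u f where "local_equations L b v u Z f"
proof -
  have v0: "v \<noteq> 0" by (rule pairing_one_nonzero[OF L])
  have dim: "vec.dim (cone_tangent_space Z (cproj_point v)) = 2"
    using Z p unfolding smooth_projective_curve_def by blast
  obtain u where u: "u \<noteq> 0" "pairing L u = 0"
    and T: "cone_tangent_space Z (cproj_point v) \<subseteq> vec.span {v, u}"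
    using tangent_direction[OF dim p L] by metis
  have "u \<notin> vec.span {v}"
  proof
    assume "u \<in> vec.span {v}"
    then obtain c where "u = c *s v" by (auto simp: vec.span_singleton)
    then show False using u L by (simp add: pairing_linear)
  qed
  then obtain b where b: "pairing b v = 0" "pairing b u = 1"
    using subspace_separating_vector[OF vec.subspace_span[of "{v}"], of u]
    by (metis insertI1 pairing_commute vec.span_base)
  define a where "a k = axis k 1 - (v $ k) *s L - (u $ k) *s b" for k
  have pa: "pairing (a k) w = w $ k - pairing L w * v $ k - pairing b w * u $ k" for k w
  proof -
    have "pairing (axis k 1) w = (\<Sum>i\<in>UNIV. if i = k then w $ i else 0)"
      unfolding pairing_def by (rule sum.cong) (auto simp: axis_def)
    then have ax: "pairing (axis k 1) w = w $ k" by simp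
    have "pairing w (a k) = pairing w (axis k 1) - v $ k * pairing w L - u $ k * pairing w b"
      by (simp add: a_def pairing_linear)
    then show ?thesis using ax by (simp add: pairing_commute mult.commute)
  qed
  have "\<forall>w\<in>cone_tangent_space Z (cproj_point v). pairing (a k) w = 0" for k
  proof
    fix w assume "w \<in> cone_tangent_space Z (cproj_point v)"
    then have "w \<in> vec.span {v, u}" using T by blast
    then obtain c d where "w = c *s v + d *s u"
      by (auto simp: vec.span_insert vec.span_singleton algebra_simps)
    then show "pairing (a k) w = 0"
      unfolding pa by (simp add: pairing_linear L u b)
  qed
  then have "\<exists>f. cpoly f \<and> (\<forall>x\<in>chart L Z. f x = 0) \<and> gradient f v = a k" for k
    using gradient_of_equation[OF v0, of Z "a k" L] by metis
  then have "\<forall>k. \<exists>f. cpoly f \<and> (\<forall>x\<in>chart L Z. f x = 0) \<and> gradient f v = a k" by blast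
  from choice[OF this] obtain h where
    h: "\<forall>k. cpoly (h k) \<and> (\<forall>x\<in>chart L Z. h k x = 0) \<and> gradient (h k) v = a k" by (elim exE)
  define H where "H x = (\<chi> k. h k x)" for x
  \<comment> \<open>Any equations with the right gradients will do; projecting puts their values into the kernel
    of \<open>L\<close> and \<open>b\<close> and does not change the derivative at \<open>v\<close>.\<close>
  define f where "f x = H x - pairing L (H x) *s v - pairing b (H x) *s u" for x
  have H: "cpoly (\<lambda>x. H x $ k)" for k using h by (simp add: H_def)
  have pH: "cpoly (\<lambda>x. pairing c (H x))" for c
    unfolding pairing_def by (intro cpoly_sum cpoly_mult cpoly_const H)
  have dH: "((\<lambda>t. H (v + t *s w) $ k) has_field_derivative pairing (a k) w) (at 0)" for k w
    using cpoly_directional_derivative[of "h k" v w] h by (simp add: H_def)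
  have dpH: "((\<lambda>t. pairing c (H (v + t *s w))) has_field_derivative
      pairing c w - pairing L w * pairing c v - pairing b w * pairing c u) (at 0)" for c w
  proof -
    have "((\<lambda>t. pairing c (H (v + t *s w))) has_field_derivative (\<Sum>k\<in>UNIV. c $ k * pairing (a k) w)) (at 0)"
      unfolding pairing_def[of c] by (intro DERIV_sum DERIV_cmult dH)
    also have "(\<Sum>k\<in>UNIV. c $ k * pairing (a k) w)
        = pairing c w - pairing L w * pairing c v - pairing b w * pairing c u"
      unfolding pa pairing_def[of c]
      by (simp add: right_diff_distrib sum_subtractf sum_distrib_left mult.left_commute)
    finally show ?thesis .
  qed
  have cf: "cpoly (\<lambda>x. f x $ k)" for k
    unfolding f_def by (simp, intro cpoly_diff cpoly_mult pH H cpoly_const)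
  have "local_equations L b v u Z f"
    unfolding local_equations_def
  proof (intro conjI allI ballI)
    fix x assume "x \<in> chart L Z"
    then have "H x = 0" using h by (simp add: H_def vec_eq_iff)
    then show "f x = 0" by (simp add: f_def pairing_linear)
  next
    fix k w
    have "gradient (\<lambda>x. f x $ k) v = a k"
    proof (rule gradient_unique[OF cf])
      fix w
      have "((\<lambda>t. f (v + t *s w) $ k) has_field_derivative
          pairing (a k) w - (pairing L w - pairing L w * pairing L v - pairing b w * pairing L u) * v $ k
          - (pairing b w - pairing L w * pairing b v - pairing b w * pairing b u) * u $ k) (at 0)"
        unfolding f_def by (simp, intro DERIV_diff DERIV_cmult_right dH dpH)
      then show "((\<lambda>t. f (v + t *s w) $ k) has_field_derivative pairing (a k) w) (at 0)"
        by (simp add: L u b)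
    qed
    then show "pairing (gradient (\<lambda>x. f x $ k) v) w = w $ k - pairing L w * v $ k - pairing b w * u $ k"
      using pa by simp
  qed (use L u b cf in \<open>auto simp: f_def pairing_linear\<close>)
  then show ?thesis by (rule that)
qed

text \<open>Completing \<open>f\<close> by the coordinates \<open>b\<close> and \<open>L - 1\<close> gives a map between spaces of the same
  dimension with derivative 1 at \<open>v\<close>. Its divided difference \<open>N\<close> takes the place of the derivative
  in what follows, because it is exact and not merely a first-order approximation.\<close>

lemma exists_local_coordinates:
  assumes "local_equations L b v u Z f"
  obtains N :: "complex^'n::finite \<Rightarrow> complex^'n \<Rightarrow> complex^'n^'n" where
    "\<forall>x y. (f x + pairing b x *s u + (pairing L x - 1) *s v)
        - (f y + pairing b y *s u + (pairing L y - 1) *s v) = N x y *v (x - y)"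
    "N v v = mat 1"
    "\<forall>i j. continuous_on UNIV (\<lambda>z. N (fst z) (snd z) $ i $ j)"
    "\<forall>i j y. cpoly (\<lambda>x. N x y $ i $ j)"
proof -
  define G where "G x = f x + pairing b x *s u + (pairing L x - 1) *s v" for x
  have cG: "cpoly (\<lambda>x. G x $ i)" for i
    using assms unfolding G_def local_equations_def
    by (simp, intro cpoly_add cpoly_mult cpoly_diff cpoly_const cpoly_pairing) auto
  then have "\<forall>i. \<exists>q. difference_quotient (\<lambda>x. G x $ i) q" using cpoly_difference by blast
  from choice[OF this] obtain q where q: "\<And>i. difference_quotient (\<lambda>x. G x $ i) (q i)" by auto
  define N :: "complex^'n \<Rightarrow> complex^'n \<Rightarrow> complex^'n^'n" where "N x y = (\<chi> i j. q i j x y)" for x y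
  have "\<forall>x y. G x - G y = N x y *v (x - y)"
    using q by (simp add: difference_quotient_def N_def vec_eq_iff matrix_vector_mult_def)
  moreover have "N v v = mat 1"
  proof -
    have "gradient (\<lambda>x. G x $ i) v = axis i 1" for i
    proof (rule gradient_unique[OF cG])
      fix w
      have f: "cpoly (\<lambda>x. f x $ i)" using assms by (simp add: local_equations_def)
      have 1: "((\<lambda>t. pairing b (v + t *s w)) has_field_derivative pairing b w) (at 0)"
        by (auto simp: pairing_linear intro!: derivative_eq_intros)
      have 2: "((\<lambda>t. pairing L (v + t *s w)) has_field_derivative pairing L w) (at 0)"
        by (auto simp: pairing_linear intro!: derivative_eq_intros)
      have "((\<lambda>t. G (v + t *s w) $ i) has_field_derivative
          pairing (gradient (\<lambda>x. f x $ i) v) w + pairing b w * u $ i + (pairing L w - 0) * v $ i) (at 0)"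
        unfolding G_def vector_add_component vector_smult_component
        by (intro DERIV_add DERIV_cmult_right DERIV_diff DERIV_const 1 2
            cpoly_directional_derivative[OF f])
      also have "pairing (gradient (\<lambda>x. f x $ i) v) w + pairing b w * u $ i + (pairing L w - 0) * v $ i = w $ i"
        using assms by (simp add: local_equations_def)
      also have "w $ i = pairing (axis i 1) w"
      proof -
        have "pairing (axis i 1) w = (\<Sum>k\<in>UNIV. if k = i then w $ k else 0)"
          unfolding pairing_def by (rule sum.cong) (auto simp: axis_def)
        then show ?thesis by simp
      qed
      finally show "((\<lambda>t. G (v + t *s w) $ i) has_field_derivative pairing (axis i 1) w) (at 0)" .
    qed
    then have "q i j v v = axis i 1 $ j" for i j
      using gradient_difference_quotient[OF q, of i v j] by simp
    then show ?thesis by (simp add: N_def mat_def vec_eq_iff axis_def)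
  qed
  moreover have "\<forall>i j. continuous_on UNIV (\<lambda>z. N (fst z) (snd z) $ i $ j)"
    using q by (simp add: N_def difference_quotient_def)
  moreover have "\<forall>i j y. cpoly (\<lambda>x. N x y $ i $ j)"
    using q by (simp add: N_def difference_quotient_def)
  ultimately show ?thesis unfolding G_def by (rule that)
qed

text \<open>On the zero set of \<open>f\<close> the linear system \<open>N x v (x - v) = b x u\<close> holds, so Cramer's rule
  expresses each coordinate of \<open>x - v\<close>, hence every difference \<open>h x - h v\<close>, as a multiple of the
  parameter \<open>b x\<close>, up to the determinant.\<close>

lemma local_expansion:
  assumes N: "\<And>x y. (f x + pairing b x *s u + (pairing L x - 1) *s v)
        - (f y + pairing b y *s u + (pairing L y - 1) *s v) = N x y *v (x - y)"
    and cN: "\<And>i j y. cpoly (\<lambda>x. N x y $ i $ j)"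
    and v: "f v = 0" "pairing L v = 1" "pairing b v = 0"
    and h: "cpoly h"
  obtains g where "cpoly g"
    "\<And>x. f x = 0 \<Longrightarrow> pairing L x = 1 \<Longrightarrow> det (N x v) * (h x - h v) = pairing b x * g x"
proof -
  define R where "R k x = det (\<chi> i j. if j = k then u $ i else N x v $ i $ j)" for k x
  have R: "cpoly (R k)" for k
    unfolding R_def
  proof (rule cpoly_det)
    show "cpoly (\<lambda>x. (\<chi> i j. if j = k then u $ i else N x v $ i $ j) $ i $ j)" for i j
      by (cases "j = k") (simp_all add: cpoly_const cN)
  qed
  obtain q where q: "difference_quotient h q" using cpoly_difference[OF h] by blast
  define g where "g x = (\<Sum>k\<in>UNIV. q k x v * R k x)" for x
  have "cpoly g"
    unfolding g_def using q R by (intro cpoly_sum cpoly_mult) (auto simp: difference_quotient_def)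
  moreover have "det (N x v) * (h x - h v) = pairing b x * g x" if "f x = 0" "pairing L x = 1" for x
  proof -
    have "N x v *v (x - v) = pairing b x *s u" using N[of x v] that v by simp
    then have R': "(x - v) $ k * det (N x v) = pairing b x * R k x" for k
      unfolding R_def by (rule cramer_scaled)
    have "det (N x v) * (h x - h v) = (\<Sum>k\<in>UNIV. q k x v * ((x - v) $ k * det (N x v)))"
      using q by (simp add: difference_quotient_def sum_distrib_left mult_ac)
    then show ?thesis unfolding R' g_def by (simp add: sum_distrib_left mult_ac)
  qed
  ultimately show ?thesis by (rule that)
qed

text \<open>The expansion of an equation \<open>h\<close> in powers of the parameter has only zero coefficients: a first
  nonzero coefficient \<open>g v\<close> would give \<open>b^i g = 0\<close> on the curve with \<open>g\<close> nonzero there,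
  hence \<open>b = 0\<close> on the curve by irreducibility, and then the curve would be a single point.\<close>

lemma equation_divisible_by_powers:
  assumes Z: "projective_variety Z" "Z \<noteq> {cproj_point v}" "cproj_point v \<in> Z"
    and eqs: "local_equations L b v u Z f"
    and N: "\<And>x y. (f x + pairing b x *s u + (pairing L x - 1) *s v)
        - (f y + pairing b y *s u + (pairing L y - 1) *s v) = N x y *v (x - y)"
    and cN: "\<And>i j y. cpoly (\<lambda>x. N x y $ i $ j)" and N1: "N v v = mat 1"
    and h: "cpoly h" "\<forall>x\<in>chart L Z. h x = 0"
  shows "\<exists>g. cpoly g \<and> (\<forall>x. f x = 0 \<and> pairing L x = 1 \<longrightarrow> det (N x v) ^ i * h x = pairing b x ^ i * g x)"
proof (induction i)
  case 0
  show ?case using h by (intro exI[of _ h]) simp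
next
  case (Suc i)
  then obtain g where g: "cpoly g"
    "\<And>x. f x = 0 \<Longrightarrow> pairing L x = 1 \<Longrightarrow> det (N x v) ^ i * h x = pairing b x ^ i * g x" by blast
  have L: "pairing L v = 1" and bv: "pairing b v = 0" using eqs by (auto simp: local_equations_def)
  have v: "v \<in> chart L Z" using L Z(3) by (simp add: chart_def)
  have fch: "f x = 0" if "x \<in> chart L Z" for x using eqs that by (simp add: local_equations_def)
  have Lch: "pairing L x = 1" if "x \<in> chart L Z" for x using that by (simp add: chart_def)
  note exp = local_expansion[OF N cN fch[OF v] L bv]
  have "g v = 0"
  proof (rule ccontr)
    assume gv: "g v \<noteq> 0"
    have "\<forall>x\<in>chart L Z. pairing b x ^ i * g x = 0"
    proof
      fix x assume x: "x \<in> chart L Z"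
      show "pairing b x ^ i * g x = 0" using g(2)[OF fch[OF x] Lch[OF x]] h(2) x by simp
    qed
    then have "(\<forall>x\<in>chart L Z. pairing b x ^ i = 0) \<or> (\<forall>x\<in>chart L Z. g x = 0)"
      by (intro chart_prime Z(1) cpoly_power cpoly_pairing g(1))
    then have b0: "\<forall>x\<in>chart L Z. pairing b x = 0" using gv v by auto
    have "x = v" if x: "x \<in> chart L Z" for x
    proof -
      have "\<forall>x\<in>chart L Z. x $ k = v $ k" for k
      proof -
        obtain r where r: "cpoly r"
          "\<And>x. f x = 0 \<Longrightarrow> pairing L x = 1 \<Longrightarrow> det (N x v) * (x $ k - v $ k) = pairing b x * r x"
          using exp[OF cpoly_coord[of k]] by metis
        have "cpoly (\<lambda>x. det (N x v))" by (intro cpoly_det cN)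
        moreover have "cpoly (\<lambda>x. x $ k - v $ k)" by (intro cpoly_diff cpoly_coord cpoly_const)
        moreover have "\<forall>x\<in>chart L Z. det (N x v) * (x $ k - v $ k) = 0"
          using r(2)[OF fch Lch] b0 by simp
        ultimately have "(\<forall>x\<in>chart L Z. det (N x v) = 0) \<or> (\<forall>x\<in>chart L Z. x $ k - v $ k = 0)"
          by (rule chart_prime[OF Z(1)])
        moreover have "det (N v v) \<noteq> 0" by (simp add: N1)
        ultimately show ?thesis using v by auto
      qed
      then show ?thesis using x by (simp add: vec_eq_iff)
    qed
    then have "chart L Z = {v}" using v by blast
    then show False using chart_singleton[OF Z(1)] Z(2) by blast
  qed
  obtain g' where g': "cpoly g'"
    "\<And>x. f x = 0 \<Longrightarrow> pairing L x = 1 \<Longrightarrow> det (N x v) * (g x - g v) = pairing b x * g' x"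
    using exp[OF g(1)] by metis
  have "det (N x v) ^ Suc i * h x = pairing b x ^ Suc i * g' x" if "f x = 0" "pairing L x = 1" for x
  proof -
    have "det (N x v) ^ Suc i * h x = pairing b x ^ i * (det (N x v) * (g x - g v))"
      using g(2)[OF that] \<open>g v = 0\<close> by (simp add: mult_ac)
    then show ?thesis using g'(2)[OF that] by (simp add: mult_ac)
  qed
  then show ?case using g'(1) by blast
qed

text \<open>A holomorphic function divisible by all powers of the variable is 0.\<close>

lemma flat_function_vanishes:
  fixes h :: "complex \<Rightarrow> complex"
  assumes "h holomorphic_on ball 0 r" "0 < r"
    and w: "\<And>i. continuous_on (ball 0 r) (w i)"
    and h: "\<And>i s. s \<in> ball 0 r \<Longrightarrow> h s = s ^ i * w i s"
    and "s \<in> ball 0 r"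
  shows "h s = 0"
proof (rule ccontr)
  assume "h s \<noteq> 0"
  have h0: "h 0 = 0" using h[of 0 1] assms(2) by simp
  have "\<not> h constant_on ball 0 r"
    using \<open>h s \<noteq> 0\<close> assms(2,5) h0 unfolding constant_on_def by (metis centre_in_ball)
  then obtain g e n where g: "0 < n" "0 < e" "ball 0 e \<subseteq> ball (0::complex) r" "g holomorphic_on ball 0 e"
    "\<And>x. x \<in> ball 0 e \<Longrightarrow> h x = (x - 0) ^ n * g x" "\<And>x. x \<in> ball 0 e \<Longrightarrow> g x \<noteq> 0"
    using holomorphic_factor_zero_nonconstant[OF assms(1) open_ball connected_ball _ h0] assms(2)
    by (metis centre_in_ball)
  have "g x = x * w (Suc n) x" if "x \<in> ball 0 e" "x \<noteq> 0" for x
    using g(5)[OF that(1)] h[of x "Suc n"] that g(3) by (auto simp: mult_ac)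
  then have "\<forall>\<^sub>F x in at 0. x * w (Suc n) x = g x"
    unfolding eventually_at using g(2) by (intro exI[of _ e]) (auto simp: dist_commute)
  moreover have "((\<lambda>x. x * w (Suc n) x) \<longlongrightarrow> 0 * w (Suc n) 0) (at 0)"
    using w[of "Suc n"] assms(2) by (intro tendsto_mult tendsto_ident_at)
      (simp add: continuous_on_eq_continuous_at isCont_def)
  ultimately have "(g \<longlongrightarrow> 0) (at 0)" using tendsto_cong by fastforce
  moreover have "(g \<longlongrightarrow> g 0) (at 0)"
    using holomorphic_on_imp_continuous_on[OF g(4)] g(2)
    by (simp add: continuous_on_eq_continuous_at isCont_def)
  ultimately have "g 0 = 0" by (metis LIM_unique)
  then show False using g(2) g(6)[of 0] by simp
qed

text \<open>Near \<open>v\<close> the disc is the inverse image, under the map of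
  \<open>exists_local_coordinates\<close>, of the line spanned by \<open>u\<close>. It contains the curve near \<open>v\<close> because
  \<open>f\<close> consists of equations of the curve, and it lies on the curve because all other equations vanish
  on it as well.\<close>

proposition smooth_curve_parametrization:
  assumes Z: "smooth_projective_curve Z" and p: "p \<in> Z"
  obtains \<gamma> :: "complex \<Rightarrow> complex^'n::finite" and \<rho> where
    "0 < \<rho>" "\<forall>k. (\<lambda>s. \<gamma> s $ k) holomorphic_on ball 0 \<rho>"
    "\<forall>s\<in>ball 0 \<rho>. \<gamma> s \<noteq> 0" "cproj_point (\<gamma> 0) = p"
    "\<forall>s\<in>ball 0 \<rho>. cproj_point (\<gamma> s) \<in> Z"
    "inj_on (\<lambda>s. cproj_point (\<gamma> s)) (ball 0 \<rho>)"
    "\<forall>\<epsilon>>0. \<exists>M. open M \<and> p \<in> M \<and> Z \<inter> M \<subseteq> (\<lambda>s. cproj_point (\<gamma> s)) ` (ball 0 \<epsilon> \<inter> ball 0 \<rho>)"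
proof -
  have pc: "projective_curve Z" and pv: "projective_variety Z"
    using Z unfolding smooth_projective_curve_def projective_curve_def by blast+
  obtain A where A: "projective_variety A" "A \<subset> Z" using pc unfolding projective_curve_def by blast
  then have "A \<noteq> {}" unfolding projective_variety_def by blast
  then have notpt: "Z \<noteq> {q}" for q using A(2) by blast
  obtain v where v: "v \<noteq> 0" "p = cproj_point v" by (rule cproj_point_cases)
  obtain L where "pairing v L = 1"
    using subspace_separating_vector[OF vec.subspace_single_0, of v] v(1) by auto
  then have L: "pairing L v = 1" by (simp add: pairing_commute)
  have vZ: "cproj_point v \<in> Z" using p v(2) by simp
  obtain b u f where eqs: "local_equations L b v u Z f"
    by (rule exists_local_equations[OF Z vZ L])
  obtain N where N': "\<forall>x y. (f x + pairing b x *s u + (pairing L x - 1) *s v)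
        - (f y + pairing b y *s u + (pairing L y - 1) *s v) = N x y *v (x - y)"
    and N1: "N v v = mat 1"
    and contN': "\<forall>i j. continuous_on UNIV (\<lambda>z. N (fst z) (snd z) $ i $ j)"
    and cN': "\<forall>i j y. cpoly (\<lambda>x. N x y $ i $ j)"
    by (rule exists_local_coordinates[OF eqs])
  note N = N'[rule_format] and contN = contN'[rule_format] and cN = cN'[rule_format]
  have Lu: "pairing L u = 0" and bv: "pairing b v = 0" and bu: "pairing b u = 1"
    and Lf: "\<And>x. pairing L (f x) = 0" and bf: "\<And>x. pairing b (f x) = 0"
    and fch: "\<And>x. x \<in> chart L Z \<Longrightarrow> f x = 0"
    using eqs by (auto simp: local_equations_def)
  define G where "G x = f x + pairing b x *s u + (pairing L x - 1) *s v" for x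
  have GN: "G x - G y = N x y *v (x - y)" for x y unfolding G_def by (rule N)
  have "v \<in> chart L Z" using L vZ by (simp add: chart_def)
  then have Gv: "G v = 0" using fch L bv by (simp add: G_def)
  have contG: "continuous_on S G" for S
  proof -
    have "cpoly (\<lambda>x. G x $ k)" for k
      using eqs unfolding G_def local_equations_def
      by (simp, intro cpoly_add cpoly_mult cpoly_diff cpoly_const cpoly_pairing) auto
    then have "continuous_on S (\<lambda>x. \<chi> k. G x $ k)"
      by (intro continuous_on_vec_lambda cpoly_continuous)
    then show ?thesis by simp
  qed
  have contdet: "continuous_on UNIV (\<lambda>z. det (N (fst z) (snd z)))"
    unfolding det_def by (intro continuous_intros contN)
  have "open {z. det (N (fst z) (snd z)) \<noteq> 0}"
    by (intro open_Collect_neq contdet continuous_on_const)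
  moreover have "(v, v) \<in> {z. det (N (fst z) (snd z)) \<noteq> 0}" by (simp add: N1)
  ultimately obtain V W where VW: "open V" "open W" "v \<in> V" "v \<in> W"
    "V \<times> W \<subseteq> {z. det (N (fst z) (snd z)) \<noteq> 0}"
    by (elim open_prod_elim) auto
  define D where "D = V \<inter> W"
  have D: "open D" "v \<in> D" using VW by (auto simp: D_def)
  have detN: "det (N x y) \<noteq> 0" if "x \<in> D" "y \<in> D" for x y
    using that VW(5) by (auto simp: D_def)
  \<comment> \<open>Invertibility of the divided difference gives injectivity, and invariance of domain then
    provides a continuous local inverse.\<close>
  have injG: "inj_on G D"
  proof (rule inj_onI)
    fix x y assume xy: "x \<in> D" "y \<in> D" "G x = G y"
    then have "N x y *v (x - y) = 0 *s v" using GN[of x y] by simp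
    then have "(x - y) $ k * det (N x y) = 0" for k
      using cramer_scaled[of "N x y" "x - y" 0 v k] by simp
    then show "x = y" using detN[OF xy(1,2)] by (simp add: vec_eq_iff)
  qed
  obtain \<Psi> where hom: "homeomorphism D (G ` D) G \<Psi>"
    using invariance_of_domain_homeomorphism[OF D(1) contG _ injG] by auto
  have openGD: "open (G ` D)" using invariance_of_domain[OF contG D(1) injG] .
  have contsu: "continuous_on S (\<lambda>s :: complex. s *s u)" for S
    unfolding vector_scalar_mult_def by (intro continuous_intros)
  have "open ((\<lambda>s :: complex. s *s u) -` (G ` D))" by (rule open_vimage[OF openGD contsu])
  moreover have "0 \<in> (\<lambda>s :: complex. s *s u) -` (G ` D)" using Gv D(2) by (auto intro!: image_eqI[of _ _ v])
  ultimately obtain \<rho> where \<rho>: "0 < \<rho>" "ball 0 \<rho> \<subseteq> (\<lambda>s :: complex. s *s u) -` (G ` D)"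
    unfolding open_contains_ball by blast
  define \<gamma> where "\<gamma> s = \<Psi> (s *s u)" for s
  have \<gamma>D: "\<gamma> s \<in> D" and G\<gamma>: "G (\<gamma> s) = s *s u" if "s \<in> ball 0 \<rho>" for s
    using that \<rho>(2) hom unfolding \<gamma>_def homeomorphism_def by auto
  have cont\<gamma>: "continuous_on (ball 0 \<rho>) \<gamma>"
    unfolding \<gamma>_def
    by (rule continuous_on_compose2[OF homeomorphism_cont2[OF hom] contsu]) (use \<rho>(2) in auto)
  have pG: "pairing b (G x) = pairing b x" "pairing L (G x) = pairing L x - 1" for x
    by (simp_all add: G_def pairing_linear Lu bv bu Lf bf L)
  have b\<gamma>: "pairing b (\<gamma> s) = s" and L\<gamma>: "pairing L (\<gamma> s) = 1" if "s \<in> ball 0 \<rho>" for s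
    using pG[of "\<gamma> s"] G\<gamma>[OF that] by (auto simp: pairing_linear bu Lu)
  have f\<gamma>: "f (\<gamma> s) = 0" if "s \<in> ball 0 \<rho>" for s
    using G\<gamma>[OF that] b\<gamma>[OF that] L\<gamma>[OF that] by (simp add: G_def)
  have \<gamma>0: "\<gamma> 0 = v"
    using Gv D(2) hom unfolding \<gamma>_def homeomorphism_def by (metis vector_smult_lzero)
  \<comment> \<open>Cramer's rule for the divided difference turns the difference quotient of \<open>\<gamma>\<close> into a continuous
    function of \<open>s\<close>.\<close>
  have hol: "(\<lambda>s. \<gamma> s $ k) holomorphic_on ball 0 \<rho>" for k
  proof -
    have "\<exists>d. ((\<lambda>s. \<gamma> s $ k) has_field_derivative d) (at a)" if a: "a \<in> ball 0 \<rho>" for a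
    proof -
      define Q where "Q s = det (\<chi> i j. if j = k then u $ i else N (\<gamma> s) (\<gamma> a) $ i $ j) / det (N (\<gamma> s) (\<gamma> a))" for s
      have "continuous_on (ball 0 \<rho>) (\<lambda>s. (\<gamma> s, \<gamma> a))"
        by (intro continuous_intros cont\<gamma>)
      then have cN\<gamma>: "continuous_on (ball 0 \<rho>) (\<lambda>s. N (\<gamma> s) (\<gamma> a) $ i $ j)" for i j
        using continuous_on_compose2[OF contN[of i j], of "ball 0 \<rho>" "\<lambda>s. (\<gamma> s, \<gamma> a)"] by simp
      have "continuous_on (ball 0 \<rho>) (\<lambda>s. (\<chi> i j. if j = k then u $ i else N (\<gamma> s) (\<gamma> a) $ i $ j) $ i $ j)" for i j
        by (cases "j = k") (simp_all add: cN\<gamma>)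
      then have "continuous_on (ball 0 \<rho>) Q"
        unfolding Q_def det_def
        by (intro continuous_on_divide continuous_on_sum continuous_on_mult continuous_on_prod continuous_on_const cN\<gamma>)
          (use detN \<gamma>D a in \<open>auto simp: det_def[symmetric]\<close>)
      then have "(Q \<longlongrightarrow> Q a) (at a)"
        using a by (simp add: continuous_on_eq_continuous_at isCont_def)
      moreover have "\<forall>\<^sub>F s in at a. Q s = (\<gamma> s $ k - \<gamma> a $ k) / (s - a)"
      proof -
        have quot: "Q s = (\<gamma> s $ k - \<gamma> a $ k) / (s - a)" if s: "s \<in> ball 0 \<rho>" "s \<noteq> a" for s
        proof -
          have "N (\<gamma> s) (\<gamma> a) *v (\<gamma> s - \<gamma> a) = (s - a) *s u"
            using GN[of "\<gamma> s" "\<gamma> a"] G\<gamma>[OF s(1)] G\<gamma>[OF a] by (simp add: vector_ssub_ldistrib vector_sub_rdistrib)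
          from cramer_scaled[OF this, of k] show ?thesis
            using detN[OF \<gamma>D[OF s(1)] \<gamma>D[OF a]] s(2) by (simp add: Q_def field_simps)
        qed
        have "\<forall>\<^sub>F s in at a. s \<in> ball 0 \<rho> \<and> s \<noteq> a"
          using eventually_at_in_open[OF open_ball a] by simp
        then show ?thesis by (rule eventually_mono) (use quot in blast)
      qed
      ultimately have "((\<lambda>s. (\<gamma> s $ k - \<gamma> a $ k) / (s - a)) \<longlongrightarrow> Q a) (at a)"
        by (rule Lim_transform_eventually)
      then show ?thesis
        unfolding has_field_derivative_iff by (rule exI)
    qed
    then show ?thesis
      unfolding holomorphic_on_open[OF open_ball] by blast
  qed
  \<comment> \<open>Every equation of the curve vanishes on the disc, since it vanishes there to infinite order.\<close>
  have eq\<gamma>: "h (\<gamma> s) = 0" if h: "cpoly h" "\<forall>x\<in>chart L Z. h x = 0" and s: "s \<in> ball 0 \<rho>" for h s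
  proof -
    have "\<forall>i. \<exists>g. cpoly g \<and> (\<forall>x. f x = 0 \<and> pairing L x = 1 \<longrightarrow> det (N x v) ^ i * h x = pairing b x ^ i * g x)"
      using equation_divisible_by_powers[OF pv notpt vZ eqs N cN N1 h] by blast
    from choice[OF this] obtain g where g: "\<And>i. cpoly (g i)"
      "\<And>i x. f x = 0 \<Longrightarrow> pairing L x = 1 \<Longrightarrow> det (N x v) ^ i * h x = pairing b x ^ i * g i x" by blast
    have hol\<gamma>: "(\<lambda>s. c (\<gamma> s)) holomorphic_on ball 0 \<rho>" if "cpoly c" for c
      using that by induction (auto intro!: holomorphic_intros hol)
    define w where "w i s = g i (\<gamma> s) / det (N (\<gamma> s) v) ^ i" for i s
    show ?thesis
    proof (rule flat_function_vanishes[where h = "\<lambda>s. h (\<gamma> s)" and w = w])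
      show "(\<lambda>s. h (\<gamma> s)) holomorphic_on ball 0 \<rho>" by (rule hol\<gamma>[OF h(1)])
      show "continuous_on (ball 0 \<rho>) (w i)" for i
        unfolding w_def
        by (intro continuous_on_divide continuous_on_power holomorphic_on_imp_continuous_on hol\<gamma> g(1) cpoly_det cN)
          (use detN[OF \<gamma>D D(2)] in auto)
      show "h (\<gamma> s) = s ^ i * w i s" if "s \<in> ball 0 \<rho>" for i s
        using g(2)[OF f\<gamma>[OF that] L\<gamma>[OF that], of i] b\<gamma>[OF that] detN[OF \<gamma>D[OF that] D(2)]
        by (simp add: w_def field_simps)
    qed (use \<rho>(1) s in auto)
  qed
  have \<gamma>Z: "cproj_point (\<gamma> s) \<in> Z" if "s \<in> ball 0 \<rho>" for s
  proof (rule zariski_closed_member[OF _ L\<gamma>[OF that]])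
    show "zariski_closed Z" using pv unfolding projective_variety_def by blast
  qed (use eq\<gamma> that in blast)
  have nbhd: "\<exists>M. open M \<and> p \<in> M \<and> Z \<inter> M \<subseteq> (\<lambda>s. cproj_point (\<gamma> s)) ` (ball 0 \<epsilon> \<inter> ball 0 \<rho>)"
    if "0 < \<epsilon>" for \<epsilon>
  proof -
    define n where "n x = (1 / pairing L x) *s x" for x
    define O' where "O' = {x. pairing L x \<noteq> 0} \<inter> n -` (D \<inter> pairing b -` (ball 0 \<epsilon> \<inter> ball 0 \<rho>))"
    have cL: "continuous_on S (pairing a)" for S and a :: "complex^'n"
      by (rule cpoly_continuous[OF cpoly_pairing])
    have "continuous_on {x. pairing L x \<noteq> 0} n"
      unfolding n_def vector_scalar_mult_def by (intro continuous_intros cL) auto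
    moreover have "open {x. pairing L x \<noteq> 0}" by (intro open_Collect_neq cL continuous_on_const)
    moreover have "open (D \<inter> pairing b -` (ball 0 \<epsilon> \<inter> ball 0 \<rho>))"
      by (intro open_Int D open_vimage open_ball cL)
    ultimately have "open O'" unfolding O'_def by (rule continuous_open_preimage)
    then have "open (cproj_point ` O')"
      by (rule open_cproj_point_image) (auto simp: O'_def pairing_linear)
    moreover have "v \<in> O'" using L bv D(2) \<rho>(1) that by (simp add: O'_def n_def)
    then have "p \<in> cproj_point ` O'" using v(2) by blast
    moreover have "q \<in> (\<lambda>s. cproj_point (\<gamma> s)) ` (ball 0 \<epsilon> \<inter> ball 0 \<rho>)"
      if q: "q \<in> Z" "q \<in> cproj_point ` O'" for q
    proof -
      obtain y where y: "y \<in> O'" "q = cproj_point y" using q(2) by blast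
      define x where "x = n y"
      have Ly: "pairing L y \<noteq> 0" using y(1) by (simp add: O'_def)
      then have y0: "y \<noteq> 0" by (auto simp: pairing_linear)
      have x: "x \<in> D" "pairing b x \<in> ball 0 \<epsilon> \<inter> ball 0 \<rho>" using y(1) by (auto simp: O'_def x_def)
      have qx: "q = cproj_point x" unfolding y(2) x_def n_def using Ly y0 by (simp add: cproj_point_smult)
      have "pairing L x = 1" using Ly by (simp add: x_def n_def pairing_linear)
      then have "x \<in> chart L Z" using q(1) qx by (simp add: chart_def)
      then have "G x = pairing b x *s u" using fch \<open>pairing L x = 1\<close> by (simp add: G_def)
      then have "\<gamma> (pairing b x) = x"
        unfolding \<gamma>_def using homeomorphism_apply1[OF hom x(1)] by simp
      then show ?thesis using x(2) qx by (metis imageI)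
    qed
    ultimately show ?thesis by blast
  qed
  show ?thesis
  proof (rule that[of \<rho> \<gamma>])
    show "inj_on (\<lambda>s. cproj_point (\<gamma> s)) (ball 0 \<rho>)"
    proof (rule inj_onI)
      fix s t assume st: "s \<in> ball 0 \<rho>" "t \<in> ball 0 \<rho>" "cproj_point (\<gamma> s) = cproj_point (\<gamma> t)"
      then obtain c where c: "\<gamma> t = c *s \<gamma> s"
        using cproj_point_eq_iff[OF pairing_one_nonzero[OF L\<gamma>] pairing_one_nonzero[OF L\<gamma>]] by blast
      then have "c = 1" using L\<gamma>[OF st(1)] L\<gamma>[OF st(2)] by (simp add: pairing_linear)
      then show "s = t" using c b\<gamma>[OF st(1)] b\<gamma>[OF st(2)] by simp
    qed
    show "\<forall>s\<in>ball 0 \<rho>. \<gamma> s \<noteq> 0" using pairing_one_nonzero[OF L\<gamma>] by blast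
  qed (use \<rho>(1) hol \<gamma>0 v(2) \<gamma>Z nbhd in blast)+
qed

lemma smooth_curve_islimpt:
  assumes Z: "smooth_projective_curve Z" and p: "p \<in> Z"
  shows "p islimpt Z"
proof (rule islimptI)
  fix T assume T: "p \<in> T" "open T"
  obtain \<gamma> \<rho> where g': "0 < \<rho>" "\<forall>k. (\<lambda>s. \<gamma> s $ k) holomorphic_on ball 0 \<rho>"
    "\<forall>s\<in>ball 0 \<rho>. \<gamma> s \<noteq> 0" "cproj_point (\<gamma> 0) = p"
    "\<forall>s\<in>ball 0 \<rho>. cproj_point (\<gamma> s) \<in> Z"
    "inj_on (\<lambda>s. cproj_point (\<gamma> s)) (ball 0 \<rho>)"
    "\<forall>\<epsilon>>0. \<exists>M. open M \<and> p \<in> M \<and> Z \<inter> M \<subseteq> (\<lambda>s. cproj_point (\<gamma> s)) ` (ball 0 \<epsilon> \<inter> ball 0 \<rho>)"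
    by (rule smooth_curve_parametrization[OF Z p])
  note g = g'[rule_format]
  have "continuous_on (ball 0 \<rho>) (\<lambda>s. \<chi> i. \<gamma> s $ i)"
    by (intro continuous_on_vec_lambda holomorphic_on_imp_continuous_on g(2))
  then have "continuous_on (ball 0 \<rho>) \<gamma>" by simp
  then have "continuous_on (ball 0 \<rho>) (\<lambda>s. cproj_point (\<gamma> s))"
    by (rule continuous_on_compose2[OF continuous_on_cproj_point]) (use g(3) in auto)
  then have op: "open (ball 0 \<rho> \<inter> (\<lambda>s. cproj_point (\<gamma> s)) -` T)"
    by (rule continuous_open_preimage[OF _ open_ball T(2)])
  have "0 \<in> ball 0 \<rho> \<inter> (\<lambda>s. cproj_point (\<gamma> s)) -` T" using g(1,4) T(1) by simp
  from islimptE[OF islimpt_UNIV this op]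
  obtain s where s: "s \<in> ball 0 \<rho>" "cproj_point (\<gamma> s) \<in> T" "s \<noteq> 0" by auto
  have "cproj_point (\<gamma> s) \<noteq> p"
    using inj_onD[OF g(6), of s 0] s g(1,4) by auto
  then show "\<exists>y\<in>Z. y \<in> T \<and> y \<noteq> p"
    using g(5)[OF s(1)] s(2) by blast
qed

lemma smooth_curve_variety: "smooth_projective_curve Z \<Longrightarrow> projective_variety Z"
  by (simp add: smooth_projective_curve_def projective_curve_def)

lemma smooth_curve_closed: "smooth_projective_curve Z \<Longrightarrow> closed Z"
  using smooth_curve_variety zariski_closed_imp_closed by (auto simp: projective_variety_def)

text \<open>By the identity theorem, a closed subset that accumulates at \<open>p\<close> contains the disc around
  \<open>p\<close>. The Zariski closure of the disc is irreducible, again by the identity theorem, and would be a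
  variety strictly between the point \<open>p\<close> and the curve.\<close>

lemma proper_closed_subset_discrete:
  assumes Z: "smooth_projective_curve Z" and A: "zariski_closed A" "A \<subset> Z"
  shows "\<not> p islimpt A"
proof
  assume lim: "p islimpt A"
  have "p islimpt Z" by (rule islimpt_subset[OF lim]) (use A(2) in blast)
  then have p: "p \<in> Z" using smooth_curve_closed[OF Z] closed_limpt by blast
  obtain \<gamma> \<rho> where g': "0 < \<rho>" "\<forall>k. (\<lambda>s. \<gamma> s $ k) holomorphic_on ball 0 \<rho>"
    "\<forall>s\<in>ball 0 \<rho>. \<gamma> s \<noteq> 0" "cproj_point (\<gamma> 0) = p"
    "\<forall>s\<in>ball 0 \<rho>. cproj_point (\<gamma> s) \<in> Z"
    "inj_on (\<lambda>s. cproj_point (\<gamma> s)) (ball 0 \<rho>)"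
    "\<forall>\<epsilon>>0. \<exists>M. open M \<and> p \<in> M \<and> Z \<inter> M \<subseteq> (\<lambda>s. cproj_point (\<gamma> s)) ` (ball 0 \<epsilon> \<inter> ball 0 \<rho>)"
    by (rule smooth_curve_parametrization[OF Z p])
  note g = g'[rule_format]
  have hol: "(\<lambda>s. f (\<gamma> s)) holomorphic_on ball 0 \<rho>" if "homogeneous_poly d f" for d f
    using homogeneous_imp_cpoly[OF that] by induction (auto intro!: holomorphic_intros g(2))
  have van: "vanishes_at f (cproj_point (\<gamma> s)) \<longleftrightarrow> f (\<gamma> s) = 0"
    if "homogeneous_poly d f" "s \<in> ball 0 \<rho>" for d f s
    using vanishes_at_cproj_point[OF that(1) g(3)[OF that(2)]] .
  define C where "C = (\<lambda>s. cproj_point (\<gamma> s)) ` ball 0 \<rho>"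
  define B where "B = \<Inter>{A. zariski_closed A \<and> C \<subseteq> A}"
  have B: "zariski_closed B" "C \<subseteq> B" "\<And>A. zariski_closed A \<Longrightarrow> C \<subseteq> A \<Longrightarrow> B \<subseteq> A"
    unfolding B_def by (auto intro: zariski_closed_Inter)
  have identity: "C \<subseteq> {q. vanishes_at f q}"
    if f: "homogeneous_poly d f" and acc: "0 islimpt {s \<in> ball 0 \<rho>. f (\<gamma> s) = 0}" for d f
  proof -
    have "f (\<gamma> s) = 0" if "s \<in> ball 0 \<rho>" for s
      by (rule analytic_continuation[OF hol[OF f] open_ball connected_ball _ _ acc]) (use that g(1) in auto)
    then show ?thesis using van[OF f] by (auto simp: C_def)
  qed
  have "C \<subseteq> A"
  proof -
    obtain F where F: "\<forall>f\<in>F. \<exists>d. homogeneous_poly d f" "A = {q. \<forall>f\<in>F. vanishes_at f q}"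
      using A(1) unfolding zariski_closed_def by (elim exE conjE)
    have "C \<subseteq> {q. vanishes_at f q}" if "f \<in> F" for f
    proof -
      from F(1) that have "\<exists>d. homogeneous_poly d f" by (rule bspec)
      then obtain d where d: "homogeneous_poly d f" by (elim exE)
      have "0 islimpt {s \<in> ball 0 \<rho>. f (\<gamma> s) = 0}"
        unfolding islimpt_approachable
      proof (intro allI impI)
        fix e :: real assume "0 < e"
        then obtain M where M: "open M" "p \<in> M"
          "Z \<inter> M \<subseteq> (\<lambda>s. cproj_point (\<gamma> s)) ` (ball 0 e \<inter> ball 0 \<rho>)" using g(7) by blast
        obtain q where q: "q \<in> A" "q \<in> M" "q \<noteq> p" using islimptE[OF lim M(2,1)] by blast
        then obtain s where s: "s \<in> ball 0 e" "s \<in> ball 0 \<rho>" "q = cproj_point (\<gamma> s)"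
          using M(3) A(2) by blast
        have "\<forall>f\<in>F. vanishes_at f q" using q(1) unfolding F(2) by (rule CollectD)
        then have "vanishes_at f q" using \<open>f \<in> F\<close> by (rule bspec)
        then have "f (\<gamma> s) = 0" using van[OF d s(2)] s(3) by simp
        moreover have "s \<noteq> 0" using q(3) s(3) g(4) by auto
        ultimately show "\<exists>x'\<in>{s \<in> ball 0 \<rho>. f (\<gamma> s) = 0}. x' \<noteq> 0 \<and> dist x' 0 < e"
          using s(1,2) by (intro bexI[of _ s]) auto
      qed
      then show ?thesis by (rule identity[OF d])
    qed
    then show ?thesis unfolding F(2) by blast
  qed
  have "projective_variety B"
    unfolding projective_variety_def
  proof (intro conjI allI impI B(1))
    show "B \<noteq> {}" using B(2) g(1) by (auto simp: C_def)
    fix A1 A2 assume A12: "zariski_closed A1 \<and> zariski_closed A2 \<and> B \<subseteq> A1 \<union> A2"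
    have "C \<subseteq> A1 \<or> C \<subseteq> A2"
    proof (rule ccontr)
      assume no: "\<not> (C \<subseteq> A1 \<or> C \<subseteq> A2)"
      have ex: "\<exists>d f. homogeneous_poly d f \<and> E \<subseteq> {q. vanishes_at f q} \<and> \<not> C \<subseteq> {q. vanishes_at f q}"
        if E: "zariski_closed E" "\<not> C \<subseteq> E" for E
      proof -
        obtain F where F: "\<forall>f\<in>F. \<exists>d. homogeneous_poly d f" "E = {q. \<forall>f\<in>F. vanishes_at f q}"
          using E(1) unfolding zariski_closed_def by (elim exE conjE)
        have "\<exists>f\<in>F. \<not> C \<subseteq> {q. vanishes_at f q}" using E(2) unfolding F(2) by blast
        then obtain f where f: "f \<in> F" "\<not> C \<subseteq> {q. vanishes_at f q}" by (elim bexE)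
        from F(1) f(1) have "\<exists>d. homogeneous_poly d f" by (rule bspec)
        then obtain d where d: "homogeneous_poly d f" by (elim exE)
        have "E \<subseteq> {q. vanishes_at f q}" unfolding F(2) using f(1) by blast
        then show ?thesis using d f(2) by blast
      qed
      obtain d f where f: "homogeneous_poly d f" "A1 \<subseteq> {q. vanishes_at f q}" "\<not> C \<subseteq> {q. vanishes_at f q}"
        using ex[of A1] no A12 by blast
      obtain e h where h: "homogeneous_poly e h" "A2 \<subseteq> {q. vanishes_at h q}" "\<not> C \<subseteq> {q. vanishes_at h q}"
        using ex[of A2] no A12 by blast
      have "f (\<gamma> s) = 0 \<or> h (\<gamma> s) = 0" if s: "s \<in> ball 0 \<rho>" for s
      proof -
        have "cproj_point (\<gamma> s) \<in> A1 \<union> A2" using s B(2) A12 unfolding C_def by blast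
        then show ?thesis using f(2) h(2) van[OF f(1) s] van[OF h(1) s] by blast
      qed
      then have "ball 0 \<rho> \<subseteq> {s \<in> ball 0 \<rho>. f (\<gamma> s) = 0} \<union> {s \<in> ball 0 \<rho>. h (\<gamma> s) = 0}"
        by blast
      moreover have "(0 :: complex) islimpt ball 0 \<rho>" using g(1) by (simp add: islimpt_ball)
      ultimately have "0 islimpt {s \<in> ball 0 \<rho>. f (\<gamma> s) = 0} \<union> {s \<in> ball 0 \<rho>. h (\<gamma> s) = 0}"
        by (rule islimpt_subset[rotated])
      then have "0 islimpt {s \<in> ball 0 \<rho>. f (\<gamma> s) = 0} \<or> 0 islimpt {s \<in> ball 0 \<rho>. h (\<gamma> s) = 0}"
        by (simp add: islimpt_Un)
      then show False using identity[OF f(1)] identity[OF h(1)] f(3) h(3) by blast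
    qed
    then show "B \<subseteq> A1 \<or> B \<subseteq> A2" using B(3) A12 by blast
  qed
  moreover have "projective_variety {p}"
    unfolding projective_variety_def using zariski_closed_point by auto
  moreover have "{p} \<subset> B"
  proof -
    have "(\<lambda>s. cproj_point (\<gamma> s)) (of_real (\<rho> / 2)) \<noteq> p"
      using inj_onD[OF g(6), of "of_real (\<rho> / 2)" 0] g(1,4) by auto
    moreover have "(\<lambda>s. cproj_point (\<gamma> s)) (of_real (\<rho> / 2)) \<in> C" "p \<in> C"
      unfolding C_def using g(1,4) by (auto intro!: image_eqI[of p _ 0])
    ultimately show ?thesis using B(2) by blast
  qed
  moreover have "B \<subset> Z" using B(3)[OF A(1) \<open>C \<subseteq> A\<close>] A(2) by blast
  moreover have "\<not> (\<exists>A B. projective_variety A \<and> projective_variety B \<and> A \<subset> B \<and> B \<subset> Z)"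
    using Z by (simp add: smooth_projective_curve_def projective_curve_def)
  ultimately show False by blast
qed


section \<open>Fixed points of automorphisms\<close>

text \<open>Where \<open>f\<close> is given by forms \<open>F\<close>, fixed points are the zeros of the minors of \<open>x\<close> and \<open>F x\<close>. Together
  with the locus where the forms do not describe \<open>f\<close> they make up a closed set that contains all
  fixed points and avoids a given other point.\<close>

lemma zariski_closed_fixed_points:
  assumes Z: "zariski_closed Z" and f: "regular_map Z Z f"
  shows "zariski_closed {q \<in> Z. f q = q}"
proof -
  let ?F = "{q \<in> Z. f q = q}"
  have sep: "\<exists>A. zariski_closed A \<and> ?F \<subseteq> A \<and> p \<notin> A" if p: "p \<notin> ?F" for p
  proof (cases "p \<in> Z")
    case True
    then obtain C d F where C: "zariski_closed C" "p \<notin> C" and F: "\<forall>i. homogeneous_poly d (\<lambda>x. F x $ i)"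
      and eq: "\<forall>q\<in>Z - C. \<forall>x\<in>line_of q. x \<noteq> 0 \<longrightarrow> F x \<noteq> 0 \<and> f q = cproj_point (F x)"
      using f unfolding regular_map_def by blast
    have hom: "homogeneous_poly (1 + d) (\<lambda>x. x $ i * F x $ j + (-1) * (x $ j * F x $ i))" for i j
      using F by (intro homogeneous_add homogeneous_scale homogeneous_mult homogeneous_coord) auto
    define M where
      "M = (\<Inter>(i, j)\<in>UNIV. {q. vanishes_at (\<lambda>x. x $ i * F x $ j + (-1) * (x $ j * F x $ i)) q})"
    have M: "zariski_closed M"
      unfolding M_def using zariski_closed_vanishing[OF hom] by (intro zariski_closed_Inter) auto
    have inM: "cproj_point x \<in> M \<longleftrightarrow> (\<exists>c. F x = c *s x)" if "x \<noteq> 0" for x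
    proof -
      have "cproj_point x \<in> M \<longleftrightarrow> (\<forall>i j. x $ i * F x $ j = x $ j * F x $ i)"
        using vanishes_at_cproj_point[OF hom that] unfolding M_def by auto
      then show ?thesis using minors_vanish_iff[OF that] by blast
    qed
    have val: "F x \<noteq> 0 \<and> f q = cproj_point (F x)" if "q \<in> Z" "q \<notin> C" "x \<noteq> 0" "q = cproj_point x" for q x
      using eq[rule_format, of q x] that mem_line_cproj_point[of x] by blast
    have "?F \<subseteq> C \<union> M"
    proof
      fix q assume q: "q \<in> ?F"
      obtain x where x: "x \<noteq> 0" "q = cproj_point x" by (rule cproj_point_cases)
      show "q \<in> C \<union> M"
      proof (cases "q \<in> C")
        case False
        then have "F x \<noteq> 0" "cproj_point x = cproj_point (F x)" using val[OF _ False x] q x(2) by auto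
        then show ?thesis using inM[OF x(1)] cproj_point_eq_iff[OF x(1)] x(2) by blast
      qed simp
    qed
    moreover have "p \<notin> C \<union> M"
    proof
      assume "p \<in> C \<union> M"
      then have "p \<in> M" using C by blast
      obtain x where x: "x \<noteq> 0" "p = cproj_point x" by (rule cproj_point_cases)
      then have "cproj_point x = cproj_point (F x)"
        using inM[OF x(1)] \<open>p \<in> M\<close> val[OF True C(2) x] cproj_point_eq_iff[OF x(1)] by blast
      then show False using val[OF True C(2) x] x(2) p True by auto
    qed
    ultimately show ?thesis using zariski_closed_Un[OF C(1) M] by blast
  qed (use Z in blast)
  have "?F = \<Inter>{A. zariski_closed A \<and> ?F \<subseteq> A}" 
  proof
    show "\<Inter>{A. zariski_closed A \<and> ?F \<subseteq> A} \<subseteq> ?F"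
    proof (rule subsetI, rule ccontr)
      fix p assume p: "p \<in> \<Inter>{A. zariski_closed A \<and> ?F \<subseteq> A}" "p \<notin> ?F"
      from sep[OF p(2)] obtain A where A: "zariski_closed A \<and> ?F \<subseteq> A" "p \<notin> A" by (elim exE conjE) simp
      then show False using InterD[OF p(1), of A] by simp
    qed
  qed blast
  also have "zariski_closed \<dots>" by (rule zariski_closed_Inter) blast
  finally show ?thesis .
qed

lemma finite_Union_not_islimpt:
  "finite I \<Longrightarrow> (\<And>i. i \<in> I \<Longrightarrow> \<not> p islimpt A i) \<Longrightarrow> \<not> p islimpt (\<Union>i\<in>I. A i)"
  by (induction I rule: finite_induct) (auto simp: islimpt_Un)

lemma galois_covering_fixed_points_discrete:
  assumes cov: "galois_covering W act Z X \<pi>" and fin: "finite (carrier W)"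
  shows "\<not> p islimpt {q \<in> Z. \<exists>g\<in>carrier W - {\<one>\<^bsub>W\<^esub>}. act q g = q}"
proof -
  have Z: "smooth_projective_curve Z" using cov by (simp add: galois_covering_def curve_quotient_def)
  have zc: "zariski_closed Z" using smooth_curve_variety[OF Z] by (simp add: projective_variety_def)
  have "\<not> p islimpt {q \<in> Z. act q g = q}" if g: "g \<in> carrier W - {\<one>\<^bsub>W\<^esub>}" for g
  proof (rule proper_closed_subset_discrete[OF Z])
    show "zariski_closed {q \<in> Z. act q g = q}"
      using cov g by (intro zariski_closed_fixed_points[OF zc]) (simp add: galois_covering_def)
    show "{q \<in> Z. act q g = q} \<subset> Z"
      using cov g by (auto simp: galois_covering_def)
  qed
  then have "\<not> p islimpt (\<Union>g\<in>carrier W - {\<one>\<^bsub>W\<^esub>}. {q \<in> Z. act q g = q})"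
    by (intro finite_Union_not_islimpt) (use fin in auto)
  moreover have "(\<Union>g\<in>carrier W - {\<one>\<^bsub>W\<^esub>}. {q \<in> Z. act q g = q})
      = {q \<in> Z. \<exists>g\<in>carrier W - {\<one>\<^bsub>W\<^esub>}. act q g = q}" by blast
  ultimately show ?thesis by simp
qed


section \<open>Finiteness of Weyl groups\<close>

lemma root_reflection_involution: "root_reflection a (root_reflection a x) = x"
  by (cases "a = 0") (simp_all add: root_reflection_def algebra_simps inner_diff_left)

lemma linear_root_reflection: "linear (root_reflection a)"
  by (rule linearI) (simp_all add: root_reflection_def algebra_simps inner_add_left add_divide_distrib)

text \<open>Elements of the Weyl group are linear, permute the roots and fix the orthogonal complement of the
  roots, so they are determined by the permutation of the finite set of roots.\<close>

lemma finite_weyl_group: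
  assumes R: "root_system (R :: 'e::euclidean_space set)"
  shows "finite (carrier (weyl_group R))"
proof -
  let ?G = "BijGroup (UNIV :: 'e set)"
  define P where "P f \<longleftrightarrow> linear f \<and> f ` R = R \<and> (\<forall>x. (\<forall>a\<in>R. x \<bullet> a = 0) \<longrightarrow> f x = x)" for f :: "'e \<Rightarrow> 'e"
  have bij: "bij (root_reflection a)" for a :: 'e
    by (rule o_bij[of "root_reflection a"]) (auto simp: root_reflection_involution)
  have refl: "P (root_reflection a)" if "a \<in> R" for a
    using R that linear_root_reflection[of a] unfolding P_def root_system_def
    by (auto simp: root_reflection_def)
  have inv: "inv\<^bsub>?G\<^esub> (root_reflection a) = root_reflection a" for a
  proof -
    have "root_reflection a \<in> Bij UNIV" using bij by (simp add: Bij_def)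
    then have "inv\<^bsub>?G\<^esub> (root_reflection a) = inv_into UNIV (root_reflection a)"
      by (simp add: inv_BijGroup restrict_UNIV)
    also have "\<dots> = root_reflection a"
      by (rule inv_equality) (simp_all add: root_reflection_involution)
    finally show ?thesis .
  qed
  have "P f \<and> f \<in> Bij UNIV" if "f \<in> carrier (weyl_group R)" for f
  proof -
    have "f \<in> generate ?G (carrier ?G \<inter> root_reflection ` R)"
      using that by (simp add: weyl_group_def carrier_subgroup_generated)
    then show ?thesis
    proof induction
      case one
      then show ?case
        by (auto simp: P_def BijGroup_def restrict_UNIV id_def[symmetric] Bij_def linear_id)
    next
      case (incl h)
      then show ?case using refl bij by (auto simp: Bij_def)
    next
      case (inv h)
      then show ?case using refl bij \<open>\<And>a. inv\<^bsub>?G\<^esub> (root_reflection a) = root_reflection a\<close>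
        by (auto simp: Bij_def)
    next
      case (eng h1 h2)
      then have "h1 \<otimes>\<^bsub>?G\<^esub> h2 = h1 \<circ> h2"
        by (simp add: BijGroup_def compose_def restrict_UNIV o_def)
      moreover have "(h1 \<circ> h2) ` R = R"
        using eng.IH unfolding P_def image_comp[symmetric] by simp
      then have "P (h1 \<circ> h2)"
        using eng.IH unfolding P_def by (simp add: linear_compose)
      moreover have "h1 \<circ> h2 \<in> Bij UNIV"
        using eng.IH by (auto simp: Bij_def intro: bij_comp)
      ultimately show ?case by metis
    qed
  qed
  moreover have "finite {f. P f}"
  proof (rule finite_imageD)
    show "inj_on (\<lambda>f. restrict f R) {f. P f}"
    proof (rule inj_onI)
      fix f f' assume *: "f \<in> {f. P f}" "f' \<in> {f. P f}" "restrict f R = restrict f' R"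
      then have lin: "linear f" "linear f'" by (auto simp: P_def)
      show "f = f'"
      proof
        fix x
        obtain y z where yz: "y \<in> span R" "\<And>w. w \<in> span R \<Longrightarrow> orthogonal z w" "x = y + z"
          using orthogonal_subspace_decomp_exists[of R x] by metis
        have "f a = f' a" if "a \<in> R" for a using *(3) that by (metis restrict_apply')
        then have "f y = f' y" using linear_eq_on_span[OF lin _ yz(1)] by blast
        moreover have "\<forall>a\<in>R. z \<bullet> a = 0" using yz(2) by (auto simp: orthogonal_def span_base)
        then have "f z = z" "f' z = z" using * by (auto simp: P_def)
        ultimately show "f x = f' x" using yz(3) lin by (simp add: linear_add)
      qed
    qed
    have "finite R" using R by (simp add: root_system_def)
    moreover have "(\<lambda>f. restrict f R) ` {f. P f} \<subseteq> R \<rightarrow>\<^sub>E R" by (auto simp: P_def)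
    ultimately show "finite ((\<lambda>f. restrict f R) ` {f. P f})"
      by (meson finite_PiE finite_subset)
  qed
  ultimately show ?thesis by (auto intro: finite_subset[of _ "{f. P f}"])
qed


section \<open>Quotients of Hausdorff spaces by finite groups\<close>

text \<open>The topological facts about a Galois covering of curves and its intermediate quotient that the
  description of closures uses. The last two assumptions say that \<open>Z\<close> has no isolated points and that
  the points with nontrivial stabilizer do not accumulate anywhere.\<close>

locale finite_quotient = group W for W (structure) +
  fixes Z :: "'z::t2_space set" and act :: "'z \<Rightarrow> 'a \<Rightarrow> 'z"
    and H :: "'a set" and Y :: "'y::t2_space set" and \<phi> :: "'z \<Rightarrow> 'y"
  assumes finite_W: "finite (carrier W)"
    and act: "right_action W Z act"
    and H: "subgroup H W"
    and compact_Z: "compact Z"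
    and cont_act: "g \<in> carrier W \<Longrightarrow> continuous_on Z (\<lambda>z. act z g)"
    and cont_\<phi>: "continuous_on Z \<phi>" and \<phi>_surj: "\<phi> ` Z = Y"
    and \<phi>_eq_iff: "z \<in> Z \<Longrightarrow> z' \<in> Z \<Longrightarrow> \<phi> z = \<phi> z' \<longleftrightarrow> (\<exists>h\<in>H. z' = act z h)"
    and islimpt_Z: "z \<in> Z \<Longrightarrow> z islimpt Z"
    and fixed_discrete: "\<not> z islimpt {q \<in> Z. \<exists>g\<in>carrier W - {\<one>}. act q g = q}"
begin

definition free :: "'z set" where
  "free = {z \<in> Z. \<forall>g\<in>carrier W. act z g = z \<longrightarrow> g = \<one>}"

lemma act_closed: "z \<in> Z \<Longrightarrow> g \<in> carrier W \<Longrightarrow> act z g \<in> Z"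
  and act_one: "z \<in> Z \<Longrightarrow> act z \<one> = z"
  and act_mult: "z \<in> Z \<Longrightarrow> g \<in> carrier W \<Longrightarrow> h \<in> carrier W \<Longrightarrow> act z (g \<otimes> h) = act (act z g) h"
  using act unfolding right_action_def by blast+

lemma H_carrier: "h \<in> H \<Longrightarrow> h \<in> carrier W"
  using H subgroup.subset by blast

lemma H_inv: "h \<in> H \<Longrightarrow> inv h \<in> H"
  using H subgroup.m_inv_closed by metis

lemma finite_H: "finite H"
  by (rule finite_subset[OF subgroup.subset[OF H] finite_W])

text \<open>For \<open>H\<close> the stabilizer of \<open>l\<close> this point depends only on \<open>l u\<close>: it is the point
  \<open>\<mu>\<^sup>-\<^sup>1 (l u)\<close> for the bijection \<open>\<mu>\<close> attached to the base point \<open>z\<close>.\<close>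

definition pt :: "'z \<Rightarrow> 'a \<Rightarrow> 'y" where
  "pt z u = \<phi> (act z (inv u))"

lemma pt_in_Y: "z \<in> Z \<Longrightarrow> u \<in> carrier W \<Longrightarrow> pt z u \<in> Y"
  using \<phi>_surj act_closed by (auto simp: pt_def)

lemma pt_mult_H: 
  assumes "z \<in> Z" "u \<in> carrier W" "h \<in> H"
  shows "pt z (h \<otimes> u) = pt z u"
proof -
  have "act z (inv (h \<otimes> u)) = act (act z (inv u)) (inv h)"
    using assms H_carrier[OF assms(3)] by (simp add: inv_mult_group act_mult)
  then have "\<phi> (act z (inv u)) = \<phi> (act z (inv (h \<otimes> u)))"
    using assms H_inv H_carrier act_closed by (subst \<phi>_eq_iff) auto
  then show ?thesis by (simp add: pt_def)
qed

lemma pt_act: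
  assumes "z \<in> Z" "u \<in> carrier W" "w \<in> carrier W"
  shows "pt (act z w) u = pt z (u \<otimes> inv w)"
  using assms by (simp add: pt_def inv_mult_group act_mult)

lemma pt_eq_imp:
  assumes "z \<in> free" "u \<in> carrier W" "u' \<in> carrier W" "pt z u = pt z u'"
  shows "\<exists>h\<in>H. u = h \<otimes> u'"
proof -
  have z: "z \<in> Z" using assms(1) by (simp add: free_def)
  obtain h where h: "h \<in> H" "act z (inv u') = act (act z (inv u)) h"
    using assms z act_closed \<phi>_eq_iff[of "act z (inv u)" "act z (inv u')"] by (auto simp: pt_def)
  note hc = H_carrier[OF h(1)]
  have "act z (inv u \<otimes> h \<otimes> u') = act (act z (inv u')) u'"
    using z assms(2,3) hc h(2) by (simp add: act_mult act_closed)
  also have "\<dots> = z" using z assms(3) by (simp add: act_mult[symmetric] act_one)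
  finally have "inv u \<otimes> h \<otimes> u' = \<one>"
    using assms(1-3) hc by (simp add: free_def)
  then have "u \<otimes> (inv u \<otimes> h \<otimes> u') = u" using assms(2) by simp
  then have "u = h \<otimes> u'" using assms(2,3) hc by (simp add: m_assoc[symmetric])
  then show ?thesis using h(1) by blast
qed

lemma act_free: 
  assumes "z \<in> free" "w \<in> carrier W"
  shows "act z w \<in> free"
proof -
  have z: "z \<in> Z" using assms(1) by (simp add: free_def)
  have "g = \<one>" if g: "g \<in> carrier W" "act (act z w) g = act z w" for g
  proof -
    have "act z (w \<otimes> g \<otimes> inv w) = act (act z w) (inv w)"
      using z assms(2) g by (simp add: act_mult act_closed)
    also have "\<dots> = z" using z assms(2) by (simp add: act_mult[symmetric] act_one)
    finally have "w \<otimes> g \<otimes> inv w = \<one>" using assms g(1) by (simp add: free_def)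
    then have "w \<otimes> g = w" using assms(2) g(1) by (metis inv_equality inv_inv inv_closed m_closed)
    then show "g = \<one>" using assms(2) g(1) by simp
  qed
  then show ?thesis using z assms(2) by (simp add: free_def act_closed)
qed

lemma free_neighbourhood:
  obtains A where "open A" "z \<in> A" "\<forall>q\<in>Z \<inter> A. q \<noteq> z \<longrightarrow> q \<in> free"
proof -
  obtain A where A: "z \<in> A" "open A" "\<forall>q\<in>{q \<in> Z. \<exists>g\<in>carrier W - {\<one>}. act q g = q}. q \<in> A \<longrightarrow> q = z"
    using fixed_discrete[of z] unfolding islimpt_def by blast
  show ?thesis by (rule that[OF A(2,1)]) (use A(3) in \<open>auto simp: free_def\<close>)
qed

text \<open>Openness of \<open>\<phi>\<close>: the complement of the \<open>H\<close>-saturation of \<open>A\<close> is compact, so its image is closed.\<close>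

lemma openin_Z_imp_open_image:
  assumes A: "open A" and z: "z \<in> Z" "z \<in> A"
  obtains M where "open M" "\<phi> z \<in> M" "Y \<inter> M \<subseteq> \<phi> ` (Z \<inter> A)"
proof -
  define Z' where "Z' = (\<Inter>h\<in>H. Z \<inter> (\<lambda>q. act q h) -` (- A))"
  have one: "\<one> \<in> H" using H by (rule subgroup.one_closed)
  have "closed (Z \<inter> (\<lambda>q. act q h) -` (- A))" if "h \<in> H" for h
    using cont_act[OF H_carrier[OF that]] compact_imp_closed[OF compact_Z] A
    by (intro continuous_on_closed_vimage[THEN iffD1, rule_format, of Z, simplified Int_commute]) auto
  then have "closed Z'" unfolding Z'_def by blast
  moreover have "Z' \<subseteq> Z" unfolding Z'_def using one by blast
  ultimately have "compact Z'" using compact_Z by (metis compact_Int_closed inf.absorb_iff2)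
  then have "compact (\<phi> ` Z')"
    using cont_\<phi> \<open>Z' \<subseteq> Z\<close> by (intro compact_continuous_image) (auto intro: continuous_on_subset)
  then have "open (- \<phi> ` Z')" using compact_imp_closed by blast
  moreover have "\<phi> z \<in> - \<phi> ` Z'"
  proof
    assume "\<phi> z \<in> \<phi> ` Z'"
    then obtain q where q: "q \<in> Z'" "\<phi> z = \<phi> q" by blast
    then have "q \<in> Z" using \<open>Z' \<subseteq> Z\<close> by blast
    then obtain h where "h \<in> H" "z = act q h" using \<phi>_eq_iff[of q z] q(2) z(1) by auto
    then show False using q(1) z(2) unfolding Z'_def by blast
  qed
  moreover have "Y \<inter> - \<phi> ` Z' \<subseteq> \<phi> ` (Z \<inter> A)"
  proof
    fix y assume y: "y \<in> Y \<inter> - \<phi> ` Z'"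
    then obtain q where q: "q \<in> Z" "y = \<phi> q" using \<phi>_surj by blast
    then have "q \<notin> Z'" using y by blast
    then obtain h where h: "h \<in> H" "act q h \<in> A" using q(1) unfolding Z'_def by blast
    have "\<phi> q = \<phi> (act q h)" using q(1) h(1) H_carrier act_closed by (subst \<phi>_eq_iff) auto
    then show "y \<in> \<phi> ` (Z \<inter> A)" using q h H_carrier act_closed by auto
  qed
  ultimately show ?thesis by (rule that)
qed

text \<open>Points near \<open>z\<close> that avoid the finite set \<open>z H\<close> map to points near, but different from, \<open>\<phi> z\<close>.\<close>

lemma islimpt_Y:
  assumes "z \<in> Z"
  shows "\<phi> z islimpt Y"
proof (rule islimptI)
  fix T assume T: "\<phi> z \<in> T" "open T"
  obtain A where A: "open A" "z \<in> A" "\<forall>q\<in>Z. q \<in> A \<longrightarrow> \<phi> q \<in> T"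
    using cont_\<phi>[unfolded continuous_on_topological, rule_format, OF assms T(2,1)] by blast
  have "closed ((\<lambda>h. act z h) ` H - {z})" using finite_H by (simp add: finite_imp_closed)
  then have op: "open (A - ((\<lambda>h. act z h) ` H - {z}))" using A(1) by blast
  have "z \<in> A - ((\<lambda>h. act z h) ` H - {z})" using A(2) by simp
  from islimptE[OF islimpt_Z[OF assms] this op]
  obtain q where q: "q \<in> Z" "q \<in> A" "q \<notin> (\<lambda>h. act z h) ` H - {z}" "q \<noteq> z" by auto
  then have "\<phi> z \<noteq> \<phi> q" using \<phi>_eq_iff[OF assms q(1)] by auto
  then show "\<exists>y\<in>Y. y \<in> T \<and> y \<noteq> \<phi> z" using q A(3) \<phi>_surj by (intro bexI[of _ "\<phi> q"]) auto
qed

text \<open>If \<open>z\<close> has trivial stabilizer, a neighbourhood disjoint from its translates works. If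
  \<open>g \<noteq> 1\<close> fixes \<open>z\<close>, local injectivity makes \<open>g\<close> fix all points near \<open>z\<close>, which contradicts the
  discreteness of fixed points.\<close>

lemma free_iff_locally_injective:
  assumes \<pi>: "\<And>z z'. z \<in> Z \<Longrightarrow> z' \<in> Z \<Longrightarrow> \<pi> z = \<pi> z' \<longleftrightarrow> (\<exists>g\<in>carrier W. z' = act z g)"
    and z: "z \<in> Z"
  shows "z \<in> free \<longleftrightarrow> (\<exists>N. open N \<and> z \<in> N \<and> inj_on \<pi> (N \<inter> Z))"
proof
  assume free: "z \<in> free"
  have "\<exists>N. open N \<and> z \<in> N \<and> (\<forall>q\<in>N \<inter> Z. act q g \<notin> N)" if g: "g \<in> carrier W - {\<one>}" for g
  proof -
    have "act z g \<noteq> z" using free g by (auto simp: free_def)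
    then obtain A B where AB: "open A" "open B" "z \<in> A" "act z g \<in> B" "A \<inter> B = {}"
      using hausdorff by metis
    have "g \<in> carrier W" using g by blast
    then obtain A' where A': "open A'" "z \<in> A'" "\<forall>q\<in>Z. q \<in> A' \<longrightarrow> act q g \<in> B"
      using cont_act[unfolded continuous_on_topological, rule_format, OF _ z AB(2,4)] by blast
    have "\<forall>q\<in>(A \<inter> A') \<inter> Z. act q g \<notin> A \<inter> A'" using A'(3) AB(5) by blast
    then show ?thesis using AB(1,3) A'(1,2) by (intro exI[of _ "A \<inter> A'"] conjI open_Int IntI)
  qed
  then have "\<forall>g\<in>carrier W - {\<one>}. \<exists>N. open N \<and> z \<in> N \<and> (\<forall>q\<in>N \<inter> Z. act q g \<notin> N)" by (rule ballI)
  from bchoice[OF this] obtain N where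
    N': "\<forall>g\<in>carrier W - {\<one>}. open (N g) \<and> z \<in> N g \<and> (\<forall>q\<in>N g \<inter> Z. act q g \<notin> N g)" by (elim exE)
  note N = N'[rule_format]
  define N' where "N' = (\<Inter>g\<in>carrier W - {\<one>}. N g)"
  have "open N'" unfolding N'_def using N finite_W by (intro open_INT) auto
  moreover have "z \<in> N'" using N by (auto simp: N'_def)
  moreover have "inj_on \<pi> (N' \<inter> Z)"
  proof (rule inj_onI)
    fix q q' assume q: "q \<in> N' \<inter> Z" "q' \<in> N' \<inter> Z" "\<pi> q = \<pi> q'"
    then obtain g where g: "g \<in> carrier W" "q' = act q g" using \<pi> by blast
    show "q = q'"
    proof (cases "g = \<one>")
      case True
      then show ?thesis using g q act_one by auto
    next
      case False
      then have "q \<in> N g" "q' \<in> N g" using q g unfolding N'_def by auto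
      then show ?thesis using N[of g] False g q(1) by blast
    qed
  qed
  ultimately show "\<exists>N. open N \<and> z \<in> N \<and> inj_on \<pi> (N \<inter> Z)" by blast
next
  assume "\<exists>N. open N \<and> z \<in> N \<and> inj_on \<pi> (N \<inter> Z)"
  then obtain N where N: "open N" "z \<in> N" "inj_on \<pi> (N \<inter> Z)" by blast
  show "z \<in> free"
  proof (rule ccontr)
    assume "z \<notin> free"
    then obtain g where g: "g \<in> carrier W" "act z g = z" "g \<noteq> \<one>" using z by (auto simp: free_def)
    have "act z g \<in> N" using g N by simp
    then obtain A where A: "open A" "z \<in> A" "\<forall>q\<in>Z. q \<in> A \<longrightarrow> act q g \<in> N"
      using cont_act[OF g(1), unfolded continuous_on_topological, rule_format, OF z N(1)] by blast
    have "act q g = q" if q: "q \<in> Z" "q \<in> A \<inter> N" for q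
    proof -
      have "\<pi> q = \<pi> (act q g)" using \<pi>[OF q(1) act_closed[OF q(1) g(1)]] g(1) by blast
      then show ?thesis
        using inj_onD[OF N(3), of q "act q g"] q A(3) act_closed[OF q(1) g(1)] by auto
    qed
    then have sub: "Z \<inter> (A \<inter> N) \<subseteq> {q \<in> Z. \<exists>g\<in>carrier W - {\<one>}. act q g = q}" using g by blast
    have "z islimpt Z \<inter> (A \<inter> N)"
    proof (rule islimptI)
      fix T assume T: "z \<in> T" "open T"
      have "z \<in> T \<inter> (A \<inter> N)" "open (T \<inter> (A \<inter> N))" using T A(1,2) N(1,2) by auto
      from islimptE[OF islimpt_Z[OF z] this]
      obtain q where "q \<in> Z" "q \<in> T \<inter> (A \<inter> N)" "q \<noteq> z" .
      then show "\<exists>q\<in>Z \<inter> (A \<inter> N). q \<in> T \<and> q \<noteq> z" by blast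
    qed
    then show False using islimpt_subset[OF _ sub] fixed_discrete by blast
  qed
qed

lemma over_unramified_iff_free:
  assumes \<pi>: "\<And>z z'. z \<in> Z \<Longrightarrow> z' \<in> Z \<Longrightarrow> \<pi> z = \<pi> z' \<longleftrightarrow> (\<exists>g\<in>carrier W. z' = act z g)"
    and z: "z \<in> Z"
  shows "\<pi> z \<in> \<pi> ` Z - \<pi> ` {z \<in> Z. \<not> (\<exists>N. open N \<and> z \<in> N \<and> inj_on \<pi> (N \<inter> Z))} \<longleftrightarrow> z \<in> free"
proof -
  have "\<pi> z \<in> \<pi> ` {q \<in> Z. q \<notin> free} \<longleftrightarrow> z \<notin> free"
  proof
    assume "\<pi> z \<in> \<pi> ` {q \<in> Z. q \<notin> free}"
    then obtain q where q: "q \<in> Z" "q \<notin> free" "\<pi> z = \<pi> q" by blast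
    then obtain g where "g \<in> carrier W" "q = act z g" using \<pi> z by blast
    then show "z \<notin> free" using act_free q(2) by blast
  qed (use z in blast)
  moreover have "{q \<in> Z. \<not> (\<exists>N. open N \<and> q \<in> N \<and> inj_on \<pi> (N \<inter> Z))} = {q \<in> Z. q \<notin> free}"
    using free_iff_locally_injective[OF \<pi>] by auto
  ultimately show ?thesis using z by simp
qed

end


section \<open>Coset representatives\<close>

locale coset_representatives = group W for W (structure) +
  fixes H :: "'a set" and g :: "nat \<Rightarrow> 'a" and d :: nat
  assumes subgroup_H: "subgroup H W"
    and reps: "\<forall>j\<in>{1..d}. g j \<in> carrier W" "carrier W = (\<Union>j\<in>{1..d}. H #> g j)"
    and inj_reps: "i \<in> {1..d} \<Longrightarrow> j \<in> {1..d} \<Longrightarrow> h \<in> H \<Longrightarrow> g i = h \<otimes> g j \<Longrightarrow> i = j"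
begin

lemma rep_carrier: "j \<in> {1..d} \<Longrightarrow> g j \<in> carrier W"
  using reps(1) by blast

lemma rep_exists:
  assumes "u \<in> carrier W"
  obtains j h where "j \<in> {1..d}" "h \<in> H" "u = h \<otimes> g j"
  using assms unfolding reps(2) r_coset_def by blast

text \<open>Right multiplication permutes the right cosets of \<open>H\<close>.\<close>

lemma sum_reps_mult_right:
  fixes f :: "'a \<Rightarrow> 'm::comm_monoid_add"
  assumes f: "\<And>u h. u \<in> carrier W \<Longrightarrow> h \<in> H \<Longrightarrow> f (h \<otimes> u) = f u" and w: "w \<in> carrier W"
  shows "(\<Sum>j=1..d. f (g j \<otimes> w)) = (\<Sum>j=1..d. f (g j))"
proof -
  have Hc: "h \<in> carrier W" if "h \<in> H" for h using that subgroup.subset[OF subgroup_H] by blast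
  have "\<exists>p. p \<in> {1..d} \<and> (\<exists>h\<in>H. g j \<otimes> w = h \<otimes> g p)" if "j \<in> {1..d}" for j
  proof -
    have "g j \<otimes> w \<in> carrier W" using rep_carrier[OF that] w by simp
    then show ?thesis by (rule rep_exists) blast
  qed
  then have "\<forall>j\<in>{1..d}. \<exists>p. p \<in> {1..d} \<and> (\<exists>h\<in>H. g j \<otimes> w = h \<otimes> g p)" by (rule ballI)
  from bchoice[OF this] obtain p where
    p: "\<forall>j\<in>{1..d}. p j \<in> {1..d} \<and> (\<exists>h\<in>H. g j \<otimes> w = h \<otimes> g (p j))" by (elim exE)
  have "inj_on p {1..d}"
  proof (rule inj_onI)
    fix i j assume ij: "i \<in> {1..d}" "j \<in> {1..d}" "p i = p j"
    then obtain h k where h: "h \<in> H" "g i \<otimes> w = h \<otimes> g (p j)" and k: "k \<in> H" "g j \<otimes> w = k \<otimes> g (p j)"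
      using p by metis
    have c: "g (p j) \<in> carrier W" "g i \<in> carrier W" "g j \<in> carrier W" using p ij rep_carrier by blast+
    have "inv k \<otimes> (g j \<otimes> w) = g (p j)" using k c Hc by (simp add: m_assoc[symmetric])
    then have "g i \<otimes> w = h \<otimes> inv k \<otimes> g j \<otimes> w" using h k c Hc w by (simp add: m_assoc)
    then have "g i = h \<otimes> inv k \<otimes> g j" using h k c Hc w by (metis inv_closed m_closed right_cancel)
    moreover have "h \<otimes> inv k \<in> H" using h k subgroup_H
      by (simp add: subgroup.m_closed subgroup.m_inv_closed)
    ultimately show "i = j" using inj_reps ij by blast
  qed
  moreover have "p ` {1..d} = {1..d}" by (rule endo_inj_surj[OF _ _ \<open>inj_on p {1..d}\<close>]) (use p in auto)
  ultimately have bij: "bij_betw p {1..d} {1..d}" by (simp add: bij_betw_def)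
  have "(\<Sum>j=1..d. f (g j \<otimes> w)) = (\<Sum>j=1..d. f (g (p j)))"
  proof (rule sum.cong[OF refl])
    fix j assume j: "j \<in> {1..d}"
    then obtain h where "h \<in> H" "g j \<otimes> w = h \<otimes> g (p j)" using p by blast
    then show "f (g j \<otimes> w) = f (g (p j))" using f[OF rep_carrier] p j by auto
  qed
  also have "\<dots> = (\<Sum>j=1..d. f (g j))" by (rule sum.reindex_bij_betw[OF bij])
  finally show ?thesis .
qed

end


section \<open>The invariant form on the orbit of a weight\<close>

locale orbit_form = coset_representatives W "stabilizer_in W actV l" g d
  for W (structure) and actV :: "rat^'r::finite \<Rightarrow> 'a \<Rightarrow> rat^'r" and l g d +
  fixes B :: "rat^'r \<Rightarrow> rat^'r \<Rightarrow> rat"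
  assumes linear_act: "linear_right_action W actV"
    and form: "invariant_form W actV B"
    and negative: "v \<noteq> 0 \<Longrightarrow> B v v < 0"
begin

lemma actV_one: "actV v \<one> = v"
  and actV_mult: "u \<in> carrier W \<Longrightarrow> w \<in> carrier W \<Longrightarrow> actV v (u \<otimes> w) = actV (actV v u) w"
  and actV_linear: "u \<in> carrier W \<Longrightarrow> actV (c *s v + v') u = c *s actV v u + actV v' u"
  using linear_act unfolding linear_right_action_def right_action_def by blast+

lemma actV_add: "u \<in> carrier W \<Longrightarrow> actV (v + v') u = actV v u + actV v' u"
  using actV_linear[of u 1 v v'] by simp

lemma actV_zero: "u \<in> carrier W \<Longrightarrow> actV 0 u = 0"
  using actV_add[of u 0 0] by simp

lemma actV_sum: "u \<in> carrier W \<Longrightarrow> actV (\<Sum>i\<in>I. f i) u = (\<Sum>i\<in>I. actV (f i) u)"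
  by (induction I rule: infinite_finite_induct) (simp_all add: actV_zero actV_add)

lemma actV_stabilizer:
  "h \<in> stabilizer_in W actV l \<Longrightarrow> u \<in> carrier W \<Longrightarrow> actV l (h \<otimes> u) = actV l u"
  by (simp add: stabilizer_in_def actV_mult)

lemma B_commute: "B u v = B v u"
  and B_linear: "B (c *s u + v) w = c * B u w + B v w"
  and B_invariant: "h \<in> carrier W \<Longrightarrow> B (actV u h) (actV v h) = B u v"
  using form unfolding invariant_form_def by blast+

lemma B_linear_right: "B w (c *s u + v) = c * B w u + B w v"
  using B_linear[of c u v w] by (simp add: B_commute[of _ w])

lemma B_add: "B (u + v) w = B u w + B v w"
  using B_linear[of 1 u v w] by simp

lemma B_zero: "B 0 w = 0"
  using B_add[of 0 0 w] by simp

lemma B_scale: "B (c *s u) w = c * B u w"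
  using B_linear[of c u 0 w] by (simp add: B_zero)

lemma B_diff: "B (u - v) w = B u w - B v w"
  using B_add[of "u - v" v w] by simp

lemma B_sum: "B (\<Sum>i\<in>I. f i) w = (\<Sum>i\<in>I. B (f i) w)"
  by (induction I rule: infinite_finite_induct) (simp_all add: B_zero B_add)

lemma B_move: "h \<in> carrier W \<Longrightarrow> B (actV u h) v = B u (actV v (inv h))"
  using B_invariant[of "inv h" "actV u h" v] by (simp add: actV_mult[symmetric] actV_one)

lemma B_move_right: "h \<in> carrier W \<Longrightarrow> B u (actV v h) = B (actV u (inv h)) v"
  using B_move[of "inv h" u v] by simp

lemma actV_stabilizer_right:
  assumes u: "u \<in> carrier W" and h: "h \<in> stabilizer_in W actV l"
  shows "B (actV l (u \<otimes> h)) l = B (actV l u) l" and "actV l (u \<otimes> h) = l \<longleftrightarrow> actV l u = l"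
proof -
  have hc: "h \<in> carrier W" and hl: "actV l h = l" using h by (auto simp: stabilizer_in_def)
  have "actV (actV v h) (inv h) = v" for v using hc by (simp add: actV_mult[symmetric] actV_one)
  then have il: "actV l (inv h) = l" using hl by metis
  show "B (actV l (u \<otimes> h)) l = B (actV l u) l" using u hc il by (simp add: actV_mult B_move)
  show "actV l (u \<otimes> h) = l \<longleftrightarrow> actV l u = l"
    using hl il \<open>\<And>v. actV (actV v h) (inv h) = v\<close> u hc by (metis actV_mult)
qed

definition orb :: "nat \<Rightarrow> rat^'r" where
  "orb j = actV l (g j)"

lemma orb_eq_iff:
  assumes "i \<in> {1..d}" "j \<in> {1..d}"
  shows "orb i = orb j \<longleftrightarrow> i = j"
proof
  assume eq: "orb i = orb j"
  let ?h = "g i \<otimes> inv (g j)"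
  note c = rep_carrier[OF assms(1)] rep_carrier[OF assms(2)]
  have "actV l ?h = actV (orb j) (inv (g j))" using c eq by (simp add: actV_mult orb_def)
  also have "\<dots> = l" using c by (simp add: orb_def actV_mult[symmetric] actV_one)
  finally have "?h \<in> stabilizer_in W actV l" using c by (simp add: stabilizer_in_def)
  moreover have "g i = ?h \<otimes> g j" using c by (simp add: m_assoc)
  ultimately show "i = j" using inj_reps assms by blast
qed simp

lemma sum_orb:
  fixes f :: "rat^'r \<Rightarrow> 'm::comm_monoid_add"
  assumes "w \<in> carrier W"
  shows "(\<Sum>j=1..d. f (actV (orb j) w)) = (\<Sum>j=1..d. f (orb j))"
proof -
  have "(\<Sum>j=1..d. f (actV (orb j) w)) = (\<Sum>j=1..d. f (actV l (g j \<otimes> w)))"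
    by (rule sum.cong[OF refl]) (simp add: orb_def actV_mult rep_carrier assms)
  also have "\<dots> = (\<Sum>j=1..d. f (orb j))"
    unfolding orb_def using assms by (intro sum_reps_mult_right) (simp_all add: actV_stabilizer)
  finally show ?thesis .
qed

text \<open>Both sides are the trace of the operator \<open>w \<mapsto> \<Sum>j. (x j, w) x j\<close>: the hypothesis and
  the definiteness of the form make it the scalar \<open>c\<close>.\<close>

lemma trace_of_scalar_gram:
  assumes c: "\<And>u v. (\<Sum>j\<in>J. B (x j) u * B (x j) v) = c * B u v"
  shows "(\<Sum>j\<in>J. B (x j) (x j)) = c * of_nat CARD('r)"
proof -
  define N where "N w = (\<Sum>j\<in>J. B (x j) w *s x j)" for w
  have "N w = c *s w" for w
  proof (rule ccontr)
    assume "N w \<noteq> c *s w"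
    then have neg: "B (N w - c *s w) (N w - c *s w) < 0" by (intro negative) simp
    have "B (N w - c *s w) u = 0" for u
      using c[of w u] by (simp add: N_def B_diff B_sum B_scale)
    then show False using neg by simp
  qed
  then have "c * of_nat CARD('r) = (\<Sum>i\<in>UNIV. N (axis i 1) $ i)" by (simp add: axis_def)
  also have "\<dots> = (\<Sum>j\<in>J. \<Sum>i\<in>UNIV. B (x j) (axis i 1) * x j $ i)"
    unfolding N_def by (subst sum.swap) simp
  also have "\<dots> = (\<Sum>j\<in>J. B (x j) (x j))"
  proof (rule sum.cong[OF refl])
    fix j
    have "B (x j) (x j) = B (\<Sum>i\<in>UNIV. x j $ i *s axis i 1) (x j)" by (simp add: basis_expansion)
    also have "\<dots> = (\<Sum>i\<in>UNIV. B (x j) (axis i 1) * x j $ i)"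
      unfolding B_sum B_scale by (simp add: B_commute[of _ "x j"] mult.commute)
    finally show "(\<Sum>i\<in>UNIV. B (x j) (axis i 1) * x j $ i) = B (x j) (x j)" by simp
  qed
  finally show ?thesis by simp
qed

definition gram :: "rat^'r \<Rightarrow> rat^'r \<Rightarrow> rat" where
  "gram u v = (\<Sum>j=1..d. B (orb j) u * B (orb j) v)"

lemma invariant_gram: "invariant_form W actV (\<lambda>u v. c * gram u v)"
  unfolding invariant_form_def
proof (intro conjI allI ballI)
  show "c * gram u v = c * gram v u" for u v by (simp add: gram_def mult.commute)
  show "c * gram (b *s u + v) w = b * (c * gram u w) + c * gram v w" for b u v w
  proof -
    have "gram (b *s u + v) w = b * gram u w + gram v w"
      unfolding gram_def sum_distrib_left sum.distrib[symmetric]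
      unfolding B_linear_right by (rule sum.cong[OF refl]) (simp add: algebra_simps)
    then show ?thesis by (simp add: algebra_simps)
  qed
  show "c * gram (actV u w) (actV v w) = c * gram u v" if w: "w \<in> carrier W" for u v w
    unfolding gram_def B_move_right[OF w]
    using sum_orb[of "inv w" "\<lambda>x. B x u * B x v"] w by simp
qed

lemma gram_eq_imp_scalar:
  assumes "\<And>u v. gram u v = c * B u v"
  shows "c * of_nat CARD('r) = of_nat d * B l l"
proof -
  have "(\<Sum>j=1..d. B (orb j) (orb j)) = of_nat d * B l l"
    by (simp add: orb_def B_invariant rep_carrier)
  then show ?thesis using trace_of_scalar_gram[of orb "{1..d}" c] assms by (simp add: gram_def)
qed

end

lemma common_denominator:
  fixes r :: "'i \<Rightarrow> rat"
  assumes "finite I"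
  shows "\<exists>n::int. n > 0 \<and> (\<forall>i\<in>I. of_int n * r i \<in> \<int>)"
  using assms
proof induction
  case empty
  show ?case by (rule exI[of _ 1]) simp
next
  case (insert j I)
  then obtain n where n: "n > 0" "\<forall>i\<in>I. of_int n * r i \<in> \<int>" by blast
  obtain a b :: int where ab: "b > 0" "r j = of_int a / of_int b"
    by (metis quotient_of_denom_pos quotient_of_div surj_pair)
  have "of_int (n * b) * r i \<in> \<int>" if "i \<in> insert j I" for i
  proof (cases "i = j")
    case True
    then have "of_int (n * b) * r i = of_int (n * a)" using ab by simp
    then show ?thesis by (metis Ints_of_int)
  next
    case False
    then have "of_int n * r i \<in> \<int>" using n(2) that by simp
    then have "of_int b * (of_int n * r i) \<in> \<int>" by (rule Ints_mult[OF Ints_of_int])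
    then show ?thesis by (simp add: mult_ac)
  qed
  then show ?case using n(1) ab(1) by (intro exI[of _ "n * b"]) auto
qed

locale weight_orbit = orbit_form W actV l g d B
  for W (structure) and actV :: "rat^'r::finite \<Rightarrow> 'a \<Rightarrow> rat^'r" and l g d B +
  fixes S :: "(rat^'r) set"
  assumes lattice: "lattice_with_action W actV S"
    and weight: "is_weight W actV S l"
    and wform: "weight_form W actV S l B"
begin

lemma B_orb_integral: "j \<in> {1..d} \<Longrightarrow> m \<in> S \<Longrightarrow> B (orb j) m \<in> \<int>"
  using wform lattice unfolding orb_def weight_form_def lattice_with_action_def
  by (simp add: B_move rep_carrier)

lemma gram_multiple:
  assumes "\<forall>m\<in>S. c * gram l m \<in> \<int>"
  obtains k :: int where "\<And>u v. c * gram u v = of_int k * B u v"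
proof -
  have "\<exists>k::int. (\<lambda>u v. c * gram u v) = (\<lambda>u v. of_int k * B u v)"
    using wform invariant_gram[of c] assms unfolding weight_form_def by blast
  then show ?thesis using that by (metis (no_types, lifting))
qed

text \<open>Only forms that are integral on \<open>l\<close> and the lattice are covered by the defining property of the
  weight form; a common denominator of the numbers \<open>(x j, l)\<close> reduces to that case.\<close>

lemma gram_scalar: "\<exists>c. \<forall>u v. gram u v = c * B u v"
proof -
  obtain n :: int where n: "n > 0" "\<forall>j\<in>{1..d}. of_int n * B (orb j) l \<in> \<int>"
    using common_denominator[of "{1..d}" "\<lambda>j. B (orb j) l"] by auto
  have "of_int n * gram l m \<in> \<int>" if "m \<in> S" for m
  proof -
    have "of_int n * gram l m = (\<Sum>j=1..d. (of_int n * B (orb j) l) * B (orb j) m)"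
      by (simp add: gram_def sum_distrib_left mult.assoc)
    also have "\<dots> \<in> \<int>"
    proof (intro Ints_sum)
      fix j assume j: "j \<in> {1..d}"
      then have "of_int n * B (orb j) l \<in> \<int>" using n(2) by blast
      then show "of_int n * B (orb j) l * B (orb j) m \<in> \<int>"
        by (rule Ints_mult[OF _ B_orb_integral[OF j that]])
    qed
    finally show ?thesis .
  qed
  then have "\<forall>m\<in>S. of_int n * gram l m \<in> \<int>" by blast
  then obtain k :: int where k: "\<And>u v. of_int n * gram u v = of_int k * B u v"
    by (rule gram_multiple) blast
  have "gram u v = (of_int k / of_int n) * B u v" for u v
    using k[of u v] n(1) by (simp add: field_simps)
  then show ?thesis by blast
qed

definition kanev_q :: rat where
  "kanev_q = - (of_nat d * B l l) / of_nat CARD('r)"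

lemma gram_eq: "gram u v = - kanev_q * B u v"
proof -
  obtain c where c: "\<And>u v. gram u v = c * B u v" using gram_scalar by blast
  have "c = - kanev_q" using gram_eq_imp_scalar[OF c] by (simp add: kanev_q_def field_simps)
  then show ?thesis using c by simp
qed

lemma gram_square:
  "(\<Sum>j=1..d. B (orb i) (orb j) * B (orb j) (orb k)) = - kanev_q * B (orb i) (orb k)"
  using gram_eq[of "orb i" "orb k"] by (simp add: gram_def B_commute[of "orb i"])

lemma sum_orb_eq_0:
  assumes "irreducible_action W actV" "\<exists>w\<in>carrier W. \<exists>v. actV v w \<noteq> v"
  shows "(\<Sum>j=1..d. orb j) = 0"
proof -
  define F where "F = {v. \<forall>w\<in>carrier W. actV v w = v}"
  have "vec.subspace F"
    unfolding F_def vec.subspace_def using actV_linear[of _ _ _ 0]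
    by (auto simp: actV_zero actV_add)
  moreover have "\<forall>w\<in>carrier W. \<forall>v\<in>F. actV v w \<in> F" by (auto simp: F_def)
  ultimately have "F = {0} \<or> F = UNIV" using assms(1) unfolding irreducible_action_def by blast
  moreover have "F \<noteq> UNIV" using assms(2) by (auto simp: F_def)
  moreover have "(\<Sum>j=1..d. orb j) \<in> F"
    using sum_orb[of _ "\<lambda>x. x"] by (simp add: F_def actV_sum)
  ultimately show ?thesis by blast
qed

text \<open>Replacing \<open>(x j, l)\<close> by \<open>(x j - l, l) + (l, l)\<close>, the first summand is an integer and the second
  contributes \<open>(l, l)\<close> times the pairing of \<open>m\<close> with the sum of the orbit. So the Gram form is an
  integral multiple of the weight form, and the factor is \<open>-q\<close>.\<close>

theorem kanev_q_nat:
  assumes "l \<in> S \<or> (\<Sum>j=1..d. orb j) = 0"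
  shows "kanev_q \<in> \<nat>"
proof -
  have int: "gram l m \<in> \<int>" if m: "m \<in> S" for m
  proof -
    have split: "B (orb j) l = B l (orb j - l) + B l l" for j
      unfolding B_commute[of l "orb j - l"] B_diff by simp
    have "gram l m = (\<Sum>j=1..d. B l (orb j - l) * B (orb j) m) + B l l * B (\<Sum>j=1..d. orb j) m"
      unfolding gram_def B_sum split by (simp add: distrib_right sum.distrib sum_distrib_left)
    moreover have "(\<Sum>j=1..d. B l (orb j - l) * B (orb j) m) \<in> \<int>"
    proof (intro Ints_sum Ints_mult)
      fix j assume j: "j \<in> {1..d}"
      then have "orb j - l \<in> S" using weight rep_carrier unfolding is_weight_def orb_def by blast
      then show "B l (orb j - l) \<in> \<int>" using wform unfolding weight_form_def by blast
      show "B (orb j) m \<in> \<int>" by (rule B_orb_integral[OF j m])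
    qed
    moreover have "B l l * B (\<Sum>j=1..d. orb j) m \<in> \<int>"
      using assms
    proof
      assume "l \<in> S"
      then have "B l l \<in> \<int>" using wform unfolding weight_form_def by blast
      then show ?thesis unfolding B_sum using B_orb_integral m by (intro Ints_mult Ints_sum) auto
    qed (simp add: B_zero)
    ultimately show ?thesis by simp
  qed
  then have "\<forall>m\<in>S. 1 * gram l m \<in> \<int>" by simp
  then obtain k :: int where k: "\<And>u v. 1 * gram u v = of_int k * B u v"
    by (rule gram_multiple) blast
  have "(1 :: rat^'r) \<noteq> 0" by simp
  then have "B 1 1 < 0" by (rule negative)
  then have "- kanev_q = of_int k"
    using k[of 1 1] gram_eq[of 1 1] mult_right_cancel[of "B 1 1" "- kanev_q" "of_int k"] by simp
  then have "kanev_q = of_int (- k)" by simp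
  moreover have "B l l \<le> 0" using negative[of l] B_zero[of l] by (cases "l = 0") auto
  then have "kanev_q \<ge> 0"
    unfolding kanev_q_def by (intro divide_nonneg_nonneg) (simp_all add: mult_nonneg_nonpos)
  ultimately show ?thesis by (metis Nats_altdef2 Ints_of_int mem_Collect_eq)
qed

end


section \<open>Fibres of closures of correspondences\<close>

text \<open>For free \<open>z\<close>, the number \<open>a u\<close> is the multiplicity of \<open>pt z u\<close> in the divisor of \<open>\<phi> z\<close>. Left
  invariance makes this a function of the point \<open>pt z u\<close>, right invariance makes the divisor
  independent of the choice of \<open>z\<close>.\<close>

locale weighted_quotient = finite_quotient W Z act H Y \<phi> + coset_representatives W H g d
  for W (structure) and Z :: "'z::t2_space set" and act :: "'z \<Rightarrow> 'a \<Rightarrow> 'z" and H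
    and Y :: "'y::t2_space set" and \<phi> :: "'z \<Rightarrow> 'y" and g :: "nat \<Rightarrow> 'a" and d :: nat +
  fixes a :: "'a \<Rightarrow> rat"
  assumes a_left: "\<And>u h. u \<in> carrier W \<Longrightarrow> h \<in> H \<Longrightarrow> a (h \<otimes> u) = a u"
    and a_right: "\<And>u h. u \<in> carrier W \<Longrightarrow> h \<in> H \<Longrightarrow> a (u \<otimes> h) = a u"
begin

lemma pt_inj_on_free: "z \<in> free \<Longrightarrow> inj_on (\<lambda>j. pt z (g j)) {1..d}"
  using pt_eq_imp inj_reps reps(1) by (intro inj_onI) blast

definition weighted_curve :: "rat \<Rightarrow> ('y \<times> 'y) set" where
  "weighted_curve c = {(\<phi> z, pt z u) | z u. z \<in> free \<and> u \<in> carrier W \<and> a u = c}"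

text \<open>The curve is contained in a finite union of compact images of \<open>Z\<close>, and over free points these
  images contain nothing else, by the invariance of \<open>a\<close>.\<close>

lemma closure_weighted_curve_fibre:
  assumes z: "z \<in> free"
  shows "{y'. (\<phi> z, y') \<in> closure (weighted_curve c)} = {pt z (g j) | j. j \<in> {1..d} \<and> a (g j) = c}"
proof (intro equalityI subsetI)
  fix y' assume "y' \<in> {pt z (g j) | j. j \<in> {1..d} \<and> a (g j) = c}"
  then have "(\<phi> z, y') \<in> weighted_curve c" using z reps(1) unfolding weighted_curve_def by blast
  then show "y' \<in> {y'. (\<phi> z, y') \<in> closure (weighted_curve c)}" using closure_subset by blast
next
  fix y' assume "y' \<in> {y'. (\<phi> z, y') \<in> closure (weighted_curve c)}"
  then have cl: "(\<phi> z, y') \<in> closure (weighted_curve c)" by simp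
  have zZ: "z \<in> Z" using z by (simp add: free_def)
  define D where "D u = (\<lambda>z. (\<phi> z, pt z u)) ` Z" for u
  have "closed (D u)" if u: "u \<in> carrier W" for u
  proof -
    have "continuous_on Z (\<lambda>z. \<phi> (act z (inv u)))"
      by (rule continuous_on_compose2[OF cont_\<phi> cont_act]) (use u act_closed in auto)
    then have "compact (D u)" unfolding D_def pt_def
      by (intro compact_continuous_image continuous_on_Pair cont_\<phi> compact_Z)
    then show ?thesis by (rule compact_imp_closed)
  qed
  then have "closed (\<Union>u\<in>{u \<in> carrier W. a u = c}. D u)"
    using finite_W by (intro closed_UN) auto
  moreover have "weighted_curve c \<subseteq> (\<Union>u\<in>{u \<in> carrier W. a u = c}. D u)"
    unfolding weighted_curve_def D_def free_def by blast
  ultimately have "closure (weighted_curve c) \<subseteq> (\<Union>u\<in>{u \<in> carrier W. a u = c}. D u)"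
    by (rule closure_minimal[rotated])
  then obtain u z' where u: "u \<in> carrier W" "a u = c" and z': "z' \<in> Z" "\<phi> z = \<phi> z'" "y' = pt z' u"
    using cl unfolding D_def by blast
  then obtain h where h: "h \<in> H" "z' = act z h" using \<phi>_eq_iff zZ by blast
  note hc = H_carrier[OF h(1)]
  have y': "y' = pt z (u \<otimes> inv h)" unfolding z'(3) h(2) by (rule pt_act[OF zZ u(1) hc])
  have "u \<otimes> inv h \<in> carrier W" using u(1) hc by simp
  then obtain j k where jk: "j \<in> {1..d}" "k \<in> H" "u \<otimes> inv h = k \<otimes> g j" by (rule rep_exists)
  have gj: "g j \<in> carrier W" using reps(1) jk(1) by blast
  have "a (g j) = a (u \<otimes> inv h)" using a_left[OF gj jk(2)] jk(3) by simp
  also have "\<dots> = c" using a_right[OF u(1) H_inv[OF h(1)]] u(2) by simp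
  finally have "a (g j) = c" .
  moreover have "y' = pt z (g j)" using y' jk(3) pt_mult_H[OF zZ gj jk(2)] by simp
  ultimately show "y' \<in> {pt z (g j) | j. j \<in> {1..d} \<and> a (g j) = c}" using jk(1) by blast
qed

text \<open>A point near \<open>\<phi> z0\<close> lifts to some \<open>z\<close> near \<open>z0\<close>, and if it differs from \<open>\<phi> z0\<close>, this
  \<open>z\<close> is free. The points \<open>pt z (g j)\<close> are then distinct, and each is close to \<open>y1\<close> exactly if
  its limit \<open>pt z0 (g j)\<close> equals \<open>y1\<close>. The number so obtained is unique because \<open>\<phi> z0\<close> is not
  isolated in \<open>Y\<close>.\<close>

lemma fibre_intersection_weighted_curve:
  assumes z0: "z0 \<in> Z"
  shows "fibre_intersection Y (closure (weighted_curve c)) (\<phi> z0) y1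
    = card {j \<in> {1..d}. a (g j) = c \<and> pt z0 (g j) = y1}" (is "_ = card ?J")
proof -
  let ?C = "closure (weighted_curve c)"
  define good where "good m N0 \<longleftrightarrow> open N0 \<and> y1 \<in> N0 \<and>
      (\<forall>N. open N \<and> y1 \<in> N \<and> N \<subseteq> N0 \<longrightarrow>
        (\<forall>\<^sub>F y in at (\<phi> z0) within Y. finite {y'\<in>N. (y, y') \<in> ?C} \<and> card {y'\<in>N. (y, y') \<in> ?C} = m))"
    for m N0
  have "\<exists>P. open P \<and> y1 \<in> P \<and> (\<exists>Q. open Q \<and> pt z0 (g j) \<in> Q \<and> P \<inter> Q = {})"
    if "j \<in> {1..d} - {j. pt z0 (g j) = y1}" for j
    using hausdorff[of y1 "pt z0 (g j)"] that by fastforce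
  then have "\<forall>j\<in>{1..d} - {j. pt z0 (g j) = y1}.
      \<exists>P. open P \<and> y1 \<in> P \<and> (\<exists>Q. open Q \<and> pt z0 (g j) \<in> Q \<and> P \<inter> Q = {})" by (rule ballI)
  from bchoice[OF this] obtain P where P: "\<forall>j\<in>{1..d} - {j. pt z0 (g j) = y1}.
      open (P j) \<and> y1 \<in> P j \<and> (\<exists>Q. open Q \<and> pt z0 (g j) \<in> Q \<and> P j \<inter> Q = {})" by (elim exE)
  define N0 where "N0 = (\<Inter>j\<in>{1..d} - {j. pt z0 (g j) = y1}. P j)"
  have N0: "open N0" "y1 \<in> N0" unfolding N0_def using P by (auto intro!: open_INT)
  have "good (card ?J) N0"
    unfolding good_def
  proof (intro conjI allI impI N0)
    fix N assume N: "open N \<and> y1 \<in> N \<and> N \<subseteq> N0"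
    have "\<exists>A. open A \<and> z0 \<in> A \<and> (\<forall>z\<in>Z. z \<in> A \<longrightarrow> (pt z (g j) \<in> N \<longleftrightarrow> pt z0 (g j) = y1))"
      if j: "j \<in> {1..d}" for j
    proof -
      have gj: "g j \<in> carrier W" using reps(1) j by blast
      have cont: "continuous_on Z (\<lambda>z. pt z (g j))" unfolding pt_def
        by (rule continuous_on_compose2[OF cont_\<phi> cont_act]) (use gj act_closed in auto)
      show ?thesis
      proof (cases "pt z0 (g j) = y1")
        case True
        then show ?thesis
          using cont[unfolded continuous_on_topological, rule_format, OF z0, of N] N by auto
      next
        case False
        then have jm: "j \<in> {1..d} - {j. pt z0 (g j) = y1}" using j by simp
        then obtain Q where Q: "open Q" "pt z0 (g j) \<in> Q" "P j \<inter> Q = {}" using P by blast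
        have "N \<subseteq> P j" using N jm unfolding N0_def by blast
        then show ?thesis
          using cont[unfolded continuous_on_topological, rule_format, OF z0 Q(1,2)] Q(3) False by blast
      qed
    qed
    then have "\<forall>j\<in>{1..d}. \<exists>A. open A \<and> z0 \<in> A \<and>
        (\<forall>z\<in>Z. z \<in> A \<longrightarrow> (pt z (g j) \<in> N \<longleftrightarrow> pt z0 (g j) = y1))" by (rule ballI)
    from bchoice[OF this] obtain A where A: "\<forall>j\<in>{1..d}. open (A j) \<and> z0 \<in> A j \<and>
        (\<forall>z\<in>Z. z \<in> A j \<longrightarrow> (pt z (g j) \<in> N \<longleftrightarrow> pt z0 (g j) = y1))" by (elim exE)
    obtain F where F: "open F" "z0 \<in> F" "\<forall>q\<in>Z \<inter> F. q \<noteq> z0 \<longrightarrow> q \<in> free"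
      by (rule free_neighbourhood)
    define A' where "A' = F \<inter> (\<Inter>j\<in>{1..d}. A j)"
    have "open A'" "z0 \<in> A'" unfolding A'_def using A F by (auto intro!: open_INT)
    then obtain M where M: "open M" "\<phi> z0 \<in> M" "Y \<inter> M \<subseteq> \<phi> ` (Z \<inter> A')"
      using openin_Z_imp_open_image[OF _ z0] by metis
    have "finite {y'\<in>N. (y, y') \<in> ?C} \<and> card {y'\<in>N. (y, y') \<in> ?C} = card ?J"
      if y: "y \<in> Y" "y \<in> M" "y \<noteq> \<phi> z0" for y
    proof -
      obtain z where z: "z \<in> Z" "z \<in> A'" "y = \<phi> z" using M(3) y(1,2) by blast
      have "z \<noteq> z0" using z(3) y(3) by blast
      then have free: "z \<in> free" using F(3) z(1,2) unfolding A'_def by blast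
      have iff: "pt z (g j) \<in> N \<longleftrightarrow> pt z0 (g j) = y1" if "j \<in> {1..d}" for j
        using A that z(1,2) unfolding A'_def by blast
      have "{y'\<in>N. (y, y') \<in> ?C} = N \<inter> {y'. (\<phi> z, y') \<in> ?C}" unfolding z(3) by blast
      also have "\<dots> = (\<lambda>j. pt z (g j)) ` ?J"
        unfolding closure_weighted_curve_fibre[OF free] using iff by blast
      finally have eq: "{y'\<in>N. (y, y') \<in> ?C} = (\<lambda>j. pt z (g j)) ` ?J" .
      have "inj_on (\<lambda>j. pt z (g j)) ?J"
        by (rule inj_on_subset[OF pt_inj_on_free[OF free]]) blast
      then show ?thesis unfolding eq by (simp add: card_image)
    qed
    then show "\<forall>\<^sub>F y in at (\<phi> z0) within Y.
        finite {y'\<in>N. (y, y') \<in> ?C} \<and> card {y'\<in>N. (y, y') \<in> ?C} = card ?J"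
      unfolding eventually_at_topological using M(1,2) by blast
  qed
  moreover have "m = m'" if "good m N1" "good m' N2" for m m' N1 N2
  proof -
    let ?N = "N1 \<inter> N2"
    have N: "open ?N \<and> y1 \<in> ?N \<and> ?N \<subseteq> N1" "open ?N \<and> y1 \<in> ?N \<and> ?N \<subseteq> N2"
      using that unfolding good_def by auto
    have "\<forall>\<^sub>F y in at (\<phi> z0) within Y. finite {y'\<in>?N. (y, y') \<in> ?C} \<and> card {y'\<in>?N. (y, y') \<in> ?C} = m"
      using that(1) N(1) unfolding good_def by blast
    moreover have "\<forall>\<^sub>F y in at (\<phi> z0) within Y. finite {y'\<in>?N. (y, y') \<in> ?C} \<and> card {y'\<in>?N. (y, y') \<in> ?C} = m'"
      using that(2) N(2) unfolding good_def by blast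
    ultimately have "\<forall>\<^sub>F y in at (\<phi> z0) within Y. m = m'"
      by (rule eventually_elim2) simp
    moreover have "at (\<phi> z0) within Y \<noteq> bot"
      using islimpt_Y[OF z0] by (simp add: trivial_limit_within)
    ultimately show ?thesis by (simp add: eventually_const_iff)
  qed
  ultimately have "(THE m. \<exists>N0. good m N0) = card ?J"
    by (intro the_equality) blast+
  then show ?thesis unfolding fibre_intersection_def good_def .
qed

lemma exists_free:
  assumes "z \<in> Z"
  obtains q where "q \<in> free"
proof -
  obtain A where A: "open A" "z \<in> A" "\<forall>q\<in>Z \<inter> A. q \<noteq> z \<longrightarrow> q \<in> free"
    by (rule free_neighbourhood)
  from islimptE[OF islimpt_Z[OF assms] A(2,1)] obtain q where "q \<in> Z" "q \<in> A" "q \<noteq> z" .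
  then show ?thesis using A(3) that by blast
qed

text \<open>The formula for the divisor over free points, which is also the hypothesis on \<open>k\<close>, persists at
  all points, with coinciding points counted with the sum of their multiplicities.\<close>

lemma closure_corr_eq:
  assumes V: "V = \<phi> ` free"
    and k: "\<And>z u. z \<in> free \<Longrightarrow> u \<in> carrier W \<Longrightarrow> Poly_Mapping.lookup (k (\<phi> z)) (pt z u) = a u"
    and supp: "\<And>z y'. z \<in> free \<Longrightarrow> Poly_Mapping.lookup (k (\<phi> z)) y' \<noteq> 0 \<Longrightarrow> \<exists>u\<in>carrier W. y' = pt z u"
    and z0: "z0 \<in> Z"
  shows "closure_corr Y V k (\<phi> z0) = (\<Sum>j=1..d. Poly_Mapping.single (pt z0 (g j)) (a (g j)))"
proof -
  have part: "divisor_part V k c = weighted_curve c" if c: "c \<noteq> 0" for c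
  proof (intro equalityI subrelI)
    fix y y' assume "(y, y') \<in> divisor_part V k c"
    then obtain z where z: "z \<in> free" "y = \<phi> z" "Poly_Mapping.lookup (k (\<phi> z)) y' = c"
      unfolding divisor_part_def V by blast
    have "\<exists>u\<in>carrier W. y' = pt z u" by (rule supp[OF z(1)]) (use z(3) c in simp)
    then obtain u where u: "u \<in> carrier W" "y' = pt z u" by (elim bexE)
    then have "a u = c" using k[OF z(1) u(1)] z(3) by simp
    then show "(y, y') \<in> weighted_curve c" using z u unfolding weighted_curve_def by blast
  next
    fix y y' assume "(y, y') \<in> weighted_curve c"
    then show "(y, y') \<in> divisor_part V k c"
      using k unfolding weighted_curve_def divisor_part_def V by auto
  qed
  let ?S = "{c. c \<noteq> 0 \<and> divisor_part V k c \<noteq> {}}"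
  have S: "?S = (\<lambda>j. a (g j)) ` {1..d} - {0}"
  proof (intro equalityI subsetI)
    fix c assume c: "c \<in> ?S"
    then obtain u where u: "u \<in> carrier W" "a u = c" using part by (auto simp: weighted_curve_def)
    obtain j h where "j \<in> {1..d}" "h \<in> H" "u = h \<otimes> g j" by (rule rep_exists[OF u(1)])
    then have "c = a (g j)" "j \<in> {1..d}" using a_left[of "g j" h] reps(1) u(2) by auto
    then show "c \<in> (\<lambda>j. a (g j)) ` {1..d} - {0}" using c by auto
  next
    fix c assume c: "c \<in> (\<lambda>j. a (g j)) ` {1..d} - {0}"
    then obtain j where j: "j \<in> {1..d}" "c = a (g j)" by blast
    obtain q where "q \<in> free" by (rule exists_free[OF z0])
    then have "(\<phi> q, pt q (g j)) \<in> weighted_curve c"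
      using j reps(1) unfolding weighted_curve_def by blast
    then show "c \<in> ?S" using c part by auto
  qed
  have "(\<Sum>c\<in>?S. c * of_nat (fibre_intersection Y (closure (divisor_part V k c)) (\<phi> z0) y'))
      = Poly_Mapping.lookup (\<Sum>j=1..d. Poly_Mapping.single (pt z0 (g j)) (a (g j))) y'" for y'
  proof -
    have "(\<Sum>c\<in>?S. c * of_nat (fibre_intersection Y (closure (divisor_part V k c)) (\<phi> z0) y'))
        = (\<Sum>c\<in>?S. c * of_nat (card {j \<in> {1..d}. a (g j) = c \<and> pt z0 (g j) = y'}))"
      by (rule sum.cong[OF refl]) (simp add: part fibre_intersection_weighted_curve[OF z0])
    also have "\<dots> = (\<Sum>c\<in>(\<lambda>j. a (g j)) ` {1..d}. c * of_nat (card {j \<in> {1..d}. a (g j) = c \<and> pt z0 (g j) = y'}))"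
      unfolding S by (rule sum.mono_neutral_left) auto
    also have "\<dots> = (\<Sum>c\<in>(\<lambda>j. a (g j)) ` {1..d}. \<Sum>j\<in>{j \<in> {1..d}. a (g j) = c}. if pt z0 (g j) = y' then a (g j) else 0)"
    proof (rule sum.cong[OF refl])
      fix c
      have "(\<Sum>j\<in>{j \<in> {1..d}. a (g j) = c}. if pt z0 (g j) = y' then a (g j) else 0)
          = (\<Sum>j\<in>{j \<in> {1..d}. a (g j) = c \<and> pt z0 (g j) = y'}. c)"
        by (rule sum.mono_neutral_cong_right) auto
      then show "c * of_nat (card {j \<in> {1..d}. a (g j) = c \<and> pt z0 (g j) = y'})
          = (\<Sum>j\<in>{j \<in> {1..d}. a (g j) = c}. if pt z0 (g j) = y' then a (g j) else 0)"
        by simp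
    qed
    also have "\<dots> = (\<Sum>j=1..d. if pt z0 (g j) = y' then a (g j) else 0)"
      by (rule sum.image_gen[symmetric]) simp
    also have "\<dots> = Poly_Mapping.lookup (\<Sum>j=1..d. Poly_Mapping.single (pt z0 (g j)) (a (g j))) y'"
      by (simp add: lookup_sum lookup_single when_def)
    finally show ?thesis .
  qed
  then show ?thesis unfolding closure_corr_def by (simp add: Poly_Mapping.lookup_inverse)
qed

end


section \<open>Linear maps of divisors\<close>

lemma lookup_div_scale: "Poly_Mapping.lookup (div_scale c D) y = c * Poly_Mapping.lookup D y"
  by (simp add: div_scale_def Poly_Mapping.map.rep_eq when_def)

lemma corr_endo_superset:
  assumes "finite A" "Poly_Mapping.keys D \<subseteq> A"
  shows "corr_endo T D = (\<Sum>y\<in>A. div_scale (Poly_Mapping.lookup D y) (T y))"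
  unfolding corr_endo_def
proof (rule sum.mono_neutral_left[OF assms])
  show "\<forall>y\<in>A - Poly_Mapping.keys D. div_scale (Poly_Mapping.lookup D y) (T y) = 0"
    by (auto simp: in_keys_iff poly_mapping_eq_iff lookup_div_scale fun_eq_iff)
qed

definition div_linear :: "(('a \<Rightarrow>\<^sub>0 rat) \<Rightarrow> ('a \<Rightarrow>\<^sub>0 rat)) \<Rightarrow> bool" where
  "div_linear F \<longleftrightarrow> (\<forall>D E. F (D + E) = F D + F E) \<and> (\<forall>c D. F (div_scale c D) = div_scale c (F D))"

lemma div_scale_add: "div_scale c (D + E) = div_scale c D + div_scale c E"
  by (simp add: poly_mapping_eq_iff fun_eq_iff lookup_div_scale lookup_add distrib_left)

lemma div_linear_corr_endo: "div_linear (corr_endo T)"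
  unfolding div_linear_def
proof (intro conjI allI)
  fix D E :: "'a \<Rightarrow>\<^sub>0 rat" and c
  let ?A = "Poly_Mapping.keys D \<union> Poly_Mapping.keys E"
  have "Poly_Mapping.keys (D + E) \<subseteq> ?A" by (rule keys_add)
  then show "corr_endo T (D + E) = corr_endo T D + corr_endo T E"
    by (simp add: corr_endo_superset[of ?A] sum.distrib[symmetric] poly_mapping_eq_iff fun_eq_iff
        lookup_sum lookup_add lookup_div_scale distrib_right)
  have "Poly_Mapping.keys (div_scale c D) \<subseteq> Poly_Mapping.keys D"
    by (auto simp: in_keys_iff lookup_div_scale)
  then show "corr_endo T (div_scale c D) = div_scale c (corr_endo T D)"
    by (simp add: corr_endo_superset[of "Poly_Mapping.keys D"] poly_mapping_eq_iff fun_eq_iff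
        lookup_sum lookup_div_scale sum_distrib_left mult.assoc)
qed

lemma div_linear_add_scale: "div_linear F \<Longrightarrow> div_linear (\<lambda>D. F D + div_scale c D)"
  unfolding div_linear_def
  by (simp add: div_scale_add poly_mapping_eq_iff fun_eq_iff lookup_add lookup_div_scale algebra_simps)

lemma div_linear_comp: "div_linear F \<Longrightarrow> div_linear G \<Longrightarrow> div_linear (F \<circ> G)"
  by (simp add: div_linear_def)

lemma div_linear_eq_0:
  assumes F: "div_linear F" and points: "\<And>y. y \<in> Poly_Mapping.keys D \<Longrightarrow> F (Poly_Mapping.single y 1) = 0"
  shows "F D = 0"
proof -
  have zero: "F 0 = 0"
    using F[unfolded div_linear_def, THEN conjunct1, rule_format, of 0 0] by simp
  have sum: "F (\<Sum>y\<in>A. E y) = (\<Sum>y\<in>A. F (E y))" if "finite A" for A and E :: "'a \<Rightarrow> 'a \<Rightarrow>\<^sub>0 rat"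
    using that F by induction (simp_all add: zero div_linear_def)
  have D: "D = (\<Sum>y\<in>Poly_Mapping.keys D. div_scale (Poly_Mapping.lookup D y) (Poly_Mapping.single y 1))"
  proof (rule poly_mapping_eqI)
    fix x
    have "(\<Sum>y\<in>Poly_Mapping.keys D. Poly_Mapping.lookup D y * (if y = x then 1 else 0))
        = (\<Sum>y\<in>Poly_Mapping.keys D. if y = x then Poly_Mapping.lookup D y else 0)"
      by (rule sum.cong) auto
    then show "Poly_Mapping.lookup D x = Poly_Mapping.lookup
        (\<Sum>y\<in>Poly_Mapping.keys D. div_scale (Poly_Mapping.lookup D y) (Poly_Mapping.single y 1)) x"
      by (simp add: lookup_sum lookup_div_scale lookup_single when_def in_keys_iff)
  qed
  have "F D = (\<Sum>y\<in>Poly_Mapping.keys D. F (div_scale (Poly_Mapping.lookup D y) (Poly_Mapping.single y 1)))"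
    by (rule trans[OF arg_cong[of _ _ F, OF D] sum[OF finite_keys]])
  also have "\<dots> = (\<Sum>y\<in>Poly_Mapping.keys D. 0)"
    using F points
    by (intro sum.cong) (simp_all add: div_linear_def poly_mapping_eq_iff fun_eq_iff lookup_div_scale)
  finally show ?thesis by simp
qed

lemma div_degree_superset:
  assumes "finite A" "Poly_Mapping.keys D \<subseteq> A"
  shows "div_degree D = (\<Sum>y\<in>A. Poly_Mapping.lookup D y)"
  unfolding div_degree_def by (rule sum.mono_neutral_left[OF assms]) (simp add: in_keys_iff)

lemma div_degree_sum_single:
  assumes "finite J"
  shows "div_degree (\<Sum>j\<in>J. Poly_Mapping.single (p j) (c j)) = (\<Sum>j\<in>J. c j)"
proof -
  have "Poly_Mapping.keys (\<Sum>j\<in>J. Poly_Mapping.single (p j) (c j)) \<subseteq> p ` J"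
  proof
    fix y assume "y \<in> Poly_Mapping.keys (\<Sum>j\<in>J. Poly_Mapping.single (p j) (c j))"
    then have "(\<Sum>j\<in>J. c j when p j = y) \<noteq> 0" by (simp add: in_keys_iff lookup_sum lookup_single)
    then obtain j where "j \<in> J" "(c j when p j = y) \<noteq> 0" by (rule sum.not_neutral_contains_not_neutral)
    then show "y \<in> p ` J" by (auto simp: when_def split: if_splits)
  qed
  then have "div_degree (\<Sum>j\<in>J. Poly_Mapping.single (p j) (c j))
      = (\<Sum>y\<in>p ` J. \<Sum>j\<in>J. c j when p j = y)"
    using div_degree_superset[of "p ` J"] assms by (simp add: lookup_sum lookup_single)
  also have "\<dots> = (\<Sum>j\<in>J. \<Sum>y\<in>p ` J. c j when p j = y)" by (rule sum.swap)
  also have "\<dots> = (\<Sum>j\<in>J. c j)"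
    by (rule sum.cong[OF refl]) (use assms in \<open>simp add: when_def\<close>)
  finally show ?thesis .
qed


section \<open>The Kanev correspondence\<close>

text \<open>The multiplicity function combines the coefficient \<open>(l u, l) - (l, l) - 1\<close> with the additional
  summand for the point itself.\<close>

locale kanev =
  weight_orbit W actV l g d B S +
  weighted_quotient W Z act "stabilizer_in W actV l" Y \<phi> g d
    "\<lambda>u. B (actV l u) l - B l l - 1 + (if actV l u = l then 1 else 0)"
  for W (structure) and actV :: "rat^'r::finite \<Rightarrow> 'a \<Rightarrow> rat^'r" and l g d B S
    and Z :: "'z::t2_space set" and act :: "'z \<Rightarrow> 'a \<Rightarrow> 'z"
    and Y :: "'y::t2_space set" and \<phi> :: "'z \<Rightarrow> 'y"
begin

definition coeff :: "'a \<Rightarrow> rat" where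
  "coeff u = B (actV l u) l - B l l - 1 + (if actV l u = l then 1 else 0)"

lemma pt_eq_iff:
  assumes z: "z \<in> free" and u: "u \<in> carrier W" "u' \<in> carrier W"
  shows "pt z u = pt z u' \<longleftrightarrow> actV l u = actV l u'"
proof
  assume "pt z u = pt z u'"
  then obtain h where "h \<in> stabilizer_in W actV l" "u = h \<otimes> u'" using pt_eq_imp[OF z u] by blast
  then show "actV l u = actV l u'" using u(2) by (simp add: actV_stabilizer)
next
  assume eq: "actV l u = actV l u'"
  have zZ: "z \<in> Z" using z by (simp add: free_def)
  have "actV l (u \<otimes> inv u') = actV (actV l u') (inv u')" using u eq by (simp add: actV_mult)
  also have "\<dots> = l" using u(2) by (simp add: actV_mult[symmetric] actV_one)
  finally have "u \<otimes> inv u' \<in> stabilizer_in W actV l" using u by (simp add: stabilizer_in_def)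
  then have "pt z (u \<otimes> inv u' \<otimes> u') = pt z u'" by (rule pt_mult_H[OF zZ u(2)])
  then show "pt z u = pt z u'" using u by (simp add: m_assoc)
qed

context
  fixes \<pi> :: "'z \<Rightarrow> 'x" and \<psi> :: "'y \<Rightarrow> 'x" and \<zeta> :: "'x \<Rightarrow> 'z"
  assumes \<pi>: "\<And>z z'. z \<in> Z \<Longrightarrow> z' \<in> Z \<Longrightarrow> \<pi> z = \<pi> z' \<longleftrightarrow> (\<exists>g\<in>carrier W. z' = act z g)"
    and \<psi>: "\<And>p. p \<in> Z \<Longrightarrow> \<psi> (\<phi> p) = \<pi> p"
begin

lemma kanev_unramified_eq:
  assumes s: "\<zeta> (\<psi> y) = s" "s \<in> free" and w: "w \<in> carrier W" and y: "y = pt s w"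
    and \<psi>y: "\<psi> y = \<pi> s"
  shows "kanev_unramified W act actV B l Y \<phi> \<psi> \<zeta> d g y
    = (\<Sum>j=1..d. Poly_Mapping.single (pt s (g j)) (B (orb j) (actV l w) - B l l - 1)) + Poly_Mapping.single y 1"
proof -
  have sZ: "s \<in> Z" using s(2) by (simp add: free_def)
  let ?\<mu> = "kanev_mu W act actV l \<phi> s"
  have mu: "?\<mu> (pt s u) = actV l u" if u: "u \<in> carrier W" for u
    unfolding kanev_mu_def
  proof (rule the_equality)
    show "\<exists>g\<in>carrier W. pt s u = \<phi> (act s (inv g)) \<and> actV l u = actV l g"
      using u by (auto simp: pt_def)
  next
    fix v assume "\<exists>g\<in>carrier W. pt s u = \<phi> (act s (inv g)) \<and> v = actV l g"
    then obtain x where "x \<in> carrier W" "pt s u = pt s x" "v = actV l x" by (auto simp: pt_def)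
    then show "v = actV l u" using pt_eq_iff[OF s(2) u] by simp
  qed
  have fib: "\<exists>u\<in>carrier W. y' = pt s u" if y': "y' \<in> {y' \<in> Y. \<psi> y' = \<psi> y}" for y'
  proof -
    have "y' \<in> \<phi> ` Z" using y' \<phi>_surj by simp
    then obtain q where q: "q \<in> Z" "y' = \<phi> q" by (elim imageE) simp
    then have "\<pi> s = \<pi> q" using y' \<psi>y \<psi> by simp
    then obtain x where x: "x \<in> carrier W" "q = act s x" using \<pi>[OF sZ q(1)] by blast
    then have "y' = pt s (inv x)" using q(2) by (simp add: pt_def)
    then show ?thesis using x(1) by blast
  qed
  have inj: "inj_on ?\<mu> {y' \<in> Y. \<psi> y' = \<psi> y}"
  proof (rule inj_onI)
    fix y1 y2 assume y12: "y1 \<in> {y' \<in> Y. \<psi> y' = \<psi> y}" "y2 \<in> {y' \<in> Y. \<psi> y' = \<psi> y}" "?\<mu> y1 = ?\<mu> y2"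
    obtain u1 u2 where u: "u1 \<in> carrier W" "y1 = pt s u1" "u2 \<in> carrier W" "y2 = pt s u2"
      using fib[OF y12(1)] fib[OF y12(2)] by blast
    then show "y1 = y2" using y12(3) mu pt_eq_iff[OF s(2)] by simp
  qed
  have inv_mu: "the_inv_into {y' \<in> Y. \<psi> y' = \<psi> y} ?\<mu> (actV l u) = pt s u" if u: "u \<in> carrier W" for u
  proof -
    have "\<pi> s = \<pi> (act s (inv u))" using u sZ by (subst \<pi>) (auto simp: act_closed)
    then have "\<psi> (pt s u) = \<psi> y" using u sZ \<psi>y \<psi>[of "act s (inv u)"] by (simp add: pt_def act_closed)
    then have "pt s u \<in> {y' \<in> Y. \<psi> y' = \<psi> y}" using pt_in_Y[OF sZ u] by simp
    from the_inv_into_f_f[OF inj this] show ?thesis unfolding mu[OF u] .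
  qed
  have "?\<mu> y = actV l w" unfolding y by (rule mu[OF w])
  then show ?thesis
    unfolding kanev_unramified_def Let_def s(1) orb_def by (simp add: inv_mu rep_carrier)
qed

text \<open>Translating from the chosen base point \<open>s = z w\<close> to \<open>z\<close> itself replaces the orbit vector
  \<open>l u\<close> by \<open>l u w\<close>, and the invariance of the form removes \<open>w\<close> from the coefficients. In particular
  the divisor does not depend on the chosen base points.\<close>

lemma kanev_unramified_lookup:
  assumes z: "z \<in> free" and \<zeta>: "\<zeta> (\<pi> z) \<in> Z" "\<pi> (\<zeta> (\<pi> z)) = \<pi> z"
  shows "u \<in> carrier W \<Longrightarrow>
      Poly_Mapping.lookup (kanev_unramified W act actV B l Y \<phi> \<psi> \<zeta> d g (\<phi> z)) (pt z u) = coeff u"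
    and "Poly_Mapping.lookup (kanev_unramified W act actV B l Y \<phi> \<psi> \<zeta> d g (\<phi> z)) y' \<noteq> 0
      \<Longrightarrow> \<exists>u\<in>carrier W. y' = pt z u"
proof -
  have zZ: "z \<in> Z" using z by (simp add: free_def)
  define s where "s = \<zeta> (\<pi> z)"
  obtain w where w: "w \<in> carrier W" "s = act z w"
    using \<pi>[OF zZ \<zeta>(1)] \<zeta>(2) s_def by auto
  have s: "s \<in> free" unfolding w(2) by (rule act_free[OF z w(1)])
  have pts: "pt s u = pt z (u \<otimes> inv w)" if "u \<in> carrier W" for u
    unfolding w(2) by (rule pt_act[OF zZ that w(1)])
  have ptz: "pt z u = pt s (u \<otimes> w)" if "u \<in> carrier W" for u
    using pts[of "u \<otimes> w"] that w(1) by (simp add: m_assoc)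
  have "\<phi> z = pt z \<one>" using zZ by (simp add: pt_def act_one)
  then have y: "\<phi> z = pt s w" using ptz[of \<one>] w(1) by simp
  have eq: "kanev_unramified W act actV B l Y \<phi> \<psi> \<zeta> d g (\<phi> z)
    = (\<Sum>j=1..d. Poly_Mapping.single (pt s (g j)) (B (orb j) (actV l w) - B l l - 1)) + Poly_Mapping.single (\<phi> z) 1"
    by (rule kanev_unramified_eq) (use y s w \<psi>[OF zZ] \<zeta>(2) s_def in auto)
  show "Poly_Mapping.lookup (kanev_unramified W act actV B l Y \<phi> \<psi> \<zeta> d g (\<phi> z)) (pt z u) = coeff u"
    if u: "u \<in> carrier W"
  proof -
    have uw: "u \<otimes> w \<in> carrier W" using u w(1) by simp
    obtain j h where j: "j \<in> {1..d}" and h: "h \<in> stabilizer_in W actV l" "u \<otimes> w = h \<otimes> g j"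
      by (rule rep_exists[OF uw])
    have orbj: "orb j = actV (actV l u) w"
      using h actV_stabilizer[OF h(1) rep_carrier[OF j]] actV_mult[OF u w(1)] by (simp add: orb_def)
    have hit: "pt s (g i) = pt z u \<longleftrightarrow> i = j" if i: "i \<in> {1..d}" for i
    proof -
      have "pt s (g i) = pt z u \<longleftrightarrow> orb i = orb j"
        unfolding ptz[OF u] pt_eq_iff[OF s rep_carrier[OF i] uw] orbj
        using actV_mult[OF u w(1)] by (simp add: orb_def)
      then show ?thesis using orb_eq_iff[OF i j] by simp
    qed
    have "(\<Sum>i=1..d. Poly_Mapping.lookup (Poly_Mapping.single (pt s (g i)) (B (orb i) (actV l w) - B l l - 1)) (pt z u))
        = (\<Sum>i=1..d. if i = j then B (orb i) (actV l w) - B l l - 1 else 0)"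
      by (rule sum.cong[OF refl]) (simp add: lookup_single when_def hit)
    also have "\<dots> = B (actV l u) l - B l l - 1"
      using j by (simp add: orbj B_invariant w(1))
    finally have main: "(\<Sum>i=1..d. Poly_Mapping.lookup (Poly_Mapping.single (pt s (g i)) (B (orb i) (actV l w) - B l l - 1)) (pt z u))
        = B (actV l u) l - B l l - 1" .
    have "\<phi> z = pt z u \<longleftrightarrow> actV l u = l"
      using pt_eq_iff[OF z one_closed u] \<open>\<phi> z = pt z \<one>\<close> actV_one by auto
    then show ?thesis
      unfolding eq lookup_add lookup_sum main coeff_def by (simp add: lookup_single when_def)
  qed
  show "\<exists>u\<in>carrier W. y' = pt z u"
    if nz: "Poly_Mapping.lookup (kanev_unramified W act actV B l Y \<phi> \<psi> \<zeta> d g (\<phi> z)) y' \<noteq> 0"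
  proof (rule ccontr)
    assume no: "\<not> (\<exists>u\<in>carrier W. y' = pt z u)"
    have "pt s (g i) \<noteq> y'" if "i \<in> {1..d}" for i
      using no pts[OF rep_carrier[OF that]] rep_carrier[OF that] w(1) by auto
    moreover have "\<phi> z \<noteq> y'" using no \<open>\<phi> z = pt z \<one>\<close> by auto
    ultimately show False
      using nz unfolding eq lookup_add lookup_sum by (simp add: lookup_single when_def)
  qed
qed

end

lemma coeff_reps:
  assumes "k \<in> {1..d}" "i \<in> {1..d}"
  shows "coeff (g k \<otimes> inv (g i)) = B (orb k) (orb i) - B l l - 1 + (if k = i then 1 else 0)"
proof -
  note c = rep_carrier[OF assms(1)] rep_carrier[OF assms(2)]
  have "actV l (g k \<otimes> inv (g i)) = actV (orb k) (inv (g i))" using c by (simp add: actV_mult orb_def)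
  moreover have "actV (orb k) (inv (g i)) = l \<longleftrightarrow> orb k = orb i"
  proof
    assume "actV (orb k) (inv (g i)) = l"
    then have "actV (actV (orb k) (inv (g i))) (g i) = orb i" by (simp add: orb_def)
    then show "orb k = orb i" using c(2) by (simp add: actV_mult[symmetric] actV_one)
  next
    assume "orb k = orb i"
    then show "actV (orb k) (inv (g i)) = l"
      using c(2) by (simp add: orb_def[of i] actV_mult[symmetric] actV_one)
  qed
  moreover have "B (actV (orb k) (inv (g i))) l = B (orb k) (orb i)"
    using c(2) by (simp add: B_move orb_def[of i])
  ultimately show ?thesis using orb_eq_iff[OF assms] by (simp add: coeff_def)
qed

definition kmat :: "nat \<Rightarrow> nat \<Rightarrow> rat" where
  "kmat k i = B (orb k) (orb i) - B l l - 1 + (if k = i then 1 else 0)"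

definition kdeg :: rat where
  "kdeg = (\<Sum>j=1..d. coeff (g j))"

lemma coeff_H: "u \<in> carrier W \<Longrightarrow> h \<in> stabilizer_in W actV l \<Longrightarrow> coeff (h \<otimes> u) = coeff u"
  using a_left by (simp add: coeff_def)

text \<open>The columns of the matrix are obtained from each other by translating the orbit.\<close>

lemma kmat_column_sum:
  assumes "i \<in> {1..d}"
  shows "(\<Sum>k=1..d. kmat k i) = kdeg"
proof -
  have "(\<Sum>k=1..d. kmat k i) = (\<Sum>k=1..d. coeff (g k \<otimes> inv (g i)))"
    unfolding kmat_def by (rule sum.cong[OF refl]) (rule coeff_reps[OF _ assms, symmetric])
  also have "\<dots> = kdeg"
    unfolding kdeg_def using rep_carrier[OF assms] by (intro sum_reps_mult_right coeff_H) auto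
  finally show ?thesis .
qed

definition fibre_div :: "'z \<Rightarrow> (nat \<Rightarrow> rat) \<Rightarrow> ('y \<Rightarrow>\<^sub>0 rat)" where
  "fibre_div z \<alpha> = (\<Sum>k=1..d. Poly_Mapping.single (pt z (g k)) (\<alpha> k))"

definition kapply :: "(nat \<Rightarrow> rat) \<Rightarrow> nat \<Rightarrow> rat" where
  "kapply \<alpha> k = (\<Sum>i=1..d. kmat k i * \<alpha> i)"

lemma fibre_div_add: "fibre_div z \<alpha> + fibre_div z \<beta> = fibre_div z (\<lambda>k. \<alpha> k + \<beta> k)"
  by (simp add: fibre_div_def sum.distrib[symmetric] single_add)

lemma div_scale_fibre_div: "div_scale c (fibre_div z \<alpha>) = fibre_div z (\<lambda>k. c * \<alpha> k)"
  by (simp add: fibre_div_def poly_mapping_eq_iff fun_eq_iff lookup_div_scale lookup_sum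
      lookup_single when_def sum_distrib_left if_distrib cong: if_cong)

text \<open>The point \<open>pt z (g i)\<close> is the image of \<open>z (g i)^{-1}\<close>; the points of its divisor are again the
  points \<open>pt z (g k)\<close>, after a permutation of the cosets.\<close>

lemma corr_endo_fibre_div:
  assumes T: "\<And>z. z \<in> Z \<Longrightarrow> T (\<phi> z) = (\<Sum>j=1..d. Poly_Mapping.single (pt z (g j)) (coeff (g j)))"
    and z: "z \<in> Z"
  shows "corr_endo T (fibre_div z \<alpha>) = fibre_div z (kapply \<alpha>)"
proof -
  note lin = div_linear_corr_endo[of T, unfolded div_linear_def]
  have zero: "corr_endo T 0 = 0" by (simp add: corr_endo_def)
  have Tpt: "T (pt z (g i)) = fibre_div z (\<lambda>k. kmat k i)" if i: "i \<in> {1..d}" for i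
  proof -
    note gi = rep_carrier[OF i]
    have "T (pt z (g i)) = (\<Sum>j=1..d. Poly_Mapping.single (pt (act z (inv (g i))) (g j)) (coeff (g j)))"
      unfolding pt_def[of z] by (rule T) (use z gi act_closed in simp)
    also have "\<dots> = (\<Sum>j=1..d. Poly_Mapping.single (pt z (g j \<otimes> g i)) (coeff (g j \<otimes> g i \<otimes> inv (g i))))"
      by (rule sum.cong[OF refl]) (simp add: pt_act z gi rep_carrier m_assoc)
    also have "\<dots> = (\<Sum>j=1..d. Poly_Mapping.single (pt z (g j)) (coeff (g j \<otimes> inv (g i))))"
    proof (rule sum_reps_mult_right[OF _ gi])
      fix u h assume u: "u \<in> carrier W" and h: "h \<in> stabilizer_in W actV l"
      then have "h \<in> carrier W" by (simp add: stabilizer_in_def)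
      then have "h \<otimes> u \<otimes> inv (g i) = h \<otimes> (u \<otimes> inv (g i))" using u gi by (simp add: m_assoc)
      then have "coeff (h \<otimes> u \<otimes> inv (g i)) = coeff (u \<otimes> inv (g i))"
        using coeff_H[of "u \<otimes> inv (g i)" h] u gi h by simp
      then show "Poly_Mapping.single (pt z (h \<otimes> u)) (coeff (h \<otimes> u \<otimes> inv (g i)))
          = Poly_Mapping.single (pt z u) (coeff (u \<otimes> inv (g i)))"
        using pt_mult_H[OF z u h] by simp
    qed
    also have "\<dots> = fibre_div z (\<lambda>k. kmat k i)"
      unfolding fibre_div_def kmat_def by (rule sum.cong[OF refl]) (simp only: coeff_reps[OF _ i])
    finally show ?thesis .
  qed
  have single: "corr_endo T (Poly_Mapping.single y c) = div_scale c (T y)" for y c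
    using corr_endo_superset[of "{y}" "Poly_Mapping.single y c" T] by (simp split: if_splits)
  have "corr_endo T (fibre_div z \<alpha>) = (\<Sum>i=1..d. corr_endo T (Poly_Mapping.single (pt z (g i)) (\<alpha> i)))"
  proof -
    have "corr_endo T (\<Sum>i\<in>I. f i) = (\<Sum>i\<in>I. corr_endo T (f i))" for I :: "nat set" and f
      by (induction I rule: infinite_finite_induct) (simp_all add: zero lin)
    then show ?thesis by (simp add: fibre_div_def)
  qed
  also have "\<dots> = (\<Sum>i=1..d. fibre_div z (\<lambda>k. \<alpha> i * kmat k i))"
    by (rule sum.cong[OF refl]) (simp add: single Tpt div_scale_fibre_div)
  also have "\<dots> = fibre_div z (kapply \<alpha>)"
  proof -
    have single_sum: "Poly_Mapping.single y (\<Sum>i\<in>I. f i) = (\<Sum>i\<in>I. Poly_Mapping.single y (f i))"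
      for y :: 'y and I :: "nat set" and f :: "nat \<Rightarrow> rat"
      by (induction I rule: infinite_finite_induct) (simp_all add: single_add)
    show ?thesis
      unfolding fibre_div_def kapply_def single_sum
      by (subst sum.swap) (simp add: mult.commute)
  qed
  finally show ?thesis .
qed

text \<open>On vectors with sum 0 the matrix minus the identity is the Gram matrix \<open>P\<close>, which satisfies
  \<open>P\<^sup>2 = - q P\<close>. The vector \<open>\<beta>\<close> has sum 0 because all column sums are \<open>kdeg\<close>, and then so has
  \<open>\<gamma>\<close>.\<close>

lemma kapply_cubic:
  fixes \<alpha> :: "nat \<Rightarrow> rat"
  defines "\<beta> \<equiv> \<lambda>k. kapply \<alpha> k + - kdeg * \<alpha> k"
  defines "\<gamma> \<equiv> \<lambda>k. kapply \<beta> k + (kanev_q - 1) * \<beta> k"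
  assumes k: "k \<in> {1..d}"
  shows "kapply \<gamma> k + - 1 * \<gamma> k = 0"
proof -
  define P where "P \<alpha> k = (\<Sum>i=1..d. B (orb k) (orb i) * \<alpha> i)" for \<alpha> k
  have kP: "kapply \<alpha> k = P \<alpha> k - (B l l + 1) * (\<Sum>i=1..d. \<alpha> i) + \<alpha> k" if "k \<in> {1..d}" for \<alpha> k
  proof -
    have "kapply \<alpha> k = (\<Sum>i=1..d. B (orb k) (orb i) * \<alpha> i - (B l l + 1) * \<alpha> i + (if k = i then \<alpha> i else 0))"
      unfolding kapply_def kmat_def by (rule sum.cong[OF refl]) (simp add: algebra_simps)
    also have "\<dots> = P \<alpha> k - (B l l + 1) * (\<Sum>i=1..d. \<alpha> i) + (\<Sum>i=1..d. if k = i then \<alpha> i else 0)"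
      by (simp add: P_def sum.distrib sum_subtractf sum_distrib_left)
    finally show ?thesis using that by simp
  qed
  have sum_kapply: "(\<Sum>k=1..d. kapply \<alpha> k) = kdeg * (\<Sum>i=1..d. \<alpha> i)" for \<alpha>
  proof -
    have "(\<Sum>k=1..d. kapply \<alpha> k) = (\<Sum>i=1..d. (\<Sum>k=1..d. kmat k i) * \<alpha> i)"
      unfolding kapply_def by (subst sum.swap) (simp add: sum_distrib_right)
    also have "\<dots> = (\<Sum>i=1..d. kdeg * \<alpha> i)"
      by (rule sum.cong[OF refl]) (simp only: kmat_column_sum)
    finally show ?thesis by (simp add: sum_distrib_left)
  qed
  have PP: "P (P \<alpha>) k = - kanev_q * P \<alpha> k" for \<alpha> k
  proof -
    have "P (P \<alpha>) k = (\<Sum>i=1..d. (\<Sum>j=1..d. B (orb k) (orb j) * B (orb j) (orb i)) * \<alpha> i)"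
      unfolding P_def sum_distrib_left sum_distrib_right by (subst sum.swap) (simp add: mult.assoc)
    also have "\<dots> = (\<Sum>i=1..d. - kanev_q * (B (orb k) (orb i) * \<alpha> i))"
      unfolding gram_square by (simp add: mult.assoc)
    finally show ?thesis by (simp add: P_def sum_distrib_left)
  qed
  have P_add: "P (\<lambda>k. \<alpha> k + c * \<beta> k) k = P \<alpha> k + c * P \<beta> k" for \<alpha> \<beta> c k
    by (simp add: P_def algebra_simps sum.distrib sum_distrib_left)
  have "(\<Sum>k=1..d. \<beta> k) = 0"
    unfolding \<beta>_def sum.distrib sum_kapply sum_distrib_left[symmetric] by simp
  then have \<gamma>: "\<gamma> k = P \<beta> k + kanev_q * \<beta> k" if "k \<in> {1..d}" for k
    unfolding \<gamma>_def kP[OF that] by (simp add: algebra_simps)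
  have "(\<Sum>k=1..d. \<gamma> k) = 0"
    unfolding \<gamma>_def sum.distrib sum_kapply sum_distrib_left[symmetric] \<open>(\<Sum>k=1..d. \<beta> k) = 0\<close> by simp
  then have "kapply \<gamma> k + - 1 * \<gamma> k = P \<gamma> k" unfolding kP[OF k] by simp
  also have "\<dots> = P (\<lambda>k. P \<beta> k + kanev_q * \<beta> k) k"
    unfolding P_def[of \<gamma>] P_def[of "\<lambda>k. P \<beta> k + kanev_q * \<beta> k"] by (rule sum.cong[OF refl]) (simp add: \<gamma>)
  also have "\<dots> = 0" unfolding P_add PP by simp
  finally show ?thesis .
qed

theorem cubic_equation:
  assumes T: "\<And>z. z \<in> Z \<Longrightarrow> T (\<phi> z) = (\<Sum>j=1..d. Poly_Mapping.single (pt z (g j)) (coeff (g j)))"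
    and g1: "g 1 = \<one>" and D: "D \<in> div_Q Y" and "Z \<noteq> {}"
  defines "K \<equiv> corr_endo T"
  shows "((\<lambda>D. K D - D) \<circ> (\<lambda>D. K D + div_scale (kanev_q - 1) D)
          \<circ> (\<lambda>D. K D - div_scale (corr_degree Y T) D)) D = 0"
proof -
  have deg: "corr_degree Y T = kdeg"
    unfolding corr_degree_def
  proof (rule the_equality)
    have "div_degree (T (\<phi> z)) = kdeg" if "z \<in> Z" for z
      unfolding T[OF that] kdeg_def by (rule div_degree_sum_single) simp
    then show *: "\<forall>y\<in>Y. div_degree (T y) = kdeg" using \<phi>_surj by blast
    obtain z where "z \<in> Z" using \<open>Z \<noteq> {}\<close> by blast
    then have z: "\<phi> z \<in> Y" using \<phi>_surj by (metis imageI)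
    show "n = kdeg" if n: "\<forall>y\<in>Y. div_degree (T y) = n" for n
      using bspec[OF n z] bspec[OF * z] by simp
  qed
  have minus: "div_scale (- c) D = - div_scale c D" for c and D :: "'y \<Rightarrow>\<^sub>0 rat"
    by (simp add: poly_mapping_eq_iff fun_eq_iff lookup_div_scale)
  have one: "div_scale 1 D = D" for D :: "'y \<Rightarrow>\<^sub>0 rat"
    by (simp add: poly_mapping_eq_iff fun_eq_iff lookup_div_scale)
  define F where "F = (\<lambda>D. K D + div_scale (- 1) D) \<circ> (\<lambda>D. K D + div_scale (kanev_q - 1) D)
          \<circ> (\<lambda>D. K D + div_scale (- kdeg) D)"
  have F: "(\<lambda>D. K D - D) \<circ> (\<lambda>D. K D + div_scale (kanev_q - 1) D)
          \<circ> (\<lambda>D. K D - div_scale (corr_degree Y T) D) = F"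
    unfolding F_def deg by (simp add: minus one fun_eq_iff)
  have "div_linear F"
    unfolding F_def K_def by (intro div_linear_comp div_linear_add_scale div_linear_corr_endo)
  moreover have "F (Poly_Mapping.single y 1) = 0" if "y \<in> Poly_Mapping.keys D" for y
  proof -
    have "y \<in> Y" using D that by (auto simp: div_Q_def)
    then obtain z where z: "z \<in> Z" "y = \<phi> z" using \<phi>_surj by blast
    have "\<exists>j. j \<in> {1..d}" using rep_exists[OF one_closed] by metis
    then have d: "1 \<in> {1..d}" by auto
    have "y = pt z (g 1)" using z g1 by (simp add: pt_def act_one)
    then have single: "Poly_Mapping.single y 1 = fibre_div z (\<lambda>k. if k = 1 then 1 else 0)"
      using d by (simp add: fibre_div_def if_distrib[of "Poly_Mapping.single _"] cong: if_cong)
    have zero: "fibre_div z \<gamma> = 0" if "\<And>k. k \<in> {1..d} \<Longrightarrow> \<gamma> k = 0" for \<gamma>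
      using that by (simp add: fibre_div_def)
    have act: "corr_endo T (fibre_div z \<alpha>) = fibre_div z (kapply \<alpha>)" for \<alpha>
      using T z(1) by (rule corr_endo_fibre_div)
    show ?thesis
      unfolding F_def K_def single comp_def act div_scale_fibre_div fibre_div_add
      by (rule zero, rule kapply_cubic)
  qed
  ultimately show ?thesis unfolding F by (rule div_linear_eq_0)
qed

end


section \<open>The cubic equation for curves\<close>

theorem theorem3p9:
  fixes W :: "('g, 'b) monoid_scheme"
    and R :: "'e::euclidean_space set"
    and actV :: "rat^'r::finite \<Rightarrow> 'g \<Rightarrow> rat^'r"
    and S :: "(rat^'r) set"
    and l :: "rat^'r"
    and B :: "rat^'r \<Rightarrow> rat^'r \<Rightarrow> rat"
    and Z :: "'n::finite cproj set"
    and X :: "'m::finite cproj set"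
    and Y :: "'k::finite cproj set"
    and actZ :: "'n cproj \<Rightarrow> 'g \<Rightarrow> 'n cproj"
    and \<pi> :: "'n cproj \<Rightarrow> 'm cproj"
    and \<phi> :: "'n cproj \<Rightarrow> 'k cproj"
    and \<psi> :: "'k cproj \<Rightarrow> 'm cproj"
    and z :: "'m cproj \<Rightarrow> 'n cproj"
    and g :: "nat \<Rightarrow> 'g"
  defines "H \<equiv> stabilizer_in W actV l"
  defines "d \<equiv> card (rcosets\<^bsub>W\<^esub> H)"
  defines "q \<equiv> - (of_nat d * B l l) / of_nat (vec.dim (UNIV :: (rat^'r) set))"
  defines "U \<equiv> X - branch_locus Z \<pi>"
  assumes "group W" and "root_system R" and "W \<cong> weyl_group R"
    and "lattice_with_action W actV S"
    and "irreducible_action W actV"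
    and "is_weight W actV S l"
    and "weight_form W actV S l B"
    and "galois_covering W actZ Z X \<pi>"
    and "curve_quotient actZ H Z Y \<phi>"
    and "\<forall>p\<in>Z. \<psi> (\<phi> p) = \<pi> p"
    and "\<forall>\<xi>\<in>U. z \<xi> \<in> Z \<and> \<pi> (z \<xi>) = \<xi>"
    and "g 1 = \<one>\<^bsub>W\<^esub>" and "\<forall>j\<in>{1..d}. g j \<in> carrier W"
    and "carrier W = (\<Union>j\<in>{1..d}. H #>\<^bsub>W\<^esub> g j)"
  defines "T \<equiv> kanev_correspondence W actZ actV B l Y U \<phi> \<psi> z d g"
  defines "K \<equiv> corr_endo T"
  shows "(\<forall>D\<in>div_Q Y.
            ((\<lambda>D. K D - D)
             \<circ> (\<lambda>D. K D + div_scale (q - 1) D)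
             \<circ> (\<lambda>D. K D - div_scale (corr_degree Y T) D)) D = 0)
         \<and> (l \<in> S \<or> (\<exists>w\<in>carrier W. \<exists>v. actV v w \<noteq> v) \<longrightarrow> q \<in> \<nat>)"
proof -
  interpret W: group W by fact
  note cov = \<open>galois_covering W actZ Z X \<pi>\<close>[unfolded galois_covering_def]
  note quot = \<open>curve_quotient actZ H Z Y \<phi>\<close>[unfolded curve_quotient_def]
  have linear: "linear_right_action W actV"
    using \<open>lattice_with_action W actV S\<close> by (simp add: lattice_with_action_def)
  have actV: "actV v \<one>\<^bsub>W\<^esub> = v"
    "u \<in> carrier W \<Longrightarrow> w \<in> carrier W \<Longrightarrow> actV v (u \<otimes>\<^bsub>W\<^esub> w) = actV (actV v u) w" for u v w
    using linear unfolding linear_right_action_def right_action_def by blast+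
  have fin: "finite (carrier W)"
  proof -
    obtain h where "h \<in> iso W (weyl_group R)" using \<open>W \<cong> weyl_group R\<close> by (auto simp: is_iso_def)
    then have "bij_betw h (carrier W) (carrier (weyl_group R))" by (simp add: iso_def)
    then show ?thesis using finite_weyl_group[OF \<open>root_system R\<close>] bij_betw_finite by blast
  qed
  have subH: "subgroup H W"
    unfolding H_def stabilizer_in_def
  proof (rule W.subgroupI)
    fix h assume "h \<in> {h \<in> carrier W. actV l h = l}"
    then have h: "h \<in> carrier W" "actV l h = l" by auto
    then have "actV l (inv\<^bsub>W\<^esub> h) = actV (actV l h) (inv\<^bsub>W\<^esub> h)" by simp
    also have "\<dots> = l" using h(1) by (simp add: actV(2)[symmetric] actV(1))
    finally show "inv\<^bsub>W\<^esub> h \<in> {h \<in> carrier W. actV l h = l}" using h(1) by simp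
  qed (use actV in auto)
  interpret coset_representatives W H g d
  proof (intro coset_representatives.intro coset_representatives_axioms.intro W.is_group subH)
    show "\<forall>j\<in>{1..d}. g j \<in> carrier W" "carrier W = (\<Union>j\<in>{1..d}. H #>\<^bsub>W\<^esub> g j)" by fact+
    \<comment> \<open>The given cosets cover the group and there are exactly \<open>d\<close> cosets, so they are distinct.\<close>
    have cosets: "H #>\<^bsub>W\<^esub> u = H #>\<^bsub>W\<^esub> g j" if "j \<in> {1..d}" "u \<in> H #>\<^bsub>W\<^esub> g j" for u j
      using W.repr_independence[OF that(2) _ subH] \<open>\<forall>j\<in>{1..d}. g j \<in> carrier W\<close> that(1) by simp
    have "rcosets\<^bsub>W\<^esub> H = (\<lambda>j. H #>\<^bsub>W\<^esub> g j) ` {1..d}"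
    proof (intro equalityI subsetI)
      fix C assume "C \<in> rcosets\<^bsub>W\<^esub> H"
      then obtain u where u: "u \<in> carrier W" "C = H #>\<^bsub>W\<^esub> u" unfolding RCOSETS_def by blast
      then obtain j where "j \<in> {1..d}" "u \<in> H #>\<^bsub>W\<^esub> g j"
        using \<open>carrier W = (\<Union>j\<in>{1..d}. H #>\<^bsub>W\<^esub> g j)\<close> by blast
      then show "C \<in> (\<lambda>j. H #>\<^bsub>W\<^esub> g j) ` {1..d}" using cosets u(2) by blast
    next
      fix C assume "C \<in> (\<lambda>j. H #>\<^bsub>W\<^esub> g j) ` {1..d}"
      then show "C \<in> rcosets\<^bsub>W\<^esub> H"
        using \<open>\<forall>j\<in>{1..d}. g j \<in> carrier W\<close> unfolding RCOSETS_def by blast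
    qed
    then have "card ((\<lambda>j. H #>\<^bsub>W\<^esub> g j) ` {1..d}) = card {1..d}" by (simp add: d_def)
    then have inj: "inj_on (\<lambda>j. H #>\<^bsub>W\<^esub> g j) {1..d}" by (intro eq_card_imp_inj_on) auto
    fix i j h assume ij: "i \<in> {1..d}" "j \<in> {1..d}" and "h \<in> H" "g i = h \<otimes>\<^bsub>W\<^esub> g j"
    then have "g i \<in> H #>\<^bsub>W\<^esub> g j" by (auto simp: r_coset_def)
    then show "i = j" using cosets[OF ij(2)] inj_onD[OF inj] ij by blast
  qed
  have reps_l: "coset_representatives W (stabilizer_in W actV l) g d"
    using coset_representatives_axioms by (simp add: H_def)
  interpret orbit_form W actV l g d B
    by (intro orbit_form.intro orbit_form_axioms.intro reps_l linear)
      (use \<open>weight_form W actV S l B\<close> in \<open>simp_all add: weight_form_def\<close>)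
  interpret weight_orbit W actV l g d B S
    by unfold_locales fact+
  have smooth: "smooth_projective_curve Z" using quot by blast
  have compact: "compact Z"
    using compact_Int_closed[OF compact_UNIV_cproj smooth_curve_closed[OF smooth]] by simp
  interpret kanev W actV l g d B S Z actZ Y \<phi>
  proof (intro kanev.intro weighted_quotient.intro finite_quotient.intro finite_quotient_axioms.intro
      weighted_quotient_axioms.intro weight_orbit_axioms reps_l W.is_group fin)
    show "compact Z" by (rule compact)
    show "subgroup (stabilizer_in W actV l) W" using subH by (simp add: H_def)
    show "right_action W Z actZ" using cov by blast
    show "continuous_on Z (\<lambda>p. actZ p u)" if "u \<in> carrier W" for u
      by (rule regular_map_continuous_on) (use cov that in blast)
    show "continuous_on Z \<phi>" by (rule regular_map_continuous_on) (use quot in blast)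
    show "\<phi> ` Z = Y" using quot by blast
    show "\<phi> p = \<phi> p' \<longleftrightarrow> (\<exists>h\<in>stabilizer_in W actV l. p' = actZ p h)" if "p \<in> Z" "p' \<in> Z" for p p'
      using quot that unfolding H_def by blast
    show "p islimpt Z" if "p \<in> Z" for p by (rule smooth_curve_islimpt[OF smooth that])
    show "\<not> p islimpt {q \<in> Z. \<exists>g\<in>carrier W - {\<one>\<^bsub>W\<^esub>}. actZ q g = q}" for p
      by (rule galois_covering_fixed_points_discrete[OF \<open>galois_covering W actZ Z X \<pi>\<close> fin])
  qed (simp_all add: actV_stabilizer actV_stabilizer_right)
  have \<pi>: "\<pi> p = \<pi> p' \<longleftrightarrow> (\<exists>u\<in>carrier W. p' = actZ p u)" if "p \<in> Z" "p' \<in> Z" for p p'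
    using cov that unfolding curve_quotient_def by blast
  have X: "X = \<pi> ` Z" using cov unfolding curve_quotient_def by blast
  have U: "\<pi> p \<in> U \<longleftrightarrow> p \<in> free" if "p \<in> Z" for p
    unfolding U_def branch_locus_def X by (rule over_unramified_iff_free[OF \<pi> that])
  have \<psi>: "\<psi> (\<phi> p) = \<pi> p" if "p \<in> Z" for p using \<open>\<forall>p\<in>Z. \<psi> (\<phi> p) = \<pi> p\<close> that by blast
  have V: "{y\<in>Y. \<psi> y \<in> U} = \<phi> ` free"
  proof (intro equalityI subsetI)
    fix y assume "y \<in> {y\<in>Y. \<psi> y \<in> U}"
    then have "y \<in> \<phi> ` Z" "\<psi> y \<in> U" using \<phi>_surj by auto
    then obtain p where "p \<in> Z" "y = \<phi> p" "\<pi> p \<in> U" using \<psi> by auto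
    then show "y \<in> \<phi> ` free" using U by blast
  next
    fix y assume "y \<in> \<phi> ` free"
    then obtain p where p: "p \<in> free" "y = \<phi> p" by blast
    then have "p \<in> Z" by (simp add: free_def)
    then show "y \<in> {y\<in>Y. \<psi> y \<in> U}" using p U \<psi> \<phi>_surj by auto
  qed
  have z: "z (\<pi> p) \<in> Z" "\<pi> (z (\<pi> p)) = \<pi> p" if "p \<in> free" for p
  proof -
    have "\<pi> p \<in> U" using U that by (simp add: free_def)
    then show "z (\<pi> p) \<in> Z" "\<pi> (z (\<pi> p)) = \<pi> p"
      using \<open>\<forall>\<xi>\<in>U. z \<xi> \<in> Z \<and> \<pi> (z \<xi>) = \<xi>\<close> by auto
  qed
  have T: "T (\<phi> p) = (\<Sum>j=1..d. Poly_Mapping.single (pt p (g j)) (coeff (g j)))" if "p \<in> Z" for p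
    unfolding T_def kanev_correspondence_def coeff_def
  proof (rule closure_corr_eq[OF V _ _ that])
    fix p assume p: "p \<in> free"
    show "Poly_Mapping.lookup (kanev_unramified W actZ actV B l Y \<phi> \<psi> z d g (\<phi> p)) (pt p u)
        = B (actV l u) l - B l l - 1 + (if actV l u = l then 1 else 0)" if "u \<in> carrier W" for u
      using kanev_unramified_lookup(1)[where \<pi> = \<pi> and \<psi> = \<psi> and \<zeta> = z and z = p, OF \<pi> \<psi> p z[OF p] that] by (simp add: coeff_def)
    show "\<exists>u\<in>carrier W. y' = pt p u"
      if "Poly_Mapping.lookup (kanev_unramified W actZ actV B l Y \<phi> \<psi> z d g (\<phi> p)) y' \<noteq> 0" for y'
      using kanev_unramified_lookup(2)[where \<pi> = \<pi> and \<psi> = \<psi> and \<zeta> = z and z = p, OF \<pi> \<psi> p z[OF p] that] .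
  qed
  have qq: "q = kanev_q" unfolding q_def kanev_q_def vec_dim_card ..
  have "Z \<noteq> {}" using smooth_curve_variety[OF smooth] by (simp add: projective_variety_def)
  show ?thesis
    unfolding K_def qq
    using cubic_equation[OF T \<open>g 1 = \<one>\<^bsub>W\<^esub>\<close> _ \<open>Z \<noteq> {}\<close>] kanev_q_nat
      sum_orb_eq_0[OF \<open>irreducible_action W actV\<close>] by blast
qed

end
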